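(* Let $\pi\colon M\to\Lambda$ be a surjective map of lattices, let $R=R(R_1,\ldots,R_k,\pi)$ be a generalized $\pi$-twisted Cayley sum, and let $F=\pi_{\mathbb{R}}(R)$. Let $Y$ be the toric variety associated to the normally equivalent lattice polytopes $R_i$. Then there exists a toric morphism $X_R\to Y$ with generic fiber $X_F$.
   Context: For a lattice $M$ (a finitely generated free abelian group) write $M_{\mathbb{R}}=M\otimes\mathbb{R}$; $\pi_{\mathbb{R}}\colon M_{\mathbb{R}}\to\Lambda_{\mathbb{R}}$ is the linear extension of $\pi$. A lattice polytope in $M_{\mathbb{R}}$ is the convex hull of finitely many points of $M$. Two polytopes $P,Q$ of the same dimension are strictly combinatorially isomorphic if there is a bijective inclusion-preserving map $\varphi$ from the set of faces of $P$ to the set of faces of $Q$ such that for each face $G$ of $P$ the affine hulls of $G$ and $\varphi(G)$ are translates of each other. Under this assumption, they are called normally equivalent if moreover their inner normal fans coincide; normally equivalent lattice polytopes define the same toric variety. Generalized $\pi$-twisted Cayley sum: let $R_1,\ldots,R_k\subseteq M_{\mathbb{R}}$ be normally equivalent lattice polytopes and let $R=\mathrm{Conv}(R_1,\ldots,R_k)$. Assume that $\pi_{\mathbb{R}}(R_i)=v_i$ is a lattice point of $\Lambda$ for all $i$, and let $F=\mathrm{Conv}(v_1,\ldots,v_k)$. Then the polytope fibration $\pi_{\mathbb{R}}|_R\colon R\to F$ is called a generalized $\pi$-twisted Cayley sum, written $R=R(R_1,\ldots,R_k,\pi)$. For a lattice polytope $S$, $X_S$ denotes the projective toric variety associated to $S$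 (that is, to its inner normal fan).
   Formalization: Each R_i is additionally assumed to have dimension equal to that of the kernel of π_R; without this the claim fails, e.g. M = Z, Λ = 0, R_1 = {0}, R_2 = {1} gives X_R = P^1 while Y and X_F are points. *)

theory Defs
  imports "HOL-Analysis.Analysis" "HOL-Computational_Algebra.Polynomial" "HOL-Algebra.Group"
begin

section \<open>Lattices and polytopes\<close>

text \<open>
  A lattice \<open>M\<close> is realised inside a real vector space as the integer span of linearly independent
  vectors. Then \<open>M \<otimes> \<real>\<close> is \<open>span M\<close>, which may be a proper subspace, so rank 0 is allowed.
  The inner product of the ambient space identifies \<open>span M\<close> with its dual; thus the normal cones
  below are sets of vectors \<open>u\<close>, standing for the linear forms \<open>x \<mapsto> u \<bullet> x\<close>.
\<close>

definition is_lattice :: "'a::euclidean_space set \<Rightarrow> bool" where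
  "is_lattice M \<longleftrightarrow>
     (\<exists>B. independent B \<and> M = {\<Sum>b\<in>B. real_of_int (c b) *\<^sub>R b | c :: 'a \<Rightarrow> int. True})"

definition lattice_surjection ::
  "'a::euclidean_space set \<Rightarrow> 'b::euclidean_space set \<Rightarrow> ('a \<Rightarrow> 'b) \<Rightarrow> bool" where
  "lattice_surjection M \<Lambda> \<pi> \<longleftrightarrow> (\<forall>x\<in>M. \<forall>y\<in>M. \<pi> (x + y) = \<pi> x + \<pi> y) \<and> \<pi> ` M = \<Lambda>"

text \<open>Only the values of \<open>\<pi>\<^sub>\<real>\<close> on \<open>span M\<close>, where it is determined by \<open>\<pi>\<close>, ever matter.\<close>

definition is_real_extension ::
  "'a::euclidean_space set \<Rightarrow> ('a \<Rightarrow> 'b::euclidean_space) \<Rightarrow> ('a \<Rightarrow> 'b) \<Rightarrow> bool" where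
  "is_real_extension M \<pi> \<pi>\<^sub>R \<longleftrightarrow> linear \<pi>\<^sub>R \<and> (\<forall>m\<in>M. \<pi>\<^sub>R m = \<pi> m)"

definition lattice_polytope :: "'a::euclidean_space set \<Rightarrow> 'a set \<Rightarrow> bool" where
  "lattice_polytope M P \<longleftrightarrow> (\<exists>S. finite S \<and> S \<subseteq> M \<and> P = convex hull S)"

definition inner_normal_cone :: "'a::euclidean_space set \<Rightarrow> 'a set \<Rightarrow> 'a set" where
  "inner_normal_cone P G = {u. \<forall>x\<in>G. \<forall>y\<in>P. u \<bullet> x \<le> u \<bullet> y}"

text \<open>
  If \<open>P\<close> is not full-dimensional this is a generalized fan: all its cones contain the subspace of
  forms that are constant on \<open>P\<close>.
\<close>

definition inner_normal_fan :: "'a::euclidean_space set \<Rightarrow> 'a set set" where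
  "inner_normal_fan P = {inner_normal_cone P G | G. G face_of P \<and> G \<noteq> {}}"

definition strictly_combinatorially_isomorphic ::
  "'a::euclidean_space set \<Rightarrow> 'a set \<Rightarrow> bool" where
  "strictly_combinatorially_isomorphic P Q \<longleftrightarrow>
     aff_dim P = aff_dim Q \<and>
     (\<exists>\<phi>. bij_betw \<phi> {G. G face_of P} {G. G face_of Q} \<and>
          (\<forall>G H. G face_of P \<and> H face_of P \<and> G \<subseteq> H \<longrightarrow> \<phi> G \<subseteq> \<phi> H) \<and>
          (\<forall>G. G face_of P \<longrightarrow> (\<exists>a. affine hull (\<phi> G) = (\<lambda>x. a + x) ` (affine hull G))))"

definition normally_equivalent :: "'a::euclidean_space set \<Rightarrow> 'a set \<Rightarrow> bool" where
  "normally_equivalent P Q \<longleftrightarrow>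
     strictly_combinatorially_isomorphic P Q \<and> inner_normal_fan P = inner_normal_fan Q"

text \<open>\<open>R = R(R\<^sub>1, \<dots>, R\<^sub>k, \<pi>)\<close> with \<open>R\<^sub>i\<close> given as \<open>Rs i\<close>.\<close>

definition generalized_twisted_Cayley_sum ::
  "'a::euclidean_space set \<Rightarrow> 'b::euclidean_space set \<Rightarrow> ('a \<Rightarrow> 'b) \<Rightarrow>
   nat \<Rightarrow> (nat \<Rightarrow> 'a set) \<Rightarrow> 'a set \<Rightarrow> bool" where
  "generalized_twisted_Cayley_sum M \<Lambda> \<pi>\<^sub>R k Rs R \<longleftrightarrow>
     (\<forall>i\<in>{1..k}. lattice_polytope M (Rs i)) \<and>
     (\<forall>i\<in>{1..k}. \<forall>j\<in>{1..k}. normally_equivalent (Rs i) (Rs j)) \<and>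
     (\<forall>i\<in>{1..k}. \<exists>v\<in>\<Lambda>. \<pi>\<^sub>R ` Rs i = {v}) \<and>
     R = convex hull (\<Union>i\<in>{1..k}. Rs i)"


section \<open>Varieties as spaces with functions\<close>

text \<open>
  Varieties over an algebraically closed field \<open>'k\<close> in the classical sense: the set of closed points
  with the Zariski topology and, for every open set \<open>W\<close>, the functions that are regular on \<open>W\<close>
  (values outside \<open>W\<close> are irrelevant).
\<close>

record ('p, 'k) variety =
  zariski :: "'p topology"
  regular :: "'p set \<Rightarrow> ('p \<Rightarrow> 'k) set"

abbreviation points :: "('p, 'k, 'z) variety_scheme \<Rightarrow> 'p set" where
  "points X \<equiv> topspace (zariski X)"

definition variety_morphism ::
  "('p, 'k, 'y) variety_scheme \<Rightarrow> ('q, 'k, 'z) variety_scheme \<Rightarrow> ('p \<Rightarrow> 'q) \<Rightarrow> bool" where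
  "variety_morphism X Y f \<longleftrightarrow>
     continuous_map (zariski X) (zariski Y) f \<and>
     (\<forall>V g. openin (zariski Y) V \<and> g \<in> regular Y V \<longrightarrow> g \<circ> f \<in> regular X (points X \<inter> f -` V))"

definition variety_isomorphism ::
  "('p, 'k, 'y) variety_scheme \<Rightarrow> ('q, 'k, 'z) variety_scheme \<Rightarrow> ('p \<Rightarrow> 'q) \<Rightarrow> bool" where
  "variety_isomorphism X Y f \<longleftrightarrow>
     variety_morphism X Y f \<and>
     (\<exists>g. variety_morphism Y X g \<and> (\<forall>x\<in>points X. g (f x) = x) \<and> (\<forall>y\<in>points Y. f (g y) = y))"

definition open_subvariety :: "('p, 'k, 'z) variety_scheme \<Rightarrow> 'p set \<Rightarrow> ('p, 'k) variety" where
  "open_subvariety X U = \<lparr>zariski = subtopology (zariski X) U, regular = regular X\<rparr>"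

text \<open>
  A family \<open>\<C>\<close> of charts \<open>(D, A)\<close>, where \<open>A\<close> is a ring of functions on \<open>D\<close>, determines a space with
  functions: the sets \<open>{p \<in> D. t p \<noteq> 0}\<close> with \<open>t \<in> A\<close> form a basis of the topology, and a function is
  regular if around every point it is a quotient \<open>s / t\<close> with \<open>s, t \<in> A\<close> for some chart.
\<close>

definition variety_of_charts ::
  "('p set \<times> ('p \<Rightarrow> 'k::field) set) set \<Rightarrow> ('p, 'k) variety" where
  "variety_of_charts \<C> =
     \<lparr>zariski = topology_generated_by {{p\<in>D. t p \<noteq> 0} | D A t. (D, A) \<in> \<C> \<and> t \<in> A},
      regular = (\<lambda>W. {f. \<forall>p\<in>W. \<exists>(D, A)\<in>\<C>. \<exists>s\<in>A. \<exists>t\<in>A. p \<in> D \<and> t p \<noteq> 0 \<and>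
                             (\<forall>q\<in>W \<inter> D. t q \<noteq> 0 \<longrightarrow> f q = s q / t q)})\<rparr>"

text \<open>
  The product of varieties: the charts are \<open>U \<times> V\<close> with \<open>U\<close>, \<open>V\<close> open, carrying the image of
  \<open>\<O>(U) \<otimes> \<O>(V)\<close>. The topology is finer than the product topology.
\<close>

definition variety_product ::
  "('p, 'k::field, 'y) variety_scheme \<Rightarrow> ('q, 'k, 'z) variety_scheme \<Rightarrow> ('p \<times> 'q, 'k) variety" where
  "variety_product X Y = variety_of_charts
     {(U \<times> V, {\<lambda>(x, y). \<Sum>i<n. a i x * b i y | (n::nat) a b.
                  (\<forall>i<n. a i \<in> regular X U \<and> b i \<in> regular Y V)}) | U V.
        openin (zariski X) U \<and> openin (zariski Y) V}"

text \<open>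
  \<open>f : X \<rightarrow> Y\<close> (with \<open>Y\<close> irreducible) has generic fiber \<open>Z\<close>. The fiber over the generic point of \<open>Y\<close>
  is the limit of the varieties \<open>f\<^sup>-\<^sup>1(U)\<close> over the nonempty open \<open>U \<subseteq> Y\<close>, and an isomorphism of it
  with \<open>Z\<close> (base-changed to the function field of \<open>Y\<close>) is the germ of an isomorphism
  \<open>U \<times> Z \<cong> f\<^sup>-\<^sup>1(U)\<close> over \<open>U\<close>. In particular every fiber over a point of \<open>U\<close> is then isomorphic to \<open>Z\<close>.
\<close>

definition has_generic_fiber ::
  "('p, 'k::field, 'x) variety_scheme \<Rightarrow> ('q, 'k, 'y) variety_scheme \<Rightarrow> ('p \<Rightarrow> 'q) \<Rightarrow>
   ('r, 'k, 'z) variety_scheme \<Rightarrow> bool" where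
  "has_generic_fiber X Y f Z \<longleftrightarrow>
     (\<exists>U \<psi>. openin (zariski Y) U \<and> U \<noteq> {} \<and>
        variety_isomorphism (variety_product (open_subvariety Y U) Z)
                            (open_subvariety X (points X \<inter> f -` U)) \<psi> \<and>
        (\<forall>y\<in>U. \<forall>z\<in>points Z. f (\<psi> (y, z)) = y))"


section \<open>Toric varieties\<close>

text \<open>A toric variety comes with its torus, an open subset with a group structure.\<close>

record ('p, 'k) toric_variety = "('p, 'k) variety" +
  torus :: "'p monoid"

definition toric_morphism ::
  "('p, 'k) toric_variety \<Rightarrow> ('q, 'k) toric_variety \<Rightarrow> ('p \<Rightarrow> 'q) \<Rightarrow> bool" where
  "toric_morphism X Y f \<longleftrightarrow> variety_morphism X Y f \<and> f \<in> hom (torus X) (torus Y)"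

definition dual_cone :: "'a::euclidean_space set \<Rightarrow> 'a set" where
  "dual_cone \<sigma> = {m. \<forall>u\<in>\<sigma>. 0 \<le> u \<bullet> m}"

definition cone_monoid :: "'a::euclidean_space set \<Rightarrow> 'a set \<Rightarrow> 'a set" where
  "cone_monoid M \<sigma> = M \<inter> dual_cone \<sigma>"

text \<open>
  The points of the affine toric variety \<open>U\<^sub>\<sigma> = Spec k[\<sigma>\<^sup>\<or> \<inter> M]\<close>, as monoid homomorphisms
  from \<open>\<sigma>\<^sup>\<or> \<inter> M\<close> to \<open>(k, \<cdot>)\<close>.
\<close>

definition affine_toric :: "'a::euclidean_space set \<Rightarrow> 'a set \<Rightarrow> ('a \<Rightarrow> 'k::field) set" where
  "affine_toric M \<sigma> =
     {\<gamma> \<in> extensional (cone_monoid M \<sigma>).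
        \<gamma> 0 = 1 \<and> (\<forall>m\<in>cone_monoid M \<sigma>. \<forall>m'\<in>cone_monoid M \<sigma>. \<gamma> (m + m') = \<gamma> m * \<gamma> m')}"

text \<open>
  \<open>X\<^sub>\<Sigma>\<close> is the disjoint union of the \<open>U\<^sub>\<sigma>\<close>, \<open>\<sigma> \<in> \<Sigma>\<close>, with \<open>U\<^sub>\<sigma>\<close> and \<open>U\<^sub>\<tau>\<close> glued along \<open>U\<^bsub>\<sigma> \<inter> \<tau>\<^esub>\<close>.
  A point is thus a class of pairs \<open>(\<sigma>, \<gamma>)\<close> with \<open>\<gamma> \<in> U\<^sub>\<sigma>\<close>.
  The definitions also apply to a generalized fan \<open>\<Sigma>\<close> and then give the toric variety of the fan
  obtained by dividing by the lineality space \<open>L\<close>, with character lattice the part of \<open>M\<close> orthogonal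
  to \<open>L\<close>: all the dual cones are orthogonal to \<open>L\<close>.
\<close>

type_synonym ('a, 'k) toric_point = "('a set \<times> ('a \<Rightarrow> 'k)) set"

definition toric_glue ::
  "'a::euclidean_space set \<Rightarrow> 'a set set \<Rightarrow>
   (('a set \<times> ('a \<Rightarrow> 'k::field)) \<times> ('a set \<times> ('a \<Rightarrow> 'k))) set" where
  "toric_glue M \<Sigma> =
     {((\<sigma>, \<gamma>), (\<tau>, \<eta>)). \<sigma> \<in> \<Sigma> \<and> \<tau> \<in> \<Sigma> \<and> \<gamma> \<in> affine_toric M \<sigma> \<and> \<eta> \<in> affine_toric M \<tau> \<and>
        (\<exists>\<delta>\<in>affine_toric M (\<sigma> \<inter> \<tau>).
           restrict \<delta> (cone_monoid M \<sigma>) = \<gamma> \<and> restrict \<delta> (cone_monoid M \<tau>) = \<eta>)}"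

definition toric_pt ::
  "'a::euclidean_space set \<Rightarrow> 'a set set \<Rightarrow> 'a set \<Rightarrow> ('a \<Rightarrow> 'k::field) \<Rightarrow> ('a, 'k) toric_point" where
  "toric_pt M \<Sigma> \<sigma> \<gamma> = toric_glue M \<Sigma> `` {(\<sigma>, \<gamma>)}"

definition toric_chart ::
  "'a::euclidean_space set \<Rightarrow> 'a set set \<Rightarrow> 'a set \<Rightarrow> ('a, 'k::field) toric_point set" where
  "toric_chart M \<Sigma> \<sigma> = toric_pt M \<Sigma> \<sigma> ` affine_toric M \<sigma>"

text \<open>The element of \<open>U\<^sub>\<sigma>\<close> representing a point of the chart, i.e. \<open>m \<mapsto> \<chi>\<^sup>m(x)\<close> for \<open>m \<in> \<sigma>\<^sup>\<or> \<inter> M\<close>.\<close>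

definition toric_coord :: "'a set \<Rightarrow> ('a, 'k) toric_point \<Rightarrow> 'a \<Rightarrow> 'k" where
  "toric_coord \<sigma> x = (THE \<gamma>. (\<sigma>, \<gamma>) \<in> x)"

definition toric_chart_ring ::
  "'a::euclidean_space set \<Rightarrow> 'a set \<Rightarrow> (('a, 'k::field) toric_point \<Rightarrow> 'k) set" where
  "toric_chart_ring M \<sigma> =
     {\<lambda>x. \<Sum>m\<in>A. c m * toric_coord \<sigma> x m | A c. finite A \<and> A \<subseteq> cone_monoid M \<sigma>}"

text \<open>The torus is the chart of the smallest cone, with pointwise multiplication of homomorphisms.\<close>

definition fan_torus ::
  "'a::euclidean_space set \<Rightarrow> 'a set set \<Rightarrow> ('a, 'k::field) toric_point monoid" where
  "fan_torus M \<Sigma> =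
     (let \<sigma> = \<Inter>\<Sigma> in
      \<lparr>carrier = toric_chart M \<Sigma> \<sigma>,
       monoid.mult = (\<lambda>x y. toric_pt M \<Sigma> \<sigma>
          (\<lambda>m\<in>cone_monoid M \<sigma>. toric_coord \<sigma> x m * toric_coord \<sigma> y m)),
       one = toric_pt M \<Sigma> \<sigma> (\<lambda>m\<in>cone_monoid M \<sigma>. 1)\<rparr>)"

definition fan_toric_variety ::
  "'a::euclidean_space set \<Rightarrow> 'a set set \<Rightarrow> (('a, 'k::field) toric_point, 'k) toric_variety" where
  "fan_toric_variety M \<Sigma> =
     (let X = variety_of_charts {(toric_chart M \<Sigma> \<sigma>, toric_chart_ring M \<sigma>) | \<sigma>. \<sigma> \<in> \<Sigma>} in
      \<lparr>zariski = zariski X, regular = regular X, torus = fan_torus M \<Sigma>\<rparr>)"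

definition polytope_toric_variety ::
  "'a::euclidean_space set \<Rightarrow> 'a set \<Rightarrow> (('a, 'k::field) toric_point, 'k) toric_variety" where
  "polytope_toric_variety M P = fan_toric_variety M (inner_normal_fan P)"

end

theory Submission
  imports Defs
begin

text \<open>
  If a linear form is minimal on a face \<open>G\<close> of \<open>R\<close>, it is minimal on \<open>G \<inter> R\<^sub>i\<close> for an \<open>i\<close> with
  \<open>G \<inter> R\<^sub>i \<noteq> {}\<close>. Hence each normal cone of \<open>R\<close> lies in a normal cone of some \<open>R\<^sub>i\<close>, which is also a normal
  cone of \<open>R\<^sub>j\<close>, and the identity of \<open>M\<close> induces \<open>X\<^sub>R \<rightarrow> Y\<close>. Over the torus of \<open>Y\<close> only those points of
  \<open>X\<^sub>R\<close> survive at which no character in \<open>ker \<pi>\<close> vanishes. They are covered by the charts of the cones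
  that are pulled back along \<open>\<pi>\<close> from normal cones \<open>\<tau>\<close> of \<open>F\<close>, whose monoids are
  \<open>{m \<in> M. \<pi> m \<in> \<tau>\<^sup>\<or>}\<close>. A splitting \<open>s\<close> of \<open>\<pi>\<close> decomposes such a monoid as
  \<open>ker \<pi> \<oplus> s (\<tau>\<^sup>\<or> \<inter> \<Lambda>)\<close>, which trivialises the family over the torus with fiber \<open>X\<^sub>F\<close>.
\<close>


section \<open>Spaces with functions and their charts\<close>

text \<open>The trivialisation needs the torus of \<open>Y\<close> to have all of
  \<open>ker \<pi>\<close> as its character group. This is what \<open>full_dim\<close> supplies:
  the least cone of the normal fan of each \<open>R_i\<close> then has \<open>ker \<pi>\<close> as
  its monoid. Smaller \<open>R_i\<close> break the conclusion: for \<pi> = 0, \<open>R_1\<close> a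
  lattice segment and \<open>R_2\<close> its translate by an independent vector, \<open>R\<close> is
  a parallelogram and \<open>F\<close> a point, but the map from \<open>X_R\<close> to
  \<open>Y\<close> has one-dimensional fibers.

  Points are gluing classes, so the gluing must be controlled before any map can be written down.
  Three devices do this. A representative of a point determines a partial function on characters,
  its germ, and two representatives are glued iff their germs agree; so gluing is an equivalence
  relation. Normal cones are indexed by arbitrary nonempty subsets of a finite generating set, so
  that intersecting cones is uniting subsets. And \<open>dual_normal_cone_localize\<close>, a
  consequence of Farkas' lemma, yields the monomials to be inverted, both to intersect charts and to
  move from a chart of \<open>X_R\<close> to one pulled back from \<open>F\<close>.\<close>

lemma openin_vimage_continuous_map:
  assumes "continuous_map X Y f" "openin Y V"
  shows "openin X (topspace X \<inter> f -` V)"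
proof -
  have "topspace X \<inter> f -` V = {x \<in> topspace X. f x \<in> V}" by blast
  then show ?thesis using openin_continuous_map_preimage[OF assms] by simp
qed

text \<open>The record \<open>variety\<close> has no axioms. Collected here are the sheaf property
  and the properties of rings of functions on which the construction of morphisms relies; the last
  two allow division wherever a function does not vanish. Values outside \<open>W\<close> are
  immaterial, hence \<open>regular_cong\<close>.\<close>

locale function_space =
  fixes X :: "('p, 'k::field, 'z) variety_scheme"
  assumes regular_cong:
      "\<lbrakk>f \<in> regular X W; openin (zariski X) W; \<And>p. p \<in> W \<Longrightarrow> g p = f p\<rbrakk> \<Longrightarrow> g \<in> regular X W"
    and regular_restrict:
      "\<lbrakk>f \<in> regular X W; openin (zariski X) W; openin (zariski X) V; V \<subseteq> W\<rbrakk> \<Longrightarrow> f \<in> regular X V"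
    and regular_local:
      "\<lbrakk>openin (zariski X) W; \<And>p. p \<in> W \<Longrightarrow> \<exists>V. openin (zariski X) V \<and> p \<in> V \<and> V \<subseteq> W \<and> f \<in> regular X V\<rbrakk>
        \<Longrightarrow> f \<in> regular X W"
    and regular_const: "openin (zariski X) W \<Longrightarrow> (\<lambda>_. c) \<in> regular X W"
    and regular_add:
      "\<lbrakk>openin (zariski X) W; f \<in> regular X W; g \<in> regular X W\<rbrakk> \<Longrightarrow> (\<lambda>p. f p + g p) \<in> regular X W"
    and regular_mult:
      "\<lbrakk>openin (zariski X) W; f \<in> regular X W; g \<in> regular X W\<rbrakk> \<Longrightarrow> (\<lambda>p. f p * g p) \<in> regular X W"
    and openin_nonzero:
      "\<lbrakk>openin (zariski X) W; f \<in> regular X W\<rbrakk> \<Longrightarrow> openin (zariski X) {p\<in>W. f p \<noteq> 0}"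
    and regular_inverse:
      "\<lbrakk>openin (zariski X) W; f \<in> regular X W\<rbrakk>
        \<Longrightarrow> (\<lambda>p. inverse (f p)) \<in> regular X {p\<in>W. f p \<noteq> 0}"
begin

lemma regular_sum:
  assumes "openin (zariski X) W" "\<And>i. i \<in> I \<Longrightarrow> f i \<in> regular X W"
  shows "(\<lambda>p. \<Sum>i\<in>I. f i p) \<in> regular X W"
  using assms(2)
proof (induction I rule: infinite_finite_induct)
  case (insert i I)
  then have "(\<lambda>p. f i p + (\<Sum>i\<in>I. f i p)) \<in> regular X W"
    by (intro regular_add assms(1)) auto
  then show ?case using insert by simp
qed (use regular_const[OF assms(1), of 0] in auto)

lemma regular_power:
  assumes "openin (zariski X) W" "f \<in> regular X W"
  shows "(\<lambda>p. f p ^ n) \<in> regular X W"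
  by (induction n) (auto intro!: regular_const regular_mult assms)

lemma function_space_open_subvariety:
  assumes U: "openin (zariski X) U"
  shows "function_space (open_subvariety X U)"
proof -
  have [simp]: "openin (zariski (open_subvariety X U)) W \<longleftrightarrow> openin (zariski X) W \<and> W \<subseteq> U" for W
    using openin_open_subtopology[OF U] by (simp add: open_subvariety_def)
  have [simp]: "regular (open_subvariety X U) = regular X"
    by (simp add: open_subvariety_def)
  show ?thesis
  proof
    fix f W assume W: "openin (zariski (open_subvariety X U)) W"
      and *: "\<And>p. p \<in> W \<Longrightarrow> \<exists>V. openin (zariski (open_subvariety X U)) V \<and> p \<in> V \<and> V \<subseteq> W \<and>
          f \<in> regular (open_subvariety X U) V"
    show "f \<in> regular (open_subvariety X U) W"
      using W * by (auto intro!: regular_local) (meson *)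
  next
    fix f W assume W: "openin (zariski (open_subvariety X U)) W" and f: "f \<in> regular (open_subvariety X U) W"
    show "openin (zariski (open_subvariety X U)) {p \<in> W. f p \<noteq> 0}"
      using openin_nonzero[of W f] W f by auto
  qed (auto intro: regular_cong regular_restrict regular_const regular_add regular_mult regular_inverse)
qed

end

lemma points_open_subvariety: "points (open_subvariety X U) = points X \<inter> U"
  by (simp add: open_subvariety_def)

lemma function_space_cong:
  assumes "function_space X" "zariski Y = zariski X" "regular Y = regular X"
  shows "function_space Y"
  using assms(1) unfolding function_space_def assms(2,3) .

lemma variety_morphism_cong:
  assumes "zariski X' = zariski X" "regular X' = regular X" "zariski Y' = zariski Y" "regular Y' = regular Y"
  shows "variety_morphism X' Y' f \<longleftrightarrow> variety_morphism X Y f"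
  unfolding variety_morphism_def assms ..

section \<open>Spaces with functions given by charts\<close>

lemma regular_variety_of_charts:
  "f \<in> regular (variety_of_charts C) W \<longleftrightarrow>
    (\<forall>p\<in>W. \<exists>D A s t. (D, A) \<in> C \<and> s \<in> A \<and> t \<in> A \<and> p \<in> D \<and> t p \<noteq> 0 \<and>
       (\<forall>q\<in>W \<inter> D. t q \<noteq> 0 \<longrightarrow> f q = s q / t q))"
  by (simp add: variety_of_charts_def Bex_def split_paired_Ex)
    (intro ball_cong refl iff_exI, auto)

text \<open>Functions count only on their chart \<open>D\<close>, so closure of \<open>A\<close>
  under the ring operations is demanded only there. \<open>chart_refine\<close> lets two quotients
  living on different charts be written over one denominator on a smaller chart.\<close>

locale chart_atlas =
  fixes C :: "('p set \<times> ('p \<Rightarrow> 'k::field) set) set"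
  assumes chart_const: "(D, A) \<in> C \<Longrightarrow> \<exists>s\<in>A. \<forall>q\<in>D. s q = c"
    and chart_add: "\<lbrakk>(D, A) \<in> C; s \<in> A; t \<in> A\<rbrakk> \<Longrightarrow> \<exists>r\<in>A. \<forall>q\<in>D. r q = s q + t q"
    and chart_mult: "\<lbrakk>(D, A) \<in> C; s \<in> A; t \<in> A\<rbrakk> \<Longrightarrow> \<exists>r\<in>A. \<forall>q\<in>D. r q = s q * t q"
    and chart_refine: "\<lbrakk>(D1, A1) \<in> C; (D2, A2) \<in> C; p \<in> D1; p \<in> D2\<rbrakk> \<Longrightarrow>
      \<exists>(D, A)\<in>C. p \<in> D \<and> D \<subseteq> D1 \<inter> D2 \<and> (\<forall>s\<in>A1 \<union> A2. \<exists>s'\<in>A. \<forall>q\<in>D. s' q = s q)"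
begin

text \<open>Unlike in the clause of \<open>regular\<close>, the basic neighbourhood
  \<open>{q\<in>D. t q \<noteq> 0}\<close> must lie inside \<open>W\<close>. Hence openness of
  \<open>W\<close> is the case \<open>f = 0\<close>, and topology and regularity are handled by the
  same lemmas.\<close>

definition local_quotient :: "'p set \<Rightarrow> ('p \<Rightarrow> 'k) \<Rightarrow> 'p \<Rightarrow> bool" where
  "local_quotient W f p \<longleftrightarrow> (\<exists>D A s t. (D, A) \<in> C \<and> s \<in> A \<and> t \<in> A \<and> p \<in> D \<and> t p \<noteq> 0 \<and>
     (\<forall>q\<in>D. t q \<noteq> 0 \<longrightarrow> q \<in> W \<and> f q = s q / t q))"

lemma local_quotientI:
  assumes "(D, A) \<in> C" "s \<in> A" "t \<in> A" "p \<in> D" "t p \<noteq> 0"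
    "\<And>q. q \<in> D \<Longrightarrow> t q \<noteq> 0 \<Longrightarrow> q \<in> W \<and> f q = s q / t q"
  shows "local_quotient W f p"
  using assms unfolding local_quotient_def by blast

lemma local_quotientE:
  assumes "local_quotient W f p"
  obtains D A s t where "(D, A) \<in> C" "s \<in> A" "t \<in> A" "p \<in> D" "t p \<noteq> 0"
    "\<And>q. q \<in> D \<Longrightarrow> t q \<noteq> 0 \<Longrightarrow> q \<in> W \<and> f q = s q / t q"
  using assms unfolding local_quotient_def by blast

text \<open>The common denominator is the product of \<open>t1\<close> and \<open>t2\<close> on a
  refined chart; where it does not vanish, both original quotients are valid.\<close>

lemma local_quotient_common:
  assumes "local_quotient W f p" "local_quotient V g p"
  obtains D A s s' t where "(D, A) \<in> C" "s \<in> A" "s' \<in> A" "t \<in> A" "p \<in> D" "t p \<noteq> 0"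
    "\<And>q. q \<in> D \<Longrightarrow> t q \<noteq> 0 \<Longrightarrow> q \<in> W \<inter> V \<and> f q = s q / t q \<and> g q = s' q / t q"
proof -
  obtain D1 A1 s1 t1 where 1: "(D1, A1) \<in> C" "s1 \<in> A1" "t1 \<in> A1" "p \<in> D1" "t1 p \<noteq> 0"
     "\<And>q. q \<in> D1 \<Longrightarrow> t1 q \<noteq> 0 \<Longrightarrow> q \<in> W \<and> f q = s1 q / t1 q"
    using assms(1) by (rule local_quotientE) auto
  obtain D2 A2 s2 t2 where 2: "(D2, A2) \<in> C" "s2 \<in> A2" "t2 \<in> A2" "p \<in> D2" "t2 p \<noteq> 0"
     "\<And>q. q \<in> D2 \<Longrightarrow> t2 q \<noteq> 0 \<Longrightarrow> q \<in> V \<and> g q = s2 q / t2 q"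
    using assms(2) by (rule local_quotientE) auto
  obtain D A where D: "(D, A) \<in> C" "p \<in> D" "D \<subseteq> D1 \<inter> D2"
    and r: "\<And>s. s \<in> A1 \<union> A2 \<Longrightarrow> \<exists>s'\<in>A. \<forall>q\<in>D. s' q = s q"
    using chart_refine[OF 1(1) 2(1) 1(4) 2(4)] by blast
  obtain u1 where u1: "u1 \<in> A" "\<forall>q\<in>D. u1 q = s1 q" using r[of s1] 1 by blast
  obtain u2 where u2: "u2 \<in> A" "\<forall>q\<in>D. u2 q = s2 q" using r[of s2] 2 by blast
  obtain v1 where v1: "v1 \<in> A" "\<forall>q\<in>D. v1 q = t1 q" using r[of t1] 1 by blast
  obtain v2 where v2: "v2 \<in> A" "\<forall>q\<in>D. v2 q = t2 q" using r[of t2] 2 by blast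
  obtain t where t: "t \<in> A" "\<forall>q\<in>D. t q = v1 q * v2 q" using chart_mult[OF D(1) v1(1) v2(1)] by blast
  obtain s where s: "s \<in> A" "\<forall>q\<in>D. s q = u1 q * v2 q" using chart_mult[OF D(1) u1(1) v2(1)] by blast
  obtain s' where s': "s' \<in> A" "\<forall>q\<in>D. s' q = u2 q * v1 q" using chart_mult[OF D(1) u2(1) v1(1)] by blast
  show ?thesis
  proof (rule that[OF D(1) s(1) s'(1) t(1) D(2)])
    show "t p \<noteq> 0" using t v1 v2 D 1 2 by auto
    fix q assume q: "q \<in> D" "t q \<noteq> 0"
    then have "t1 q \<noteq> 0" "t2 q \<noteq> 0" "q \<in> D1" "q \<in> D2" using t v1 v2 D by auto
    then show "q \<in> W \<inter> V \<and> f q = s q / t q \<and> g q = s' q / t q"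
      using 1(6) 2(6) q t s s' u1 u2 v1 v2 by auto
  qed
qed

lemma local_quotient_mono:
  assumes "local_quotient W f p" "W \<subseteq> V" "\<And>q. q \<in> W \<Longrightarrow> g q = f q"
  shows "local_quotient V g p"
proof -
  obtain D A s t where D: "(D, A) \<in> C" "s \<in> A" "t \<in> A" "p \<in> D" "t p \<noteq> 0"
    and q: "\<And>q. q \<in> D \<Longrightarrow> t q \<noteq> 0 \<Longrightarrow> q \<in> W \<and> f q = s q / t q"
    using assms(1) by (rule local_quotientE) auto
  show ?thesis by (rule local_quotientI[OF D]) (use q assms(2,3) in auto)
qed

text \<open>The generating sets form a basis and not merely a subbasis: by passing to a common
  denominator, an intersection of two of them contains a basic set around each of its
  points.\<close>

lemma openin_chart_topology:
  "openin (zariski (variety_of_charts C)) W \<longleftrightarrow> (\<forall>p\<in>W. local_quotient W (\<lambda>_. 0) p)"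
proof
  define \<B> where "\<B> = {{p \<in> D. t p \<noteq> 0} |D A t. (D, A) \<in> C \<and> t \<in> A}"
  have eq: "openin (zariski (variety_of_charts C)) W \<longleftrightarrow> generate_topology_on \<B> W" for W
    unfolding variety_of_charts_def \<B>_def by (simp add: openin_topology_generated_by_iff)
  show "\<forall>p\<in>W. local_quotient W (\<lambda>_. 0) p" if "openin (zariski (variety_of_charts C)) W"
    using that unfolding eq
  proof (induction rule: generate_topology_on.induct)
    case (Int a b)
    show ?case
    proof
      fix p assume "p \<in> a \<inter> b"
      then have "local_quotient a (\<lambda>_. 0) p" "local_quotient b (\<lambda>_. 0) p" using Int by auto
      then obtain D A s s' t where D: "(D, A) \<in> C" "s \<in> A" "s' \<in> A" "t \<in> A" "p \<in> D" "t p \<noteq> 0"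
        and q: "\<And>q. q \<in> D \<Longrightarrow> t q \<noteq> 0 \<Longrightarrow> q \<in> a \<inter> b \<and> 0 = s q / t q \<and> 0 = s' q / t q"
        by (rule local_quotient_common) auto
      show "local_quotient (a \<inter> b) (\<lambda>_. 0) p"
        by (rule local_quotientI[OF D(1,2,4,5,6)]) (use q in auto)
    qed
  next
    case (UN K)
    show ?case
    proof
      fix p assume "p \<in> \<Union>K"
      then obtain b where b: "b \<in> K" "p \<in> b" by blast
      show "local_quotient (\<Union>K) (\<lambda>_. 0) p"
        by (rule local_quotient_mono[of b]) (use UN b in auto)
    qed
  next
    case (Basis b)
    then obtain D A t where b: "b = {p \<in> D. t p \<noteq> 0}" "(D, A) \<in> C" "t \<in> A" unfolding \<B>_def by auto
    obtain z where z: "z \<in> A" "\<forall>q\<in>D. z q = 0" using chart_const[OF b(2), of 0] by blast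
    have "local_quotient b (\<lambda>_. 0) p" if "p \<in> b" for p
      by (rule local_quotientI[OF b(2) z(1) b(3)]) (use b z that in auto)
    then show ?case by blast
  qed auto
  assume W: "\<forall>p\<in>W. local_quotient W (\<lambda>_. 0) p"
  have "\<exists>b\<in>\<B>. p \<in> b \<and> b \<subseteq> W" if p: "p \<in> W" for p
  proof -
    from W p have "local_quotient W (\<lambda>_. 0) p" by blast
    then obtain D A s t where "(D, A) \<in> C" "t \<in> A" "p \<in> D" "t p \<noteq> 0"
      "\<And>q. q \<in> D \<Longrightarrow> t q \<noteq> 0 \<Longrightarrow> q \<in> W \<and> 0 = s q / t q"
      by (rule local_quotientE) auto
    then show ?thesis unfolding \<B>_def by (intro bexI[of _ "{p\<in>D. t p \<noteq> 0}"]) auto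
  qed
  then have "W = \<Union>{b\<in>\<B>. b \<subseteq> W}" by blast
  moreover have "generate_topology_on \<B> (\<Union>{b\<in>\<B>. b \<subseteq> W})"
    by (rule generate_topology_on.UN) (auto intro: generate_topology_on.Basis)
  ultimately show "openin (zariski (variety_of_charts C)) W" unfolding eq by simp
qed

lemma regular_chart_iff:
  assumes "openin (zariski (variety_of_charts C)) W"
  shows "f \<in> regular (variety_of_charts C) W \<longleftrightarrow> (\<forall>p\<in>W. local_quotient W f p)"
proof
  assume *: "\<forall>p\<in>W. local_quotient W f p"
  show "f \<in> regular (variety_of_charts C) W"
    unfolding regular_variety_of_charts
  proof
    fix p assume "p \<in> W"
    with * have "local_quotient W f p" by blast
    then obtain D A s t where D: "(D, A) \<in> C" "s \<in> A" "t \<in> A" "p \<in> D" "t p \<noteq> 0"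
      "\<And>q. q \<in> D \<Longrightarrow> t q \<noteq> 0 \<Longrightarrow> q \<in> W \<and> f q = s q / t q"
      by (rule local_quotientE) auto
    then show "\<exists>D A s t. (D, A) \<in> C \<and> s \<in> A \<and> t \<in> A \<and> p \<in> D \<and> t p \<noteq> 0 \<and>
       (\<forall>q\<in>W \<inter> D. t q \<noteq> 0 \<longrightarrow> f q = s q / t q)"
      by (intro exI[of _ D] exI[of _ A] exI[of _ s] exI[of _ t]) auto
  qed
next
  assume f: "f \<in> regular (variety_of_charts C) W"
  show "\<forall>p\<in>W. local_quotient W f p"
  proof
    fix p assume p: "p \<in> W"
    then have 1: "local_quotient W (\<lambda>_. 0) p" using assms by (simp add: openin_chart_topology)
    obtain D A s t where D: "(D, A) \<in> C" "s \<in> A" "t \<in> A" "p \<in> D" "t p \<noteq> 0"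
       "\<forall>q\<in>W \<inter> D. t q \<noteq> 0 \<longrightarrow> f q = s q / t q"
      using f[unfolded regular_variety_of_charts, rule_format, OF p] by (elim exE conjE) (rule that)
    define g where "g q = s q / t q" for q
    have "local_quotient UNIV g p"
      by (rule local_quotientI[OF D(1,2,3,4,5)]) (simp add: g_def)
    \<comment> \<open>\<open>f\<close> agrees with \<open>g\<close> only inside \<open>W\<close>,
      which the neighbourhood \<open>V\<close> need not respect. Merging this quotient with the zero
      quotient that witnesses openness of \<open>W\<close> shrinks the neighbourhood into
      \<open>V \<inter> W\<close>.\<close>
    define V where "V = {q\<in>D. t q \<noteq> 0}"
    have "local_quotient V g p"
      by (rule local_quotientI[OF D(1,2,3,4,5)]) (simp add: g_def V_def)
    from this 1 obtain D' A' s' s'' t' where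
      D': "(D', A') \<in> C" "s' \<in> A'" "t' \<in> A'" "p \<in> D'" "t' p \<noteq> 0"
      and q': "\<And>q. q \<in> D' \<Longrightarrow> t' q \<noteq> 0 \<Longrightarrow> q \<in> V \<inter> W \<and> g q = s' q / t' q \<and> 0 = s'' q / t' q"
      by (rule local_quotient_common) auto
    have "q \<in> W \<and> f q = s' q / t' q" if "q \<in> D'" "t' q \<noteq> 0" for q
      using q'[OF that] D(6) by (auto simp: V_def g_def)
    then show "local_quotient W f p" by (intro local_quotientI[OF D'(1-5)]) auto
  qed
qed

lemma openin_chart:
  assumes "(D, A) \<in> C"
  shows "openin (zariski (variety_of_charts C)) D"
proof -
  obtain s t where s: "s \<in> A" "\<forall>q\<in>D. s q = 0" and t: "t \<in> A" "\<forall>q\<in>D. t q = 1"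
    using chart_const[OF assms, of 0] chart_const[OF assms, of 1] by blast
  have "local_quotient D (\<lambda>_. 0) p" if "p \<in> D" for p
    by (rule local_quotientI[OF assms s(1) t(1) that]) (use s t that in auto)
  then show ?thesis unfolding openin_chart_topology by blast
qed

lemma points_charts: "points (variety_of_charts C) = \<Union>(fst ` C)"
proof
  show "points (variety_of_charts C) \<subseteq> \<Union>(fst ` C)"
  proof
    fix p assume "p \<in> points (variety_of_charts C)"
    then have "local_quotient (points (variety_of_charts C)) (\<lambda>_. 0) p"
      using openin_topspace[of "zariski (variety_of_charts C)"] unfolding openin_chart_topology by blast
    then show "p \<in> \<Union>(fst ` C)" by (rule local_quotientE) force
  qed
  show "\<Union>(fst ` C) \<subseteq> points (variety_of_charts C)"
    using openin_chart[THEN openin_subset] by force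
qed

lemma regular_chart_fun:
  assumes "(D, A) \<in> C" "s \<in> A"
  shows "s \<in> regular (variety_of_charts C) D"
proof -
  obtain t where t: "t \<in> A" "\<forall>q\<in>D. t q = 1" using chart_const[OF assms(1), of 1] by blast
  have "local_quotient D s p" if "p \<in> D" for p
    by (rule local_quotientI[OF assms t(1) that]) (use t that in auto)
  then show ?thesis unfolding regular_chart_iff[OF openin_chart[OF assms(1)]] by blast
qed

lemma function_space_charts: "function_space (variety_of_charts C)"
proof
  fix f g W assume "f \<in> regular (variety_of_charts C) W" "\<And>p. p \<in> W \<Longrightarrow> g p = f p"
  then show "g \<in> regular (variety_of_charts C) W"
    unfolding regular_variety_of_charts by simp
next
  fix f W V assume "f \<in> regular (variety_of_charts C) W" "V \<subseteq> W"
  then show "f \<in> regular (variety_of_charts C) V"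
    unfolding regular_variety_of_charts
  proof (intro ballI)
    fix p assume *: "\<forall>p\<in>W. \<exists>D A s t. (D, A) \<in> C \<and> s \<in> A \<and> t \<in> A \<and> p \<in> D \<and> t p \<noteq> 0 \<and>
       (\<forall>q\<in>W \<inter> D. t q \<noteq> 0 \<longrightarrow> f q = s q / t q)" and p: "p \<in> V" and V: "V \<subseteq> W"
    from p V have "p \<in> W" by blast
    from *[rule_format, OF this] obtain D A s t where "(D, A) \<in> C" "s \<in> A" "t \<in> A" "p \<in> D" "t p \<noteq> 0"
       "\<forall>q\<in>W \<inter> D. t q \<noteq> 0 \<longrightarrow> f q = s q / t q" by (elim exE conjE) (rule that)
    then show "\<exists>D A s t. (D, A) \<in> C \<and> s \<in> A \<and> t \<in> A \<and> p \<in> D \<and> t p \<noteq> 0 \<and>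
       (\<forall>q\<in>V \<inter> D. t q \<noteq> 0 \<longrightarrow> f q = s q / t q)"
      using V by (intro exI[of _ D] exI[of _ A] exI[of _ s] exI[of _ t]) auto
  qed
next
  fix W f assume W: "openin (zariski (variety_of_charts C)) W"
    and *: "\<And>p. p \<in> W \<Longrightarrow> \<exists>V. openin (zariski (variety_of_charts C)) V \<and> p \<in> V \<and> V \<subseteq> W \<and>
              f \<in> regular (variety_of_charts C) V"
  show "f \<in> regular (variety_of_charts C) W"
    unfolding regular_chart_iff[OF W]
  proof
    fix p assume "p \<in> W"
    then obtain V where V: "openin (zariski (variety_of_charts C)) V" "p \<in> V" "V \<subseteq> W"
      "f \<in> regular (variety_of_charts C) V" using * by blast
    then have "local_quotient V f p" using regular_chart_iff[OF V(1)] by blast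
    then show "local_quotient W f p" by (rule local_quotient_mono) (use V in auto)
  qed
next
  fix W c assume W: "openin (zariski (variety_of_charts C)) W"
  show "(\<lambda>_. c) \<in> regular (variety_of_charts C) W"
    unfolding regular_variety_of_charts
  proof
    fix p assume "p \<in> W"
    with W have "local_quotient W (\<lambda>_. 0) p" unfolding openin_chart_topology by blast
    then obtain D A where D: "(D, A) \<in> C" "p \<in> D" by (rule local_quotientE) auto
    obtain s t where st: "s \<in> A" "\<forall>q\<in>D. s q = c" "t \<in> A" "\<forall>q\<in>D. t q = 1"
      using chart_const[OF D(1), of c] chart_const[OF D(1), of 1] by blast
    then show "\<exists>D A s t. (D, A) \<in> C \<and> s \<in> A \<and> t \<in> A \<and> p \<in> D \<and> t p \<noteq> 0 \<and>
       (\<forall>q\<in>W \<inter> D. t q \<noteq> 0 \<longrightarrow> c = s q / t q)"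
      using D by (intro exI[of _ D] exI[of _ A] exI[of _ s] exI[of _ t]) auto
  qed
next
  fix W f g assume W: "openin (zariski (variety_of_charts C)) W"
    and f: "f \<in> regular (variety_of_charts C) W" and g: "g \<in> regular (variety_of_charts C) W"
  have "local_quotient W (\<lambda>p. f p + g p) p \<and> local_quotient W (\<lambda>p. f p * g p) p" if p: "p \<in> W" for p
  proof -
    have "local_quotient W f p" "local_quotient W g p"
      using f g p regular_chart_iff[OF W] by auto
    then obtain D A s s' t where D: "(D, A) \<in> C" "s \<in> A" "s' \<in> A" "t \<in> A" "p \<in> D" "t p \<noteq> 0"
      and q: "\<And>q. q \<in> D \<Longrightarrow> t q \<noteq> 0 \<Longrightarrow> q \<in> W \<and> f q = s q / t q \<and> g q = s' q / t q"
      by (rule local_quotient_common) auto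
    obtain r where r: "r \<in> A" "\<forall>q\<in>D. r q = s q + s' q" using chart_add[OF D(1-3)] by blast
    obtain r' where r': "r' \<in> A" "\<forall>q\<in>D. r' q = s q * s' q" using chart_mult[OF D(1-3)] by blast
    obtain t' where t': "t' \<in> A" "\<forall>q\<in>D. t' q = t q * t q" using chart_mult[OF D(1) D(4) D(4)] by blast
    have "local_quotient W (\<lambda>p. f p + g p) p"
      by (rule local_quotientI[OF D(1) r(1) D(4,5,6)]) (use q r in \<open>auto simp: add_divide_distrib\<close>)
    moreover have "local_quotient W (\<lambda>p. f p * g p) p"
      by (rule local_quotientI[OF D(1) r'(1) t'(1) D(5)]) (use q r' t' D in auto)
    ultimately show ?thesis ..
  qed
  then show "(\<lambda>p. f p + g p) \<in> regular (variety_of_charts C) W"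
    "(\<lambda>p. f p * g p) \<in> regular (variety_of_charts C) W"
    unfolding regular_chart_iff[OF W] by auto
next
  fix W f assume W: "openin (zariski (variety_of_charts C)) W"
    and f: "f \<in> regular (variety_of_charts C) W"
  have *: "local_quotient {p\<in>W. f p \<noteq> 0} (\<lambda>p. inverse (f p)) p" if p: "p \<in> W" "f p \<noteq> 0" for p
  proof -
    from f p have "local_quotient W f p" using regular_chart_iff[OF W] by blast
    then obtain D A s t where D: "(D, A) \<in> C" "s \<in> A" "t \<in> A" "p \<in> D" "t p \<noteq> 0"
      and q: "\<And>q. q \<in> D \<Longrightarrow> t q \<noteq> 0 \<Longrightarrow> q \<in> W \<and> f q = s q / t q"
      by (rule local_quotientE) auto
    \<comment> \<open>The inverse of \<open>s / t\<close> is written as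
      \<open>t * t / (s * t)\<close> rather than \<open>t / s\<close>: the factor \<open>t\<close>
      in the denominator keeps the basic set inside the locus where \<open>f = s / t\<close> is
      known.\<close>
    obtain r where r: "r \<in> A" "\<forall>q\<in>D. r q = s q * t q" using chart_mult[OF D(1-3)] by blast
    obtain t' where t': "t' \<in> A" "\<forall>q\<in>D. t' q = t q * t q" using chart_mult[OF D(1) D(3) D(3)] by blast
    show ?thesis
      by (rule local_quotientI[OF D(1) t'(1) r(1) D(4)]) (use q[of p] q r t' D p in auto)
  qed
  show o: "openin (zariski (variety_of_charts C)) {p \<in> W. f p \<noteq> 0}"
    unfolding openin_chart_topology
  proof
    fix p assume "p \<in> {p\<in>W. f p \<noteq> 0}"
    then have "local_quotient {p\<in>W. f p \<noteq> 0} (\<lambda>p. inverse (f p)) p" using * by auto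
    then obtain D A s t where D: "(D, A) \<in> C" "s \<in> A" "t \<in> A" "p \<in> D" "t p \<noteq> 0"
      and q: "\<And>q. q \<in> D \<Longrightarrow> t q \<noteq> 0 \<Longrightarrow> q \<in> {p\<in>W. f p \<noteq> 0} \<and> inverse (f q) = s q / t q"
      by (rule local_quotientE) auto
    obtain z where z: "z \<in> A" "\<forall>q\<in>D. z q = 0" using chart_const[OF D(1), of 0] by blast
    show "local_quotient {p\<in>W. f p \<noteq> 0} (\<lambda>_. 0) p"
      by (rule local_quotientI[OF D(1) z(1) D(3,4,5)]) (use q z in auto)
  qed
  show "(\<lambda>p. inverse (f p)) \<in> regular (variety_of_charts C) {p \<in> W. f p \<noteq> 0}"
    unfolding regular_chart_iff[OF o] using * by auto
qed

text \<open>Open sets and regular functions of the target are locally given by quotients of chart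
  functions. In a \<open>function_space\<close> such quotients are regular on an open locus, so it
  suffices to pull back the chart functions near each point.\<close>

lemma variety_morphism_into_charts:
  assumes "function_space Z"
    and image: "\<And>p. p \<in> points Z \<Longrightarrow> F p \<in> \<Union>(fst ` C)"
    and pullback: "\<And>D A p. (D, A) \<in> C \<Longrightarrow> p \<in> points Z \<Longrightarrow> F p \<in> D \<Longrightarrow>
       \<exists>W. openin (zariski Z) W \<and> p \<in> W \<and> F ` W \<subseteq> D \<and> (\<forall>s\<in>A. s \<circ> F \<in> regular Z W)"
  shows "variety_morphism Z (variety_of_charts C) F"
proof -
  interpret Z: function_space Z by fact
  have loc: "\<exists>W. openin (zariski Z) W \<and> p \<in> W \<and> F ` W \<subseteq> {q\<in>D. t q \<noteq> 0} \<and>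
       (\<lambda>q. s (F q) / t (F q)) \<in> regular Z W"
    if DA: "(D, A) \<in> C" "s \<in> A" "t \<in> A" and p: "p \<in> points Z" "F p \<in> D" "t (F p) \<noteq> 0" for D A s t p
  proof -
    obtain W where W: "openin (zariski Z) W" "p \<in> W" "F ` W \<subseteq> D" "\<forall>s\<in>A. s \<circ> F \<in> regular Z W"
      using pullback[OF DA(1) p(1,2)] by blast
    define V where "V = {q\<in>W. (t \<circ> F) q \<noteq> 0}"
    have V: "openin (zariski Z) V" unfolding V_def using W(1,4) DA(3) by (intro Z.openin_nonzero) blast+
    have "(\<lambda>q. inverse ((t \<circ> F) q)) \<in> regular Z V"
      unfolding V_def using W(1,4) DA(3) by (intro Z.regular_inverse) blast+
    moreover have "s \<circ> F \<in> regular Z V"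
      by (rule Z.regular_restrict[OF _ W(1) V]) (use W(4) DA(2) V_def in blast)+
    ultimately have "(\<lambda>q. (s \<circ> F) q * inverse ((t \<circ> F) q)) \<in> regular Z V"
      by (intro Z.regular_mult V)
    then show ?thesis using V W p by (intro exI[of _ V]) (auto simp: V_def divide_inverse)
  qed
  have cont: "continuous_map (zariski Z) (zariski (variety_of_charts C)) F"
    unfolding variety_of_charts_def
  proof (simp, rule continuous_on_generated_topo)
    fix b assume "b \<in> {{p \<in> D. t p \<noteq> 0} |D A t. (D, A) \<in> C \<and> t \<in> A}"
    then obtain D A t where b: "b = {p \<in> D. t p \<noteq> 0}" "(D, A) \<in> C" "t \<in> A" by auto
    show "openin (zariski Z) (F -` b \<inter> points Z)"
    proof (subst openin_subopen, intro ballI)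
      fix p assume "p \<in> F -` b \<inter> points Z"
      then obtain W where "openin (zariski Z) W" "p \<in> W" "F ` W \<subseteq> b"
        using loc[OF b(2,3,3), of p] b by auto
      then show "\<exists>T. openin (zariski Z) T \<and> p \<in> T \<and> T \<subseteq> F -` b \<inter> points Z"
        using openin_subset by blast
    qed
  next
    show "F ` points Z \<subseteq> \<Union>{{p \<in> D. t p \<noteq> 0} |D A t. (D, A) \<in> C \<and> t \<in> A}"
    proof safe
      fix p assume "p \<in> points Z"
      then obtain D A where "(D, A) \<in> C" "F p \<in> D" using image by fastforce
      moreover then obtain t where "t \<in> A" "t (F p) = 1" using chart_const[of D A 1] by blast
      ultimately show "F p \<in> \<Union>{{p \<in> D. t p \<noteq> 0} |D A t. (D, A) \<in> C \<and> t \<in> A}"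
        by (intro UnionI[of "{p\<in>D. t p \<noteq> 0}"]) auto
    qed
  qed
  show ?thesis unfolding variety_morphism_def
  proof (intro conjI cont allI impI)
    fix V g assume "openin (zariski (variety_of_charts C)) V \<and> g \<in> regular (variety_of_charts C) V"
    then have V: "openin (zariski (variety_of_charts C)) V" and g: "g \<in> regular (variety_of_charts C) V"
      by auto
    have o: "openin (zariski Z) (points Z \<inter> F -` V)"
      by (rule openin_vimage_continuous_map[OF cont V])
    show "g \<circ> F \<in> regular Z (points Z \<inter> F -` V)"
    proof (rule Z.regular_local[OF o])
      fix p assume p: "p \<in> points Z \<inter> F -` V"
      then have "local_quotient V g (F p)" using g regular_chart_iff[OF V] by auto
      then obtain D A s t where D: "(D, A) \<in> C" "s \<in> A" "t \<in> A" "F p \<in> D" "t (F p) \<noteq> 0"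
        and q: "\<And>q. q \<in> D \<Longrightarrow> t q \<noteq> 0 \<Longrightarrow> q \<in> V \<and> g q = s q / t q"
        by (rule local_quotientE) auto
      obtain W where W: "openin (zariski Z) W" "p \<in> W" "F ` W \<subseteq> {q\<in>D. t q \<noteq> 0}"
       "(\<lambda>q. s (F q) / t (F q)) \<in> regular Z W" using loc[OF D(1-3) _ D(4,5)] p by auto
      have "g \<circ> F \<in> regular Z W"
        by (rule Z.regular_cong[OF W(4,1)]) (use W(3) q in auto)
      moreover have "W \<subseteq> points Z \<inter> F -` V" using W(3) q openin_subset[OF W(1)] by auto
      ultimately show "\<exists>W. openin (zariski Z) W \<and> p \<in> W \<and> W \<subseteq> points Z \<inter> F -` V \<and> g \<circ> F \<in> regular Z W"
        using W by blast
    qed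
  qed
qed

end

lemma variety_morphism_into_open:
  assumes f: "variety_morphism Z X f" and U: "openin (zariski X) U" and im: "f ` points Z \<subseteq> U"
  shows "variety_morphism Z (open_subvariety X U) f"
proof -
  have "openin (zariski X) V" if "openin (zariski (open_subvariety X U)) V" for V
    using that openin_open_subtopology[OF U] by (simp add: open_subvariety_def)
  then show ?thesis
    using f im unfolding variety_morphism_def
    by (auto simp: open_subvariety_def continuous_map_in_subtopology)
qed

section \<open>Products of spaces with functions\<close>

locale product_of_function_spaces = X: function_space X + Y: function_space Y
  for X :: "('p, 'k::field, 'x) variety_scheme" and Y :: "('q, 'k, 'y) variety_scheme"
begin

definition tensor_ring :: "'p set \<Rightarrow> 'q set \<Rightarrow> ('p \<times> 'q \<Rightarrow> 'k) set" where
  "tensor_ring U V = {\<lambda>(x, y). \<Sum>i<n. a i x * b i y | (n::nat) a b.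
                  (\<forall>i<n. a i \<in> regular X U \<and> b i \<in> regular Y V)}"

definition product_charts where
  "product_charts = {(U \<times> V, tensor_ring U V) | U V. openin (zariski X) U \<and> openin (zariski Y) V}"

lemma variety_product_charts: "variety_product X Y = variety_of_charts product_charts"
  unfolding variety_product_def product_charts_def tensor_ring_def ..

lemma tensor_ringI:
  assumes "\<And>i. i < (n::nat) \<Longrightarrow> a i \<in> regular X U" "\<And>i. i < n \<Longrightarrow> b i \<in> regular Y V"
    "\<And>x y. f (x, y) = (\<Sum>i<n. a i x * b i y)"
  shows "f \<in> tensor_ring U V"
proof -
  have "f = (\<lambda>(x, y). \<Sum>i<n. a i x * b i y)" using assms(3) by auto
  then show ?thesis unfolding tensor_ring_def using assms(1,2) by blast
qed

lemma tensor_ringE: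
  assumes "f \<in> tensor_ring U V"
  obtains n a b where "f = (\<lambda>(x, y). \<Sum>i<(n::nat). a i x * b i y)"
    "\<forall>i<n. a i \<in> regular X U \<and> b i \<in> regular Y V"
  using assms unfolding tensor_ring_def by blast

lemma tensor_ring_simple:
  assumes "a \<in> regular X U" "b \<in> regular Y V"
  shows "(\<lambda>(x, y). a x * b y) \<in> tensor_ring U V"
  by (rule tensor_ringI[of 1 "\<lambda>_. a" _ "\<lambda>_. b"]) (use assms in auto)

lemma tensor_ring_add:
  assumes "s \<in> tensor_ring U V" "t \<in> tensor_ring U V"
  shows "(\<lambda>p. s p + t p) \<in> tensor_ring U V"
proof -
  obtain n a b where s: "s = (\<lambda>(x, y). \<Sum>i<(n::nat). a i x * b i y)" "\<forall>i<n. a i \<in> regular X U \<and> b i \<in> regular Y V"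
    using assms(1) by (rule tensor_ringE)
  obtain n' a' b' where t: "t = (\<lambda>(x, y). \<Sum>i<(n'::nat). a' i x * b' i y)"
     "\<forall>i<n'. a' i \<in> regular X U \<and> b' i \<in> regular Y V"
    using assms(2) by (rule tensor_ringE)
  show ?thesis
  proof (rule tensor_ringI[of "n + n'" "\<lambda>i. if i < n then a i else a' (i - n)" _
        "\<lambda>i. if i < n then b i else b' (i - n)"])
    fix x y
    let ?g = "\<lambda>i. (if i < n then a i else a' (i - n)) x * (if i < n then b i else b' (i - n)) y"
    have "(\<Sum>i<n + n'. ?g i) = (\<Sum>i<n. ?g i) + (\<Sum>i<n'. ?g (i + n))"
      by (induction n') (auto simp: add.commute add.left_commute)
    then show "s (x, y) + t (x, y) = (\<Sum>i<n + n'. ?g i)" by (simp add: s t)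
  qed (use s t in auto)
qed

lemma tensor_ring_mult:
  assumes U: "openin (zariski X) U" and V: "openin (zariski Y) V"
    and "s \<in> tensor_ring U V" "t \<in> tensor_ring U V"
  shows "(\<lambda>p. s p * t p) \<in> tensor_ring U V"
proof -
  obtain n a b where s: "s = (\<lambda>(x, y). \<Sum>i<(n::nat). a i x * b i y)" "\<forall>i<n. a i \<in> regular X U \<and> b i \<in> regular Y V"
    using assms(3) by (rule tensor_ringE)
  \<comment> \<open>Induction on the number of summands of \<open>s\<close>: one elementary tensor
    times \<open>t\<close> is again a sum of such tensors, so no double sum has to be
    reindexed.\<close>
  have "\<forall>i<m. a i \<in> regular X U \<and> b i \<in> regular Y V \<Longrightarrow>
        (\<lambda>(x, y). (\<Sum>i<m. a i x * b i y) * t (x, y)) \<in> tensor_ring U V" for m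
  proof (induction m)
    case 0
    show ?case by (rule tensor_ringI[of 0]) auto
  next
    case (Suc m)
    obtain n' a' b' where t: "t = (\<lambda>(x, y). \<Sum>i<(n'::nat). a' i x * b' i y)"
       "\<forall>i<n'. a' i \<in> regular X U \<and> b' i \<in> regular Y V"
      using assms(4) by (rule tensor_ringE)
    have "(\<lambda>(x, y). a m x * b m y * t (x, y)) \<in> tensor_ring U V"
      by (rule tensor_ringI[of n' "\<lambda>i x. a m x * a' i x" _ "\<lambda>i y. b m y * b' i y"])
        (use Suc.prems t in \<open>auto intro!: X.regular_mult Y.regular_mult U V
           simp: sum_distrib_left algebra_simps\<close>)
    from tensor_ring_add[OF Suc.IH this] Suc.prems
    show ?case by (auto simp: case_prod_beta' distrib_right)
  qed
  from this[of n] s show ?thesis by (simp add: case_prod_beta')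
qed

lemma tensor_ring_mono:
  assumes "openin (zariski X) U" "openin (zariski Y) V" "openin (zariski X) U'" "openin (zariski Y) V'"
    "U' \<subseteq> U" "V' \<subseteq> V"
  shows "tensor_ring U V \<subseteq> tensor_ring U' V'"
  unfolding tensor_ring_def
  using X.regular_restrict[OF _ assms(1,3,5)] Y.regular_restrict[OF _ assms(2,4,6)] by blast

sublocale product: chart_atlas product_charts
proof
  fix D A c assume "(D, A) \<in> product_charts"
  then obtain U V where *: "D = U \<times> V" "A = tensor_ring U V" "openin (zariski X) U" "openin (zariski Y) V"
    unfolding product_charts_def by auto
  have "(\<lambda>(x, y). c * 1) \<in> A" unfolding *
    by (rule tensor_ring_simple) (auto intro: X.regular_const Y.regular_const *)
  then show "\<exists>s\<in>A. \<forall>q\<in>D. s q = c" by (rule rev_bexI) auto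
next
  fix D A s t assume "(D, A) \<in> product_charts" and st: "s \<in> A" "t \<in> A"
  then obtain U V where *: "D = U \<times> V" "A = tensor_ring U V" "openin (zariski X) U" "openin (zariski Y) V"
    unfolding product_charts_def by auto
  show "\<exists>r\<in>A. \<forall>q\<in>D. r q = s q + t q" "\<exists>r\<in>A. \<forall>q\<in>D. r q = s q * t q"
    using tensor_ring_add[of s U V t] tensor_ring_mult[of U V s t] * st by auto
next
  fix D1 A1 D2 A2 p
  assume "(D1, A1) \<in> product_charts" "(D2, A2) \<in> product_charts" and p: "p \<in> D1" "p \<in> D2"
  then obtain U1 V1 U2 V2 where *: "D1 = U1 \<times> V1" "A1 = tensor_ring U1 V1" "openin (zariski X) U1"
      "openin (zariski Y) V1" "D2 = U2 \<times> V2" "A2 = tensor_ring U2 V2" "openin (zariski X) U2"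
      "openin (zariski Y) V2"
    unfolding product_charts_def by auto
  have o: "openin (zariski X) (U1 \<inter> U2)" "openin (zariski Y) (V1 \<inter> V2)" using * by auto
  have "((U1 \<inter> U2) \<times> (V1 \<inter> V2), tensor_ring (U1 \<inter> U2) (V1 \<inter> V2)) \<in> product_charts"
    using o unfolding product_charts_def by blast
  moreover have "A1 \<subseteq> tensor_ring (U1 \<inter> U2) (V1 \<inter> V2)" "A2 \<subseteq> tensor_ring (U1 \<inter> U2) (V1 \<inter> V2)"
    unfolding * using tensor_ring_mono[OF *(3,4) o] tensor_ring_mono[OF *(7,8) o] by auto
  ultimately show "\<exists>(D, A)\<in>product_charts. p \<in> D \<and> D \<subseteq> D1 \<inter> D2 \<and> (\<forall>s\<in>A1 \<union> A2. \<exists>s'\<in>A. \<forall>q\<in>D. s' q = s q)"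
    using p * by (intro bexI[of _ "((U1 \<inter> U2) \<times> (V1 \<inter> V2), tensor_ring (U1 \<inter> U2) (V1 \<inter> V2))"]) auto
qed

lemma function_space_product: "function_space (variety_product X Y)"
  unfolding variety_product_charts by (rule product.function_space_charts)

lemma openin_product:
  "openin (zariski X) U \<Longrightarrow> openin (zariski Y) V \<Longrightarrow> openin (zariski (variety_product X Y)) (U \<times> V)"
  unfolding variety_product_charts
  by (rule product.openin_chart[of _ "tensor_ring U V"]) (auto simp: product_charts_def)

lemma points_product: "points (variety_product X Y) = points X \<times> points Y"
proof
  show "points (variety_product X Y) \<subseteq> points X \<times> points Y"
  proof
    fix p assume "p \<in> points (variety_product X Y)"
    then obtain U V where "openin (zariski X) U" "openin (zariski Y) V" "p \<in> U \<times> V"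
      unfolding variety_product_charts product.points_charts unfolding product_charts_def by auto
    then show "p \<in> points X \<times> points Y" by (auto dest: openin_subset)
  qed
  show "points X \<times> points Y \<subseteq> points (variety_product X Y)"
    using openin_product[THEN openin_subset] by auto
qed

lemma regular_product:
  assumes "openin (zariski X) U" "openin (zariski Y) V" "a \<in> regular X U" "b \<in> regular Y V"
  shows "(\<lambda>(x, y). a x * b y) \<in> regular (variety_product X Y) (U \<times> V)"
  unfolding variety_product_charts
  by (rule product.regular_chart_fun[of _ "tensor_ring U V"])
    (use assms tensor_ring_simple in \<open>auto simp: product_charts_def\<close>)

text \<open>A sum of products \<open>a i x * b i y\<close> pulls back to the sum of the products of
  \<open>a i \<circ> f\<close> and \<open>b i \<circ> g\<close>, which is regular on the
  intersection of the two preimages. This makes the inverse of the trivialisation a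
  morphism.\<close>

lemma variety_morphism_pair:
  assumes Z: "function_space Z" and f: "variety_morphism Z X f" and g: "variety_morphism Z Y g"
  shows "variety_morphism Z (variety_product X Y) (\<lambda>z. (f z, g z))"
  unfolding variety_product_charts
proof (rule product.variety_morphism_into_charts[OF Z])
  interpret Z: function_space Z by fact
  note cont = f[unfolded variety_morphism_def, THEN conjunct1] g[unfolded variety_morphism_def, THEN conjunct1]
  fix p assume p: "p \<in> points Z"
  then have "(f p, g p) \<in> points X \<times> points Y" using cont by (auto simp: continuous_map_def)
  then show "(f p, g p) \<in> \<Union> (fst ` product_charts)"
    unfolding points_product[symmetric] variety_product_charts product.points_charts .
  fix D A assume "(D, A) \<in> product_charts" and pD: "(f p, g p) \<in> D"
  then obtain U V where *: "D = U \<times> V" "A = tensor_ring U V" "openin (zariski X) U" "openin (zariski Y) V"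
    unfolding product_charts_def by auto
  define W1 where "W1 = points Z \<inter> f -` U"
  define W2 where "W2 = points Z \<inter> g -` V"
  have W: "openin (zariski Z) W1" "openin (zariski Z) W2"
    unfolding W1_def W2_def by (rule openin_vimage_continuous_map[OF cont(1) *(3)],
        rule openin_vimage_continuous_map[OF cont(2) *(4)])
  then have W12: "openin (zariski Z) (W1 \<inter> W2)" by blast
  have "s \<circ> (\<lambda>z. (f z, g z)) \<in> regular Z (W1 \<inter> W2)" if sA: "s \<in> A" for s
  proof -
    obtain n a b where s: "s = (\<lambda>(x, y). \<Sum>i<(n::nat). a i x * b i y)"
       "\<forall>i<n. a i \<in> regular X U \<and> b i \<in> regular Y V"
      using sA unfolding *(2) by (rule tensor_ringE)
    have "(\<lambda>z. (a i \<circ> f) z * (b i \<circ> g) z) \<in> regular Z (W1 \<inter> W2)" if "i < n" for i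
    proof (rule Z.regular_mult[OF W12])
      have "a i \<circ> f \<in> regular Z W1" "b i \<circ> g \<in> regular Z W2"
        using f g s that * unfolding variety_morphism_def W1_def W2_def by auto
      then show "a i \<circ> f \<in> regular Z (W1 \<inter> W2)" "b i \<circ> g \<in> regular Z (W1 \<inter> W2)"
        using Z.regular_restrict W W12 by auto
    qed
    then have "(\<lambda>z. \<Sum>i<n. (a i \<circ> f) z * (b i \<circ> g) z) \<in> regular Z (W1 \<inter> W2)"
      by (intro Z.regular_sum W12) auto
    moreover have "s \<circ> (\<lambda>z. (f z, g z)) = (\<lambda>z. \<Sum>i<n. (a i \<circ> f) z * (b i \<circ> g) z)"
      by (auto simp: s)
    ultimately show ?thesis by simp
  qed
  then show "\<exists>W. openin (zariski Z) W \<and> p \<in> W \<and> (\<lambda>z. (f z, g z)) ` W \<subseteq> D \<and>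
        (\<forall>s\<in>A. s \<circ> (\<lambda>z. (f z, g z)) \<in> regular Z W)"
    using W12 p pD by (intro exI[of _ "W1 \<inter> W2"]) (auto simp: W1_def W2_def *)
qed

end

section \<open>Gluing affine toric varieties\<close>

text \<open>The gluing of charts is carried out at this level; freeness of a lattice enters through
  \<open>lattice_section\<close>.\<close>

locale additive_subgroup =
  fixes M :: "'a::euclidean_space set"
  assumes zero_closed: "0 \<in> M"
    and add_closed: "x \<in> M \<Longrightarrow> y \<in> M \<Longrightarrow> x + y \<in> M"
    and minus_closed: "x \<in> M \<Longrightarrow> - x \<in> M"
begin

lemma diff_closed: "x \<in> M \<Longrightarrow> y \<in> M \<Longrightarrow> x - y \<in> M"
  using add_closed[OF _ minus_closed] by fastforce

lemma nat_scale_closed: "x \<in> M \<Longrightarrow> real n *\<^sub>R x \<in> M"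
  by (induction n) (auto simp: zero_closed scaleR_left_distrib intro: add_closed)

lemma sum_closed: "(\<And>i. i \<in> I \<Longrightarrow> f i \<in> M) \<Longrightarrow> sum f I \<in> M"
  by (induction I rule: infinite_finite_induct) (auto intro: zero_closed add_closed)

lemma cone_monoid_zero: "0 \<in> cone_monoid M \<sigma>"
  by (simp add: cone_monoid_def dual_cone_def zero_closed)

lemma cone_monoid_add:
  "d \<in> cone_monoid M \<sigma> \<Longrightarrow> e \<in> cone_monoid M \<sigma> \<Longrightarrow> d + e \<in> cone_monoid M \<sigma>"
  by (auto simp: cone_monoid_def dual_cone_def inner_add_right add_closed)

lemma cone_monoid_scale: "d \<in> cone_monoid M \<sigma> \<Longrightarrow> real n *\<^sub>R d \<in> cone_monoid M \<sigma>"
  by (auto simp: cone_monoid_def dual_cone_def nat_scale_closed)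

lemma affine_toric_zero: "\<gamma> \<in> affine_toric M \<sigma> \<Longrightarrow> \<gamma> 0 = 1"
  and affine_toric_add: "\<gamma> \<in> affine_toric M \<sigma> \<Longrightarrow> d \<in> cone_monoid M \<sigma> \<Longrightarrow> e \<in> cone_monoid M \<sigma> \<Longrightarrow>
    \<gamma> (d + e) = \<gamma> d * \<gamma> e"
  by (auto simp: affine_toric_def)

lemma affine_toric_scale:
  "\<gamma> \<in> affine_toric M \<sigma> \<Longrightarrow> d \<in> cone_monoid M \<sigma> \<Longrightarrow> \<gamma> (real n *\<^sub>R d) = \<gamma> d ^ n"
  by (induction n) (auto simp: affine_toric_zero scaleR_left_distrib affine_toric_add cone_monoid_scale)

lemma affine_toric_unit:
  assumes "\<gamma> \<in> affine_toric M \<sigma>" "d \<in> cone_monoid M \<sigma>" "- d \<in> cone_monoid M \<sigma>"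
  shows "\<gamma> d \<noteq> 0"
  using affine_toric_add[OF assms] affine_toric_zero[OF assms(1)] by auto

lemma affine_toricI:
  assumes "\<gamma> 0 = 1"
    "\<And>d e. d \<in> cone_monoid M \<sigma> \<Longrightarrow> e \<in> cone_monoid M \<sigma> \<Longrightarrow> \<gamma> (d + e) = \<gamma> d * \<gamma> e"
  shows "restrict \<gamma> (cone_monoid M \<sigma>) \<in> affine_toric M \<sigma>"
  using assms cone_monoid_add cone_monoid_zero by (auto simp: affine_toric_def)

end

lemma cone_monoid_antimono: "\<rho> \<subseteq> \<sigma> \<Longrightarrow> cone_monoid M \<sigma> \<subseteq> cone_monoid M \<rho>"
  by (auto simp: cone_monoid_def dual_cone_def)

section \<open>Germs of points of affine toric varieties\<close>

context additive_subgroup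
begin

lemma affine_toric_restrict:
  assumes "\<delta> \<in> affine_toric M \<rho>" "\<rho> \<subseteq> \<sigma>"
  shows "restrict \<delta> (cone_monoid M \<sigma>) \<in> affine_toric M \<sigma>"
  using cone_monoid_antimono[OF assms(2), of M] affine_toric_add[OF assms(1)]
  by (intro affine_toricI) (auto simp: affine_toric_zero[OF assms(1)])

text \<open>The extension of \<open>\<gamma>\<close> to the localisation of \<open>\<sigma>\<^sup>\<or> \<inter> M\<close> at the monomials on which \<open>\<gamma>\<close> does not
  vanish, as a graph. It depends only on the point that \<open>(\<sigma>, \<gamma>)\<close> represents.\<close>

definition germ :: "'a set \<Rightarrow> ('a \<Rightarrow> 'k::field) \<Rightarrow> ('a \<times> 'k) set" where
  "germ \<sigma> \<gamma> = {(d - e, \<gamma> d / \<gamma> e) | d e. d \<in> cone_monoid M \<sigma> \<and> e \<in> cone_monoid M \<sigma> \<and> \<gamma> e \<noteq> 0}"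

lemma germI:
  "d \<in> cone_monoid M \<sigma> \<Longrightarrow> e \<in> cone_monoid M \<sigma> \<Longrightarrow> \<gamma> e \<noteq> 0 \<Longrightarrow> x = d - e \<Longrightarrow> c = \<gamma> d / \<gamma> e \<Longrightarrow>
    (x, c) \<in> germ \<sigma> \<gamma>"
  unfolding germ_def by blast

lemma germE:
  assumes "(x, c) \<in> germ \<sigma> \<gamma>"
  obtains d e where "d \<in> cone_monoid M \<sigma>" "e \<in> cone_monoid M \<sigma>" "\<gamma> e \<noteq> 0" "x = d - e" "c = \<gamma> d / \<gamma> e"
  using assms unfolding germ_def by blast

lemma germ_base:
  "\<gamma> \<in> affine_toric M \<sigma> \<Longrightarrow> d \<in> cone_monoid M \<sigma> \<Longrightarrow> (d, \<gamma> d) \<in> germ \<sigma> \<gamma>"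
  by (rule germI[of d _ 0]) (auto simp: affine_toric_zero cone_monoid_zero)

lemma germ_single_valued:
  assumes \<gamma>: "\<gamma> \<in> affine_toric M \<sigma>" and "(x, c) \<in> germ \<sigma> \<gamma>" "(x, c') \<in> germ \<sigma> \<gamma>"
  shows "c = c'"
proof -
  obtain d e where 1: "d \<in> cone_monoid M \<sigma>" "e \<in> cone_monoid M \<sigma>" "\<gamma> e \<noteq> 0" "x = d - e" "c = \<gamma> d / \<gamma> e"
    using assms(2) by (rule germE)
  obtain d' e' where 2: "d' \<in> cone_monoid M \<sigma>" "e' \<in> cone_monoid M \<sigma>" "\<gamma> e' \<noteq> 0" "x = d' - e'"
    "c' = \<gamma> d' / \<gamma> e'"
    using assms(3) by (rule germE)
  have "d + e' = d' + e" using 1(4) 2(4) by (simp add: algebra_simps)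
  then have "\<gamma> d * \<gamma> e' = \<gamma> d' * \<gamma> e"
    using affine_toric_add[OF \<gamma> 1(1) 2(2)] affine_toric_add[OF \<gamma> 2(1) 1(2)] by simp
  then show ?thesis using 1 2 by (simp add: frac_eq_eq)
qed

lemma germ_add:
  assumes \<gamma>: "\<gamma> \<in> affine_toric M \<sigma>" and "(x, c) \<in> germ \<sigma> \<gamma>" "(y, c') \<in> germ \<sigma> \<gamma>"
  shows "(x + y, c * c') \<in> germ \<sigma> \<gamma>"
proof -
  obtain d e where 1: "d \<in> cone_monoid M \<sigma>" "e \<in> cone_monoid M \<sigma>" "\<gamma> e \<noteq> 0" "x = d - e" "c = \<gamma> d / \<gamma> e"
    using assms(2) by (rule germE)
  obtain d' e' where 2: "d' \<in> cone_monoid M \<sigma>" "e' \<in> cone_monoid M \<sigma>" "\<gamma> e' \<noteq> 0" "y = d' - e'"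
    "c' = \<gamma> d' / \<gamma> e'"
    using assms(3) by (rule germE)
  show ?thesis
    by (rule germI[of "d + d'" _ "e + e'"]) (use 1 2 in \<open>auto simp: affine_toric_add[OF \<gamma>] cone_monoid_add\<close>)
qed

text \<open>By \<open>loc\<close>, each element of the monoid of \<rho> is an element of the monoid
  of \<sigma> minus a multiple of \<open>m\<close>. As \<open>\<delta> m \<noteq> 0\<close>, a
  fraction over the larger monoid can be expanded by a power of \<open>\<delta> m\<close> until
  numerator and denominator come from the smaller one.\<close>

lemma germ_localize:
  assumes \<delta>: "\<delta> \<in> affine_toric M \<rho>" and "\<rho> \<subseteq> \<sigma>" and m: "m \<in> cone_monoid M \<sigma>" "\<delta> m \<noteq> 0"
    and loc: "\<And>d. d \<in> cone_monoid M \<rho> \<Longrightarrow> \<exists>n::nat. d + real n *\<^sub>R m \<in> cone_monoid M \<sigma>"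
  shows "germ \<sigma> (restrict \<delta> (cone_monoid M \<sigma>)) = germ \<rho> \<delta>"
proof -
  have sub: "cone_monoid M \<sigma> \<subseteq> cone_monoid M \<rho>" by (rule cone_monoid_antimono) fact
  have "(x, c) \<in> germ \<rho> \<delta>" if xc: "(x, c) \<in> germ \<sigma> (restrict \<delta> (cone_monoid M \<sigma>))" for x c
  proof -
    obtain d e where "d \<in> cone_monoid M \<sigma>" "e \<in> cone_monoid M \<sigma>"
      "restrict \<delta> (cone_monoid M \<sigma>) e \<noteq> 0" "x = d - e"
      "c = restrict \<delta> (cone_monoid M \<sigma>) d / restrict \<delta> (cone_monoid M \<sigma>) e"
      using xc by (rule germE)
    then show ?thesis using sub by (intro germI[of d _ e]) auto
  qed
  moreover have "(x, c) \<in> germ \<sigma> (restrict \<delta> (cone_monoid M \<sigma>))" if xc: "(x, c) \<in> germ \<rho> \<delta>" for x c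
  proof -
    obtain d e where 1: "d \<in> cone_monoid M \<rho>" "e \<in> cone_monoid M \<rho>" "\<delta> e \<noteq> 0" "x = d - e" "c = \<delta> d / \<delta> e"
      using xc by (rule germE)
    obtain n n' :: nat where n: "d + real n *\<^sub>R m \<in> cone_monoid M \<sigma>" "e + real n' *\<^sub>R m \<in> cone_monoid M \<sigma>"
      using loc 1 by blast
    \<comment> \<open>Numerator and denominator are shifted by the same multiple of
      \<open>m\<close>, so that the factors \<open>\<delta> m ^ (n + n')\<close> cancel.\<close>
    have mem: "d + real (n + n') *\<^sub>R m \<in> cone_monoid M \<sigma>" "e + real (n + n') *\<^sub>R m \<in> cone_monoid M \<sigma>"
      using cone_monoid_add[OF n(1) cone_monoid_scale[OF m(1), of n']]
       cone_monoid_add[OF n(2) cone_monoid_scale[OF m(1), of n]] by (simp_all add: algebra_simps)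
    have "\<delta> (y + real (n + n') *\<^sub>R m) = \<delta> y * \<delta> m ^ (n + n')" if "y \<in> cone_monoid M \<rho>" for y
    proof -
      have "m \<in> cone_monoid M \<rho>" using m sub by blast
      then show ?thesis
        using affine_toric_add[OF \<delta> that cone_monoid_scale[of m \<rho> "n + n'"]]
          affine_toric_scale[OF \<delta>, of m "n + n'"] by simp
    qed
    then show ?thesis
      by (intro germI[OF mem]) (use 1 m mem in auto)
  qed
  ultimately show ?thesis by auto
qed

text \<open>The germ is a single-valued multiplicative relation, so as soon as it covers a larger
  monoid it supplies an extension of \<gamma> to it.\<close>

lemma germ_extend:
  assumes \<gamma>: "\<gamma> \<in> affine_toric M \<sigma>" and "\<rho> \<subseteq> \<sigma>" and dom: "cone_monoid M \<rho> \<subseteq> Domain (germ \<sigma> \<gamma>)"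
  obtains \<delta> where "\<delta> \<in> affine_toric M \<rho>" "restrict \<delta> (cone_monoid M \<sigma>) = \<gamma>"
    "\<And>d. d \<in> cone_monoid M \<rho> \<Longrightarrow> (d, \<delta> d) \<in> germ \<sigma> \<gamma>"
proof -
  define \<epsilon> where "\<epsilon> d = (SOME c. (d, c) \<in> germ \<sigma> \<gamma>)" for d
  have \<epsilon>: "(d, \<epsilon> d) \<in> germ \<sigma> \<gamma>" if "d \<in> cone_monoid M \<rho>" for d
    unfolding \<epsilon>_def by (rule someI_ex) (use dom that in auto)
  have eq: "\<epsilon> d = c" if "d \<in> cone_monoid M \<rho>" "(d, c) \<in> germ \<sigma> \<gamma>" for d c
    using germ_single_valued[OF \<gamma> \<epsilon>[OF that(1)] that(2)] .
  have sub: "cone_monoid M \<sigma> \<subseteq> cone_monoid M \<rho>" by (rule cone_monoid_antimono) fact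
  have base: "\<epsilon> d = \<gamma> d" if "d \<in> cone_monoid M \<sigma>" for d
    using that sub by (intro eq germ_base[OF \<gamma>]) auto
  show ?thesis
  proof (rule that)
    show "restrict \<epsilon> (cone_monoid M \<rho>) \<in> affine_toric M \<rho>"
    proof (rule affine_toricI)
      show "\<epsilon> 0 = 1" using base[OF cone_monoid_zero] affine_toric_zero[OF \<gamma>] by simp
      show "\<epsilon> (d + e) = \<epsilon> d * \<epsilon> e" if "d \<in> cone_monoid M \<rho>" "e \<in> cone_monoid M \<rho>" for d e
        by (rule eq) (use that cone_monoid_add germ_add[OF \<gamma>] \<epsilon> in auto)
    qed
    show "restrict (restrict \<epsilon> (cone_monoid M \<rho>)) (cone_monoid M \<sigma>) = \<gamma>"
    proof
      fix d show "restrict (restrict \<epsilon> (cone_monoid M \<rho>)) (cone_monoid M \<sigma>) d = \<gamma> d"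
      proof (cases "d \<in> cone_monoid M \<sigma>")
        case True then show ?thesis using base sub by auto
      next
        case False then show ?thesis using \<gamma> by (auto simp: affine_toric_def extensional_def)
      qed
    qed
    show "(d, restrict \<epsilon> (cone_monoid M \<rho>) d) \<in> germ \<sigma> \<gamma>" if "d \<in> cone_monoid M \<rho>" for d
      using \<epsilon> that by simp
  qed
qed

end

text \<open>\<open>separation\<close> is the Separation Lemma of toric geometry: \<open>m\<close> is
  nonnegative on \<sigma> and nonpositive on \<tau>, and inverting \<open>m\<close> in the monoid of
  \<sigma> gives the monoid of \<open>\<sigma> \<inter> \<tau>\<close>. Everything about the gluing
  rests on it.\<close>

locale separated_fan = additive_subgroup M for M :: "'a::euclidean_space set" +
  fixes \<Sigma> :: "'a set set"
  assumes fan_Int: "\<sigma> \<in> \<Sigma> \<Longrightarrow> \<tau> \<in> \<Sigma> \<Longrightarrow> \<sigma> \<inter> \<tau> \<in> \<Sigma>"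
    and separation: "\<sigma> \<in> \<Sigma> \<Longrightarrow> \<tau> \<in> \<Sigma> \<Longrightarrow> \<exists>m\<in>cone_monoid M \<sigma>. - m \<in> cone_monoid M \<tau> \<and>
      (\<forall>d\<in>cone_monoid M (\<sigma> \<inter> \<tau>). \<exists>n::nat. d + real n *\<^sub>R m \<in> cone_monoid M \<sigma>)"
begin

text \<open>Transitivity is not visible in the definition of \<open>toric_glue\<close>, but it is in
  equality of germs; so \<open>toric_pt\<close> is an equivalence class. Glued pairs have the same
  germ because \<open>m\<close> is a unit on \<open>\<sigma> \<inter> \<tau>\<close>, whence both
  germs equal that of the common extension \<delta>.\<close>

lemma toric_glue_iff_germ:
  assumes fan: "\<sigma> \<in> \<Sigma>" "\<tau> \<in> \<Sigma>" and \<gamma>: "\<gamma> \<in> affine_toric M \<sigma>" and \<eta>: "\<eta> \<in> affine_toric M \<tau>"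
  shows "((\<sigma>, \<gamma>), (\<tau>, \<eta>)) \<in> toric_glue M \<Sigma> \<longleftrightarrow> germ \<sigma> \<gamma> = germ \<tau> \<eta>"
proof
  have loc: "germ \<sigma> (restrict \<delta> (cone_monoid M \<sigma>)) = germ (\<sigma> \<inter> \<tau>) \<delta>"
    if fan: "\<sigma> \<in> \<Sigma>" "\<tau> \<in> \<Sigma>" and \<delta>: "\<delta> \<in> affine_toric M (\<sigma> \<inter> \<tau>)" for \<sigma> \<tau> and \<delta> :: "'a \<Rightarrow> 'b"
  proof -
    obtain m where m: "m \<in> cone_monoid M \<sigma>" "- m \<in> cone_monoid M \<tau>"
      "\<forall>d\<in>cone_monoid M (\<sigma> \<inter> \<tau>). \<exists>n::nat. d + real n *\<^sub>R m \<in> cone_monoid M \<sigma>"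
      using separation[OF fan] by blast
    have "\<delta> m \<noteq> 0"
      by (rule affine_toric_unit[OF \<delta>])
        (use m cone_monoid_antimono[of "\<sigma> \<inter> \<tau>" \<sigma> M] cone_monoid_antimono[of "\<sigma> \<inter> \<tau>" \<tau> M] in auto)
    then show ?thesis by (intro germ_localize[OF \<delta> _ m(1)]) (use m in auto)
  qed
  assume "((\<sigma>, \<gamma>), (\<tau>, \<eta>)) \<in> toric_glue M \<Sigma>"
  then obtain \<delta> where \<delta>: "\<delta> \<in> affine_toric M (\<sigma> \<inter> \<tau>)" "restrict \<delta> (cone_monoid M \<sigma>) = \<gamma>"
    "restrict \<delta> (cone_monoid M \<tau>) = \<eta>" unfolding toric_glue_def by auto
  from loc[OF fan \<delta>(1)] loc[OF fan(2,1), of \<delta>] \<delta> show "germ \<sigma> \<gamma> = germ \<tau> \<eta>"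
    by (simp add: Int_commute)
next
  assume eq: "germ \<sigma> \<gamma> = germ \<tau> \<eta>"
  obtain m where m: "m \<in> cone_monoid M \<sigma>" "- m \<in> cone_monoid M \<tau>"
      "\<forall>d\<in>cone_monoid M (\<sigma> \<inter> \<tau>). \<exists>n::nat. d + real n *\<^sub>R m \<in> cone_monoid M \<sigma>"
    using separation[OF fan] by blast
  \<comment> \<open>Write \<open>d\<close> as \<open>d + n m\<close> plus \<open>n (- m)\<close>.
    The first summand is in the monoid of \<sigma>, the second in that of \<tau>, and by
    \<open>eq\<close> both are in the domain of the same germ.\<close>
  have "cone_monoid M (\<sigma> \<inter> \<tau>) \<subseteq> Domain (germ \<sigma> \<gamma>)"
  proof
    fix d assume "d \<in> cone_monoid M (\<sigma> \<inter> \<tau>)"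
    then obtain n :: nat where "d + real n *\<^sub>R m \<in> cone_monoid M \<sigma>" using m by blast
    then have "(d + real n *\<^sub>R m, \<gamma> (d + real n *\<^sub>R m)) \<in> germ \<sigma> \<gamma>" by (rule germ_base[OF \<gamma>])
    moreover have "(real n *\<^sub>R (- m), \<eta> (real n *\<^sub>R (- m))) \<in> germ \<sigma> \<gamma>"
      unfolding eq by (rule germ_base[OF \<eta>]) (use m cone_monoid_scale in blast)
    ultimately have "(d + real n *\<^sub>R m + real n *\<^sub>R (- m),
        \<gamma> (d + real n *\<^sub>R m) * \<eta> (real n *\<^sub>R (- m))) \<in> germ \<sigma> \<gamma>"
      by (rule germ_add[OF \<gamma>])
    then show "d \<in> Domain (germ \<sigma> \<gamma>)" by auto
  qed
  then obtain \<delta> where \<delta>: "\<delta> \<in> affine_toric M (\<sigma> \<inter> \<tau>)" "restrict \<delta> (cone_monoid M \<sigma>) = \<gamma>"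
    "\<And>d. d \<in> cone_monoid M (\<sigma> \<inter> \<tau>) \<Longrightarrow> (d, \<delta> d) \<in> germ \<sigma> \<gamma>"
    using germ_extend[OF \<gamma> Int_lower1] by metis
  have "restrict \<delta> (cone_monoid M \<tau>) = \<eta>"
  proof
    fix d show "restrict \<delta> (cone_monoid M \<tau>) d = \<eta> d"
    proof (cases "d \<in> cone_monoid M \<tau>")
      case True
      then have "d \<in> cone_monoid M (\<sigma> \<inter> \<tau>)" using cone_monoid_antimono[of "\<sigma> \<inter> \<tau>" \<tau> M] by auto
      then show ?thesis using True germ_single_valued[OF \<eta>] germ_base[OF \<eta> True] \<delta>(3) eq by auto
    next
      case False then show ?thesis using \<eta> by (auto simp: affine_toric_def extensional_def)
    qed
  qed
  with \<delta> fan \<gamma> \<eta> show "((\<sigma>, \<gamma>), (\<tau>, \<eta>)) \<in> toric_glue M \<Sigma>" unfolding toric_glue_def by auto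
qed

lemma mem_toric_pt_iff:
  assumes "\<sigma> \<in> \<Sigma>" "\<gamma> \<in> affine_toric M \<sigma>"
  shows "(\<tau>, \<eta>) \<in> toric_pt M \<Sigma> \<sigma> \<gamma> \<longleftrightarrow> \<tau> \<in> \<Sigma> \<and> \<eta> \<in> affine_toric M \<tau> \<and> germ \<sigma> \<gamma> = germ \<tau> \<eta>"
  using toric_glue_iff_germ[OF assms(1) _ assms(2), of \<tau> \<eta>]
  unfolding toric_pt_def by (auto simp: toric_glue_def)

lemma toric_pt_eq_iff:
  assumes "\<sigma> \<in> \<Sigma>" "\<gamma> \<in> affine_toric M \<sigma>" "\<tau> \<in> \<Sigma>" "\<eta> \<in> affine_toric M \<tau>"
  shows "toric_pt M \<Sigma> \<sigma> \<gamma> = toric_pt M \<Sigma> \<tau> \<eta> \<longleftrightarrow> ((\<sigma>, \<gamma>), (\<tau>, \<eta>)) \<in> toric_glue M \<Sigma>"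
proof
  assume "toric_pt M \<Sigma> \<sigma> \<gamma> = toric_pt M \<Sigma> \<tau> \<eta>"
  then have "(\<tau>, \<eta>) \<in> toric_pt M \<Sigma> \<sigma> \<gamma>" using mem_toric_pt_iff[OF assms(3,4), of \<tau> \<eta>] assms by simp
  then show "((\<sigma>, \<gamma>), (\<tau>, \<eta>)) \<in> toric_glue M \<Sigma>" by (simp add: toric_pt_def)
next
  assume "((\<sigma>, \<gamma>), (\<tau>, \<eta>)) \<in> toric_glue M \<Sigma>"
  then have "germ \<sigma> \<gamma> = germ \<tau> \<eta>" using toric_glue_iff_germ[OF assms(1,3,2,4)] by simp
  then have "p \<in> toric_pt M \<Sigma> \<sigma> \<gamma> \<longleftrightarrow> p \<in> toric_pt M \<Sigma> \<tau> \<eta>" for p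
    using mem_toric_pt_iff[OF assms(1,2)] mem_toric_pt_iff[OF assms(3,4)] by (cases p) simp
  then show "toric_pt M \<Sigma> \<sigma> \<gamma> = toric_pt M \<Sigma> \<tau> \<eta>" by blast
qed

lemma toric_pt_eqI:
  assumes "\<sigma> \<in> \<Sigma>" "\<tau> \<in> \<Sigma>" "\<delta> \<in> affine_toric M (\<sigma> \<inter> \<tau>)"
  shows "toric_pt M \<Sigma> \<sigma> (restrict \<delta> (cone_monoid M \<sigma>)) = toric_pt M \<Sigma> \<tau> (restrict \<delta> (cone_monoid M \<tau>))"
proof -
  note r = affine_toric_restrict[OF assms(3) Int_lower1] affine_toric_restrict[OF assms(3) Int_lower2]
  show ?thesis
    unfolding toric_pt_eq_iff[OF assms(1) r(1) assms(2) r(2)]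
    using assms r unfolding toric_glue_def by auto
qed

lemma toric_coord_pt:
  assumes "\<sigma> \<in> \<Sigma>" "\<gamma> \<in> affine_toric M \<sigma>"
  shows "toric_coord \<sigma> (toric_pt M \<Sigma> \<sigma> \<gamma>) = \<gamma>"
  unfolding toric_coord_def
proof (rule the_equality)
  show "(\<sigma>, \<gamma>) \<in> toric_pt M \<Sigma> \<sigma> \<gamma>" using assms by (simp add: mem_toric_pt_iff)
  fix \<eta> assume "(\<sigma>, \<eta>) \<in> toric_pt M \<Sigma> \<sigma> \<gamma>"
  then have \<eta>: "\<eta> \<in> affine_toric M \<sigma>" "germ \<sigma> \<gamma> = germ \<sigma> \<eta>" using mem_toric_pt_iff[OF assms] by auto
  show "\<eta> = \<gamma>"
  proof
    fix d show "\<eta> d = \<gamma> d"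
    proof (cases "d \<in> cone_monoid M \<sigma>")
      case True
      then show ?thesis
        using germ_single_valued[OF \<eta>(1) germ_base[OF \<eta>(1) True]] germ_base[OF assms(2) True] \<eta>(2) by simp
    next
      case False then show ?thesis using \<eta>(1) assms(2) by (auto simp: affine_toric_def extensional_def)
    qed
  qed
qed

lemma toric_chart_pt: "\<sigma> \<in> \<Sigma> \<Longrightarrow> \<gamma> \<in> affine_toric M \<sigma> \<Longrightarrow> toric_pt M \<Sigma> \<sigma> \<gamma> \<in> toric_chart M \<Sigma> \<sigma>"
  unfolding toric_chart_def by blast

lemma
  assumes "\<sigma> \<in> \<Sigma>" "x \<in> toric_chart M \<Sigma> \<sigma>"
  shows toric_coord_affine: "toric_coord \<sigma> x \<in> affine_toric M \<sigma>"
    and toric_pt_coord: "toric_pt M \<Sigma> \<sigma> (toric_coord \<sigma> x) = x"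
proof -
  obtain \<gamma> where "\<gamma> \<in> affine_toric M \<sigma>" "x = toric_pt M \<Sigma> \<sigma> \<gamma>"
    using assms(2) unfolding toric_chart_def by blast
  then show "toric_coord \<sigma> x \<in> affine_toric M \<sigma>" "toric_pt M \<Sigma> \<sigma> (toric_coord \<sigma> x) = x"
    by (simp_all add: toric_coord_pt[OF assms(1)])
qed

lemma toric_chart_eqI:
  assumes "\<sigma> \<in> \<Sigma>" "x \<in> toric_chart M \<Sigma> \<sigma>" "y \<in> toric_chart M \<Sigma> \<sigma>"
    and "\<And>d. d \<in> cone_monoid M \<sigma> \<Longrightarrow> toric_coord \<sigma> x d = toric_coord \<sigma> y d"
  shows "x = y"
proof -
  have "toric_coord \<sigma> x = toric_coord \<sigma> y"
    by (rule extensionalityI[of _ "cone_monoid M \<sigma>"])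
      (use toric_coord_affine[OF assms(1,2)] toric_coord_affine[OF assms(1,3)] assms(4)
        in \<open>auto simp: affine_toric_def\<close>)
  then show ?thesis using toric_pt_coord[OF assms(1,2)] toric_pt_coord[OF assms(1,3)] by metis
qed

lemma toric_chart_pt_eq:
  assumes "\<rho> \<in> \<Sigma>" "\<sigma> \<in> \<Sigma>" "\<rho> \<subseteq> \<sigma>" "\<delta> \<in> affine_toric M \<rho>"
  shows "toric_pt M \<Sigma> \<rho> \<delta> = toric_pt M \<Sigma> \<sigma> (restrict \<delta> (cone_monoid M \<sigma>))"
proof -
  have "restrict \<delta> (cone_monoid M \<rho>) = \<delta>" using assms(4) by (auto simp: affine_toric_def extensional_restrict)
  moreover have "\<rho> \<inter> \<sigma> = \<rho>" using assms(3) by blast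
  ultimately show ?thesis using toric_pt_eqI[OF assms(1,2), of \<delta>] assms(4) by simp
qed

lemma
  assumes "\<rho> \<in> \<Sigma>" "\<sigma> \<in> \<Sigma>" "\<rho> \<subseteq> \<sigma>" "x \<in> toric_chart M \<Sigma> \<rho>"
  shows toric_chart_mono: "x \<in> toric_chart M \<Sigma> \<sigma>"
    and toric_coord_mono: "d \<in> cone_monoid M \<sigma> \<Longrightarrow> toric_coord \<sigma> x d = toric_coord \<rho> x d"
proof -
  have 1: "x = toric_pt M \<Sigma> \<sigma> (restrict (toric_coord \<rho> x) (cone_monoid M \<sigma>))"
    using toric_chart_pt_eq[OF assms(1-3) toric_coord_affine[OF assms(1,4)]] toric_pt_coord[OF assms(1,4)]
    by simp
  have 2: "restrict (toric_coord \<rho> x) (cone_monoid M \<sigma>) \<in> affine_toric M \<sigma>"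
    by (rule affine_toric_restrict[OF toric_coord_affine[OF assms(1,4)] assms(3)])
  show "x \<in> toric_chart M \<Sigma> \<sigma>" using 1 toric_chart_pt[OF assms(2) 2] by simp
  show "toric_coord \<sigma> x d = toric_coord \<rho> x d" if "d \<in> cone_monoid M \<sigma>"
    using toric_coord_pt[OF assms(2) 2] 1 that by (metis restrict_apply')
qed

text \<open>The coordinates of \<open>x\<close> extend to the larger monoid as quotients by powers
  of the value at \<open>m\<close>. Thus nonvanishing of one monomial detects membership in a
  smaller chart, which is used for chart intersections and for the preimage of the torus.\<close>

lemma toric_chart_localize:
  assumes fan: "\<rho> \<in> \<Sigma>" "\<sigma> \<in> \<Sigma>" "\<rho> \<subseteq> \<sigma>" and x: "x \<in> toric_chart M \<Sigma> \<sigma>"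
    and m: "m \<in> cone_monoid M \<sigma>" "toric_coord \<sigma> x m \<noteq> 0"
    and loc: "\<And>d. d \<in> cone_monoid M \<rho> \<Longrightarrow> \<exists>n::nat. d + real n *\<^sub>R m \<in> cone_monoid M \<sigma>"
  shows "x \<in> toric_chart M \<Sigma> \<rho>"
proof -
  let ?\<gamma> = "toric_coord \<sigma> x"
  note \<gamma> = toric_coord_affine[OF fan(2) x]
  have "cone_monoid M \<rho> \<subseteq> Domain (germ \<sigma> ?\<gamma>)"
  proof
    fix d assume "d \<in> cone_monoid M \<rho>"
    then obtain n :: nat where n: "d + real n *\<^sub>R m \<in> cone_monoid M \<sigma>" using loc by blast
    have "(d, ?\<gamma> (d + real n *\<^sub>R m) / ?\<gamma> (real n *\<^sub>R m)) \<in> germ \<sigma> ?\<gamma>"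
      by (rule germI[OF n cone_monoid_scale[OF m(1), of n]]) (use m affine_toric_scale[OF \<gamma> m(1)] in auto)
    then show "d \<in> Domain (germ \<sigma> ?\<gamma>)" by blast
  qed
  then obtain \<delta> where \<delta>: "\<delta> \<in> affine_toric M \<rho>" "restrict \<delta> (cone_monoid M \<sigma>) = ?\<gamma>"
    using germ_extend[OF \<gamma> fan(3)] by metis
  have "x = toric_pt M \<Sigma> \<rho> \<delta>"
    using toric_chart_pt_eq[OF fan \<delta>(1)] \<delta>(2) toric_pt_coord[OF fan(2) x] by simp
  then show ?thesis using toric_chart_pt[OF fan(1) \<delta>(1)] by simp
qed

text \<open>The common extension \<delta> that witnesses the gluing is itself a representative of
  \<open>x\<close> in the chart of the intersection.\<close>

lemma toric_chart_Int:
  assumes fan: "\<sigma> \<in> \<Sigma>" "\<tau> \<in> \<Sigma>" and x: "x \<in> toric_chart M \<Sigma> \<sigma>" "x \<in> toric_chart M \<Sigma> \<tau>"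
  shows "x \<in> toric_chart M \<Sigma> (\<sigma> \<inter> \<tau>)"
proof -
  have "((\<sigma>, toric_coord \<sigma> x), (\<tau>, toric_coord \<tau> x)) \<in> toric_glue M \<Sigma>"
    using toric_pt_eq_iff[OF fan(1) toric_coord_affine[OF fan(1) x(1)] fan(2) toric_coord_affine[OF fan(2) x(2)]]
      toric_pt_coord[OF fan(1) x(1)] toric_pt_coord[OF fan(2) x(2)] by simp
  then obtain \<delta> where \<delta>: "\<delta> \<in> affine_toric M (\<sigma> \<inter> \<tau>)" "restrict \<delta> (cone_monoid M \<sigma>) = toric_coord \<sigma> x"
    unfolding toric_glue_def by auto
  have "x = toric_pt M \<Sigma> (\<sigma> \<inter> \<tau>) \<delta>"
    using toric_chart_pt_eq[OF fan_Int[OF fan] fan(1) Int_lower1 \<delta>(1)] \<delta>(2) toric_pt_coord[OF fan(1) x(1)]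
    by simp
  then show ?thesis using toric_chart_pt[OF fan_Int[OF fan] \<delta>(1)] by simp
qed

lemma toric_coord_zero: "\<sigma> \<in> \<Sigma> \<Longrightarrow> x \<in> toric_chart M \<Sigma> \<sigma> \<Longrightarrow> toric_coord \<sigma> x 0 = 1"
  by (rule affine_toric_zero[OF toric_coord_affine])

lemma toric_coord_add:
  "\<sigma> \<in> \<Sigma> \<Longrightarrow> x \<in> toric_chart M \<Sigma> \<sigma> \<Longrightarrow> d \<in> cone_monoid M \<sigma> \<Longrightarrow> e \<in> cone_monoid M \<sigma> \<Longrightarrow>
    toric_coord \<sigma> x (d + e) = toric_coord \<sigma> x d * toric_coord \<sigma> x e"
  by (rule affine_toric_add[OF toric_coord_affine])

section \<open>The atlas of a fan and morphisms into it\<close>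

definition charts :: "(('a, 'k::field) toric_point set \<times> (('a, 'k) toric_point \<Rightarrow> 'k) set) set" where
  "charts = {(toric_chart M \<Sigma> \<sigma>, toric_chart_ring M \<sigma>) | \<sigma>. \<sigma> \<in> \<Sigma>}"

lemma toric_chart_ringI:
  "finite A \<Longrightarrow> A \<subseteq> cone_monoid M \<sigma> \<Longrightarrow> (\<lambda>x. \<Sum>m\<in>A. c m * toric_coord \<sigma> x m) \<in> toric_chart_ring M \<sigma>"
  unfolding toric_chart_ring_def by blast

lemma toric_chart_ringE:
  assumes "s \<in> toric_chart_ring M \<sigma>"
  obtains A c where "finite A" "A \<subseteq> cone_monoid M \<sigma>" "s = (\<lambda>x. \<Sum>m\<in>A. c m * toric_coord \<sigma> x m)"
  using assms unfolding toric_chart_ring_def by blast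

sublocale toric: chart_atlas "charts :: (('a, 'k::field) toric_point set \<times> (('a, 'k) toric_point \<Rightarrow> 'k) set) set"
proof
  fix D :: "('a, 'k) toric_point set" and R and c :: 'k assume "(D, R) \<in> charts"
  then obtain \<sigma> where \<sigma>: "\<sigma> \<in> \<Sigma>" "D = toric_chart M \<Sigma> \<sigma>" "R = toric_chart_ring M \<sigma>" unfolding charts_def by auto
  have "(\<lambda>x. \<Sum>m\<in>{0}. c * toric_coord \<sigma> x m) \<in> R"
    unfolding \<sigma> by (rule toric_chart_ringI) (auto simp: cone_monoid_zero)
  then show "\<exists>s\<in>R. \<forall>q\<in>D. s q = c"
    by (rule rev_bexI) (use \<sigma> toric_coord_zero in auto)
next
  fix D :: "('a, 'k) toric_point set" and R s t assume "(D, R) \<in> charts" and st: "s \<in> R" "t \<in> R"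
  then obtain \<sigma> where \<sigma>: "\<sigma> \<in> \<Sigma>" "D = toric_chart M \<Sigma> \<sigma>" "R = toric_chart_ring M \<sigma>" unfolding charts_def by auto
  obtain A c where A: "finite A" "A \<subseteq> cone_monoid M \<sigma>" "s = (\<lambda>x. \<Sum>m\<in>A. c m * toric_coord \<sigma> x m)"
    using st(1) unfolding \<sigma> by (rule toric_chart_ringE)
  obtain B e where B: "finite B" "B \<subseteq> cone_monoid M \<sigma>" "t = (\<lambda>x. \<Sum>m\<in>B. e m * toric_coord \<sigma> x m)"
    using st(2) unfolding \<sigma> by (rule toric_chart_ringE)
  define f where "f m = (if m \<in> A then c m else 0) + (if m \<in> B then e m else 0)" for m
  have "(\<lambda>x. \<Sum>m\<in>A \<union> B. f m * toric_coord \<sigma> x m) \<in> R"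
    unfolding \<sigma> by (rule toric_chart_ringI) (use A B in auto)
  moreover have "(\<Sum>m\<in>A \<union> B. f m * toric_coord \<sigma> x m) = s x + t x" for x
  proof -
    have "s x = (\<Sum>m\<in>A \<union> B. (if m \<in> A then c m else 0) * toric_coord \<sigma> x m)"
      unfolding A(3) by (rule sum.mono_neutral_cong_left) (use A B in auto)
    moreover have "t x = (\<Sum>m\<in>A \<union> B. (if m \<in> B then e m else 0) * toric_coord \<sigma> x m)"
      unfolding B(3) by (rule sum.mono_neutral_cong_left) (use A B in auto)
    ultimately show ?thesis by (simp add: f_def distrib_right sum.distrib)
  qed
  ultimately show "\<exists>r\<in>R. \<forall>q\<in>D. r q = s q + t q" by (intro rev_bexI) auto
  \<comment> \<open>Different pairs of exponents may have the same sum, so the coefficient of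
    \<open>d\<close> in the product collects all pairs adding up to \<open>d\<close>.\<close>
  define g where "g d = (\<Sum>p\<in>{p\<in>A \<times> B. fst p + snd p = d}. c (fst p) * e (snd p))" for d
  let ?T = "(\<lambda>p. fst p + snd p) ` (A \<times> B)"
  have "(\<lambda>x. \<Sum>d\<in>?T. g d * toric_coord \<sigma> x d) \<in> R"
    unfolding \<sigma> by (rule toric_chart_ringI) (use A B in \<open>auto intro!: cone_monoid_add\<close>)
  moreover have "(\<Sum>d\<in>?T. g d * toric_coord \<sigma> x d) = s x * t x" if "x \<in> D" for x
  proof -
    have "s x * t x = (\<Sum>p\<in>A \<times> B. (c (fst p) * e (snd p)) * toric_coord \<sigma> x (fst p + snd p))"
      unfolding A(3) B(3) sum_product sum.cartesian_product case_prod_beta'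
      by (rule sum.cong) (use that \<sigma> A B in \<open>auto simp: toric_coord_add subset_iff algebra_simps\<close>)
    also have "\<dots> = (\<Sum>d\<in>?T. \<Sum>p\<in>{p\<in>A \<times> B. fst p + snd p = d}.
        (c (fst p) * e (snd p)) * toric_coord \<sigma> x (fst p + snd p))"
      by (rule sum.group[symmetric]) (use A B in auto)
    also have "\<dots> = (\<Sum>d\<in>?T. g d * toric_coord \<sigma> x d)"
      unfolding g_def sum_distrib_right by (intro sum.cong) auto
    finally show ?thesis ..
  qed
  ultimately show "\<exists>r\<in>R. \<forall>q\<in>D. r q = s q * t q" by (intro rev_bexI) auto
next
  fix D1 D2 :: "('a, 'k) toric_point set" and R1 R2 p
  assume "(D1, R1) \<in> charts" "(D2, R2) \<in> charts" and p: "p \<in> D1" "p \<in> D2"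
  then obtain \<sigma> \<tau> where \<sigma>: "\<sigma> \<in> \<Sigma>" "D1 = toric_chart M \<Sigma> \<sigma>" "R1 = toric_chart_ring M \<sigma>"
    and \<tau>: "\<tau> \<in> \<Sigma>" "D2 = toric_chart M \<Sigma> \<tau>" "R2 = toric_chart_ring M \<tau>" unfolding charts_def by auto
  note fan = fan_Int[OF \<sigma>(1) \<tau>(1)]
  have conv: "\<exists>s'\<in>toric_chart_ring M (\<sigma> \<inter> \<tau>). \<forall>q\<in>toric_chart M \<Sigma> (\<sigma> \<inter> \<tau>). s' q = s q"
    if s: "s \<in> toric_chart_ring M \<upsilon>" and \<upsilon>: "\<upsilon> \<in> \<Sigma>" "\<sigma> \<inter> \<tau> \<subseteq> \<upsilon>" for s :: "('a, 'k) toric_point \<Rightarrow> 'k" and \<upsilon>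
  proof -
    obtain A c where A: "finite A" "A \<subseteq> cone_monoid M \<upsilon>" "s = (\<lambda>x. \<Sum>m\<in>A. c m * toric_coord \<upsilon> x m)"
      using s by (rule toric_chart_ringE)
    have "(\<lambda>x. \<Sum>m\<in>A. c m * toric_coord (\<sigma> \<inter> \<tau>) x m) \<in> toric_chart_ring M (\<sigma> \<inter> \<tau>)"
      by (rule toric_chart_ringI) (use A cone_monoid_antimono[OF \<upsilon>(2), of M] in auto)
    moreover have "(\<Sum>m\<in>A. c m * toric_coord (\<sigma> \<inter> \<tau>) q m) = s q" if "q \<in> toric_chart M \<Sigma> (\<sigma> \<inter> \<tau>)" for q
      unfolding A(3) by (intro sum.cong refl) (use A(2) toric_coord_mono[OF fan \<upsilon> that] in auto)
    ultimately show ?thesis by (intro rev_bexI) auto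
  qed
  have "(toric_chart M \<Sigma> (\<sigma> \<inter> \<tau>), toric_chart_ring M (\<sigma> \<inter> \<tau>)) \<in> charts" using fan unfolding charts_def by blast
  moreover have "p \<in> toric_chart M \<Sigma> (\<sigma> \<inter> \<tau>)" using toric_chart_Int \<sigma> \<tau> p by auto
  moreover have "toric_chart M \<Sigma> (\<sigma> \<inter> \<tau>) \<subseteq> D1 \<inter> D2"
    using toric_chart_mono[OF fan \<sigma>(1)] toric_chart_mono[OF fan \<tau>(1)] \<sigma> \<tau> by auto
  moreover have "\<forall>s\<in>R1 \<union> R2. \<exists>s'\<in>toric_chart_ring M (\<sigma> \<inter> \<tau>). \<forall>q\<in>toric_chart M \<Sigma> (\<sigma> \<inter> \<tau>). s' q = s q"
    using conv[OF _ \<sigma>(1)] conv[OF _ \<tau>(1)] \<sigma> \<tau> by auto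
  ultimately show "\<exists>(D, A)\<in>charts. p \<in> D \<and> D \<subseteq> D1 \<inter> D2 \<and> (\<forall>s\<in>R1 \<union> R2. \<exists>s'\<in>A. \<forall>q\<in>D. s' q = s q)"
    by (intro bexI[of _ "(toric_chart M \<Sigma> (\<sigma> \<inter> \<tau>), toric_chart_ring M (\<sigma> \<inter> \<tau>))"]) auto
qed

lemma zariski_fan: "zariski (fan_toric_variety M \<Sigma>) = zariski (variety_of_charts charts)"
  and regular_fan: "regular (fan_toric_variety M \<Sigma>) = regular (variety_of_charts charts)"
  by (simp_all add: fan_toric_variety_def charts_def Let_def)

lemma function_space_fan: "function_space (fan_toric_variety M \<Sigma>)"
  by (rule function_space_cong[OF toric.function_space_charts zariski_fan regular_fan])

lemma points_fan: "points (fan_toric_variety M \<Sigma>) = (\<Union>\<sigma>\<in>\<Sigma>. toric_chart M \<Sigma> \<sigma>)"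
  unfolding zariski_fan toric.points_charts by (auto simp: charts_def)

lemma openin_toric_chart:
  "\<sigma> \<in> \<Sigma> \<Longrightarrow> openin (zariski (fan_toric_variety M \<Sigma> :: (('a, 'k::field) toric_point, 'k) toric_variety)) (toric_chart M \<Sigma> \<sigma>)"
  unfolding zariski_fan by (rule toric.openin_chart) (auto simp: charts_def)

lemma regular_toric_coord:
  assumes "\<sigma> \<in> \<Sigma>" "m \<in> cone_monoid M \<sigma>"
  shows "(\<lambda>x. toric_coord \<sigma> x m :: 'k::field) \<in> regular (fan_toric_variety M \<Sigma>) (toric_chart M \<Sigma> \<sigma>)"
proof -
  have "(\<lambda>x. \<Sum>d\<in>{m}. 1 * toric_coord \<sigma> x d :: 'k) \<in> toric_chart_ring M \<sigma>"
    by (rule toric_chart_ringI) (use assms in auto)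
  then show ?thesis
    unfolding regular_fan
    by (intro toric.regular_chart_fun) (use assms in \<open>auto simp: charts_def\<close>)
qed

text \<open>\<open>variety_morphism_into_charts\<close> asks about every chart containing the image
  point; here one suitable chart per point is enough. The separating \<open>m\<close> leads to any
  other chart \<tau>: near \<open>p\<close> its monomial is invertible, and
  \<open>d = (d + n m) - n m\<close> expresses the coordinates on \<tau> through those on
  \<sigma>.\<close>

lemma variety_morphism_into_fan:
  assumes Z: "function_space (Z :: ('z, 'k::field, 'y) variety_scheme)"
    and loc: "\<And>p. p \<in> points Z \<Longrightarrow> \<exists>\<sigma>\<in>\<Sigma>. \<exists>W. openin (zariski Z) W \<and> p \<in> W \<and> g ` W \<subseteq> toric_chart M \<Sigma> \<sigma> \<and>
       (\<forall>m\<in>cone_monoid M \<sigma>. (\<lambda>q. toric_coord \<sigma> (g q) m) \<in> regular Z W)"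
  shows "variety_morphism Z (fan_toric_variety M \<Sigma> :: (('a, 'k) toric_point, 'k) toric_variety) g"
proof -
  interpret Z: function_space Z by fact
  have "variety_morphism Z (variety_of_charts charts) g"
  proof (rule toric.variety_morphism_into_charts[OF Z])
    fix p assume "p \<in> points Z"
    then show "g p \<in> \<Union> (fst ` charts)"
      using loc[of p] by (force simp: charts_def)
  next
    fix D R p assume "(D, R) \<in> charts" and p: "p \<in> points Z" "g p \<in> D"
    then obtain \<tau> where \<tau>: "\<tau> \<in> \<Sigma>" "D = toric_chart M \<Sigma> \<tau>" "R = toric_chart_ring M \<tau>" unfolding charts_def by auto
    obtain \<sigma> W where \<sigma>: "\<sigma> \<in> \<Sigma>" and W: "openin (zariski Z) W" "p \<in> W" "g ` W \<subseteq> toric_chart M \<Sigma> \<sigma>"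
      "\<And>m. m\<in>cone_monoid M \<sigma> \<Longrightarrow> (\<lambda>q. toric_coord \<sigma> (g q) m) \<in> regular Z W" using loc[OF p(1)] by blast
    let ?\<rho> = "\<sigma> \<inter> \<tau>"
    note \<rho> = fan_Int[OF \<sigma> \<tau>(1)]
    obtain m where m: "m \<in> cone_monoid M \<sigma>" "- m \<in> cone_monoid M \<tau>"
      "\<forall>d\<in>cone_monoid M (\<sigma> \<inter> \<tau>). \<exists>n::nat. d + real n *\<^sub>R m \<in> cone_monoid M \<sigma>"
      using separation[OF \<sigma> \<tau>(1)] by blast
    \<comment> \<open>\<open>V\<close> is the part of \<open>W\<close> that lands in the chart of
      \<open>\<sigma> \<inter> \<tau>\<close>: there \<open>m\<close> is a unit, and conversely its
      nonvanishing forces membership.\<close>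
    define V where "V = {q\<in>W. toric_coord \<sigma> (g q) m \<noteq> 0}"
    have V: "openin (zariski Z) V" unfolding V_def by (rule Z.openin_nonzero[OF W(1) W(4)[OF m(1)]])
    have gV: "g q \<in> toric_chart M \<Sigma> ?\<rho>" if "q \<in> V" for q
      by (rule toric_chart_localize[OF \<rho> \<sigma> Int_lower1 _ m(1)]) (use that W m V_def in auto)
    have m\<rho>: "m \<in> cone_monoid M ?\<rho>" "- m \<in> cone_monoid M ?\<rho>"
      using m cone_monoid_antimono[of ?\<rho> \<sigma> M] cone_monoid_antimono[of ?\<rho> \<tau> M] by auto
    have gp: "g p \<in> toric_chart M \<Sigma> ?\<rho>" using toric_chart_Int[OF \<sigma> \<tau>(1)] p \<tau> W by auto
    have "toric_coord \<sigma> (g p) m \<noteq> 0"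
      unfolding toric_coord_mono[OF \<rho> \<sigma> Int_lower1 gp m(1)]
      by (rule affine_toric_unit[OF toric_coord_affine[OF \<rho> gp] m\<rho>])
    then have pV: "p \<in> V" using W V_def by auto
    have reg: "(\<lambda>q. toric_coord \<tau> (g q) d) \<in> regular Z V" if d: "d \<in> cone_monoid M \<tau>" for d
    proof -
      have d\<rho>: "d \<in> cone_monoid M ?\<rho>" using d cone_monoid_antimono[of ?\<rho> \<tau> M] by auto
      then obtain n :: nat where n: "d + real n *\<^sub>R m \<in> cone_monoid M \<sigma>" using m by blast
      have 1: "(\<lambda>q. toric_coord \<sigma> (g q) (d + real n *\<^sub>R m)) \<in> regular Z V"
        by (rule Z.regular_restrict[OF W(4)[OF n] W(1) V]) (auto simp: V_def)
      have 2: "(\<lambda>q. inverse (toric_coord \<sigma> (g q) m) ^ n) \<in> regular Z V"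
        by (rule Z.regular_power[OF V])
          (use Z.regular_inverse[OF W(1) W(4)[OF m(1)]] in \<open>simp add: V_def\<close>)
      show ?thesis
      proof (rule Z.regular_cong[OF Z.regular_mult[OF V 1 2] V])
        fix q assume q: "q \<in> V"
        note gq = gV[OF q]
        note aff = toric_coord_affine[OF \<rho> gq]
        have "toric_coord \<sigma> (g q) (d + real n *\<^sub>R m) = toric_coord ?\<rho> (g q) d * toric_coord ?\<rho> (g q) m ^ n"
          unfolding toric_coord_mono[OF \<rho> \<sigma> Int_lower1 gq n]
          using affine_toric_add[OF aff d\<rho> cone_monoid_scale[OF m\<rho>(1)]] affine_toric_scale[OF aff m\<rho>(1)]
          by simp
        moreover have "toric_coord ?\<rho> (g q) m = toric_coord \<sigma> (g q) m"
          using toric_coord_mono[OF \<rho> \<sigma> Int_lower1 gq m(1)] by simp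
        moreover have "toric_coord \<tau> (g q) d = toric_coord ?\<rho> (g q) d"
          by (rule toric_coord_mono[OF \<rho> \<tau>(1) Int_lower2 gq d])
        ultimately show "toric_coord \<tau> (g q) d =
            toric_coord \<sigma> (g q) (d + real n *\<^sub>R m) * inverse (toric_coord \<sigma> (g q) m) ^ n"
          using q by (simp add: V_def power_inverse field_simps)
      qed
    qed
    have "s \<circ> g \<in> regular Z V" if s: "s \<in> R" for s
    proof -
      obtain A c where A: "finite A" "A \<subseteq> cone_monoid M \<tau>" "s = (\<lambda>x. \<Sum>m\<in>A. c m * toric_coord \<tau> x m)"
        using s unfolding \<tau> by (rule toric_chart_ringE)
      have "(\<lambda>q. \<Sum>m\<in>A. c m * toric_coord \<tau> (g q) m) \<in> regular Z V"
        by (intro Z.regular_sum Z.regular_mult Z.regular_const V reg) (use A in auto)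
      then show ?thesis unfolding A(3) by (simp add: comp_def)
    qed
    moreover have "g ` V \<subseteq> D" using gV toric_chart_mono[OF \<rho> \<tau>(1) Int_lower2] \<tau> by auto
    ultimately show "\<exists>W. openin (zariski Z) W \<and> p \<in> W \<and> g ` W \<subseteq> D \<and> (\<forall>s\<in>R. s \<circ> g \<in> regular Z W)"
      using V pV by blast
  qed
  then show ?thesis
    using variety_morphism_cong[OF refl refl zariski_fan regular_fan] by blast
qed

end

section \<open>Normal fans of lattice polytopes\<close>

text \<open>A finitely generated cone is closed, so a point outside it is strictly separated from it
  by a hyperplane, whose normal is then nonnegative on the generators and negative on
  \<open>m\<close>.\<close>

lemma farkas:
  fixes S :: "'a::euclidean_space set"
  assumes "finite S" and m: "\<And>u. (\<forall>s\<in>S. 0 \<le> u \<bullet> s) \<Longrightarrow> 0 \<le> u \<bullet> m"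
  shows "m \<in> convex_cone hull S"
proof (rule ccontr)
  let ?C = "convex_cone hull S"
  assume "m \<notin> ?C"
  then obtain a b where ab: "a \<bullet> m < b" "\<forall>x\<in>?C. b < a \<bullet> x"
    using separating_hyperplane_closed_point[OF convex_convex_cone_hull closed_convex_cone_hull[OF assms(1)]]
    by blast
  have b: "b < 0" using ab(2) convex_cone_hull_contains_0 by fastforce
  have "0 \<le> a \<bullet> s" if "s \<in> S" for s
  proof (rule ccontr)
    assume neg: "\<not> 0 \<le> a \<bullet> s"
    \<comment> \<open>The factor is chosen so that \<open>a\<close> takes exactly the value
      \<open>b\<close> on the multiple, which contradicts strict separation.\<close>
    have "(b / (a \<bullet> s)) *\<^sub>R s \<in> ?C"
      by (rule convex_cone_hull_mul) (use b neg that in \<open>auto intro: hull_inc divide_nonpos_nonpos\<close>)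
    then have "b < a \<bullet> ((b / (a \<bullet> s)) *\<^sub>R s)" using ab(2) by blast
    then show False using neg by simp
  qed
  then have "0 \<le> a \<bullet> m" using m by blast
  then show False using ab b by linarith
qed

section \<open>Normal cones of finite point sets and their duals\<close>

lemma inner_normal_cone_hull_left: "inner_normal_cone (convex hull S) A = inner_normal_cone S A"
proof -
  have "u \<bullet> x \<le> u \<bullet> y" if "\<forall>y\<in>S. u \<bullet> x \<le> u \<bullet> y" "y \<in> convex hull S" for u x y :: 'a
  proof -
    have "convex hull S \<subseteq> {y. u \<bullet> y \<ge> u \<bullet> x}"
      by (rule hull_minimal) (use that convex_halfspace_ge in auto)
    then show ?thesis using that by auto
  qed
  then show ?thesis unfolding inner_normal_cone_def using hull_subset[of S convex] by blast
qed

lemma inner_normal_cone_hull_right: "inner_normal_cone S (convex hull A) = inner_normal_cone S A"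
proof -
  have "u \<bullet> x \<le> u \<bullet> y" if "\<forall>x\<in>A. u \<bullet> x \<le> u \<bullet> y" "x \<in> convex hull A" for u x y :: 'a
  proof -
    have "convex hull A \<subseteq> {x. u \<bullet> x \<le> u \<bullet> y}"
      by (rule hull_minimal) (use that convex_halfspace_le in auto)
    then show ?thesis using that by auto
  qed
  then show ?thesis unfolding inner_normal_cone_def using hull_subset[of A convex] by blast
qed

lemma inner_normal_cone_Un: "inner_normal_cone S (A \<union> B) = inner_normal_cone S A \<inter> inner_normal_cone S B"
  by (auto simp: inner_normal_cone_def)

lemma inner_normal_cone_antimono: "A \<subseteq> B \<Longrightarrow> T \<subseteq> S \<Longrightarrow> inner_normal_cone S B \<subseteq> inner_normal_cone T A"
  by (auto simp: inner_normal_cone_def)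

text \<open>\<open>A\<close> need not generate a face. It has the same normal cone as the least face
  containing it, because a form minimal on \<open>A\<close> cuts out a face of the hull that
  contains \<open>A\<close> and hence that least face. With arbitrary subsets,
  \<open>inner_normal_cone_Un\<close> gives closure of the fan under intersection.\<close>

lemma inner_normal_fan_hull:
  fixes S :: "'a::euclidean_space set"
  assumes "finite S"
  shows "inner_normal_fan (convex hull S) = {inner_normal_cone S A | A. A \<noteq> {} \<and> A \<subseteq> S}"
proof (intro equalityI subsetI)
  fix \<sigma> assume "\<sigma> \<in> inner_normal_fan (convex hull S)"
  then obtain G where G: "G face_of convex hull S" "G \<noteq> {}" "\<sigma> = inner_normal_cone (convex hull S) G"
    unfolding inner_normal_fan_def by blast
  obtain A where "A \<subseteq> S" "G = convex hull A"
    using face_of_convex_hull_subset[OF finite_imp_compact[OF assms] G(1)] .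
  then show "\<sigma> \<in> {inner_normal_cone S A | A. A \<noteq> {} \<and> A \<subseteq> S}"
    using G by (auto simp: inner_normal_cone_hull_left inner_normal_cone_hull_right)
next
  fix \<sigma> assume "\<sigma> \<in> {inner_normal_cone S A | A. A \<noteq> {} \<and> A \<subseteq> S}"
  then obtain A where A: "A \<noteq> {}" "A \<subseteq> S" "\<sigma> = inner_normal_cone S A" by blast
  let ?P = "convex hull S"
  let ?F = "{T. T face_of ?P \<and> A \<subseteq> T}"
  have SP: "S \<subseteq> ?P" by (rule hull_subset)
  have "?P \<in> ?F" using A SP face_of_refl[OF convex_convex_hull] by auto
  then have G: "\<Inter>?F face_of ?P" by (intro face_of_Inter) auto
  have AG: "A \<subseteq> \<Inter>?F" by auto
  have "inner_normal_cone ?P (\<Inter>?F) = inner_normal_cone S A"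
  proof (intro equalityI subsetI)
    show "u \<in> inner_normal_cone S A" if "u \<in> inner_normal_cone ?P (\<Inter>?F)" for u
      using that inner_normal_cone_antimono[OF AG SP] by blast
    fix u assume "u \<in> inner_normal_cone S A"
    then have u: "u \<bullet> x \<le> u \<bullet> y" if "x \<in> A" "y \<in> ?P" for x y
      using that inner_normal_cone_hull_left[of S A] unfolding inner_normal_cone_def by blast
    obtain a where a: "a \<in> A" using A by blast
    have "?P \<inter> {x. u \<bullet> x = u \<bullet> a} face_of ?P"
      by (rule face_of_Int_supporting_hyperplane_ge) (use u a in auto)
    moreover have "A \<subseteq> ?P \<inter> {x. u \<bullet> x = u \<bullet> a}"
      using u a A SP by (auto intro!: antisym)
    ultimately have "\<Inter>?F \<subseteq> {x. u \<bullet> x = u \<bullet> a}" by blast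
    then show "u \<in> inner_normal_cone ?P (\<Inter>?F)"
      using u[OF a] unfolding inner_normal_cone_def by fastforce
  qed
  then show "\<sigma> \<in> inner_normal_fan (convex hull S)"
    unfolding inner_normal_fan_def using G AG A by blast
qed

text \<open>A form lies in the normal cone iff it is nonnegative on the finitely many differences
  \<open>y - x\<close>, so this is Farkas' lemma for these differences. It reduces statements about
  dual cones to checks on generators.\<close>

lemma dual_normal_cone_hull:
  fixes S :: "'a::euclidean_space set"
  assumes "finite S" "A \<subseteq> S"
  shows "dual_cone (inner_normal_cone S A) \<subseteq> convex_cone hull {y - x | x y. x \<in> A \<and> y \<in> S}"
proof
  fix d assume d: "d \<in> dual_cone (inner_normal_cone S A)"
  have "{y - x | x y. x \<in> A \<and> y \<in> S} = (\<lambda>(x, y). y - x) ` (A \<times> S)" by auto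
  moreover have "finite (A \<times> S)" using assms finite_subset by blast
  ultimately have "finite {y - x | x y. x \<in> A \<and> y \<in> S}" by simp
  then show "d \<in> convex_cone hull {y - x | x y. x \<in> A \<and> y \<in> S}"
  proof (rule farkas)
    fix u assume "\<forall>s\<in>{y - x | x y. x \<in> A \<and> y \<in> S}. 0 \<le> u \<bullet> s"
    then have "0 \<le> u \<bullet> (y - x)" if "x \<in> A" "y \<in> S" for x y using that by blast
    then have "u \<in> inner_normal_cone S A" unfolding inner_normal_cone_def by (auto simp: inner_diff_right)
    then show "0 \<le> u \<bullet> d" using d unfolding dual_cone_def by blast
  qed
qed

lemma dual_cone_add: "d \<in> dual_cone \<sigma> \<Longrightarrow> e \<in> dual_cone \<sigma> \<Longrightarrow> d + e \<in> dual_cone \<sigma>"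
  and dual_cone_scale: "0 \<le> r \<Longrightarrow> d \<in> dual_cone \<sigma> \<Longrightarrow> r *\<^sub>R d \<in> dual_cone \<sigma>"
  and dual_cone_zero: "0 \<in> dual_cone \<sigma>"
  by (auto simp: dual_cone_def inner_add_right)

lemma dual_cone_sum: "(\<And>i. i \<in> I \<Longrightarrow> f i \<in> dual_cone \<sigma>) \<Longrightarrow> sum f I \<in> dual_cone \<sigma>"
  by (induction I rule: infinite_finite_induct) (auto intro: dual_cone_zero dual_cone_add)

lemma diff_in_dual_normal_cone: "x \<in> A \<Longrightarrow> y \<in> S \<Longrightarrow> y - x \<in> dual_cone (inner_normal_cone S A)"
  by (auto simp: dual_cone_def inner_normal_cone_def inner_diff_right)

text \<open>Adding the vectors of \<open>B\<close> to \<open>A\<close> inverts the element \<open>\<Sum>b\<in>B. b - \<alpha> b\<close> of the dual cone, whatever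
  points \<open>\<alpha> b\<close> of \<open>A\<close> are chosen. This is used both for the separation property and for a localisation
  inside a fiber of \<open>\<pi>\<close>, where \<open>\<alpha> b\<close> has to lie over the same point as \<open>b\<close>.\<close>

lemma dual_normal_cone_localize:
  fixes S :: "'a::euclidean_space set"
  assumes "finite S" "A \<subseteq> S" "B \<subseteq> S" and \<alpha>: "\<And>b. b \<in> B \<Longrightarrow> \<alpha> b \<in> A"
    and d: "d \<in> dual_cone (inner_normal_cone S (A \<union> B))"
  shows "\<exists>n::nat. d + real n *\<^sub>R (\<Sum>b\<in>B. b - \<alpha> b) \<in> dual_cone (inner_normal_cone S A)"
proof -
  let ?D = "dual_cone (inner_normal_cone S A)"
  define m where "m = (\<Sum>b\<in>B. b - \<alpha> b)"
  have m: "m \<in> ?D"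
    unfolding m_def by (rule dual_cone_sum) (use \<alpha> assms(3) in \<open>auto intro: diff_in_dual_normal_cone\<close>)
  have finB: "finite B" using assms finite_subset by blast
  \<comment> \<open>\<open>T\<close> is a convex cone, so the claim need only be checked on the
    differences that generate the dual of the normal cone of \<open>A \<union> B\<close>.\<close>
  define T where "T = {d. \<exists>r\<ge>0. d + r *\<^sub>R m \<in> ?D}"
  have "convex_cone T"
    unfolding convex_cone_iff
  proof (intro conjI ballI allI impI)
    show "0 \<in> T" unfolding T_def using dual_cone_zero by (auto intro!: exI[of _ 0])
    fix x assume "x \<in> T"
    then obtain r where r: "r \<ge> 0" "x + r *\<^sub>R m \<in> ?D" unfolding T_def by blast
    show "x + y \<in> T" if "y \<in> T" for y
    proof -
      obtain r' where r': "r' \<ge> 0" "y + r' *\<^sub>R m \<in> ?D" using \<open>y \<in> T\<close> unfolding T_def by blast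
      have "x + y + (r + r') *\<^sub>R m \<in> ?D" using dual_cone_add[OF r(2) r'(2)] by (simp add: algebra_simps)
      then show ?thesis unfolding T_def using r r' by (auto intro!: exI[of _ "r + r'"])
    qed
    show "c *\<^sub>R x \<in> T" if "c \<ge> 0" for c
    proof -
      have "c *\<^sub>R x + (c * r) *\<^sub>R m \<in> ?D" using dual_cone_scale[OF that r(2)] by (simp add: algebra_simps)
      then show ?thesis unfolding T_def using r that by (auto intro!: exI[of _ "c * r"])
    qed
  qed
  moreover have "y - x \<in> T" if "x \<in> A \<union> B" "y \<in> S" for x y
  proof (cases "x \<in> A")
    case True
    then show ?thesis unfolding T_def using diff_in_dual_normal_cone[of x A y S] that
      by (auto intro!: exI[of _ 0])
  next
    case False
    then have x: "x \<in> B" using that by blast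
    \<comment> \<open>The summand \<open>x - \<alpha> x\<close> of \<open>m\<close> cancels
      \<open>- x\<close> and leaves \<open>y - \<alpha> x\<close>, whose base point is in
      \<open>A\<close>.\<close>
    have "y - x + 1 *\<^sub>R m = (y - \<alpha> x) + (\<Sum>b\<in>B - {x}. b - \<alpha> b)"
      unfolding m_def using finB x by (simp add: sum.remove)
    also have "\<dots> \<in> ?D"
      by (intro dual_cone_add dual_cone_sum diff_in_dual_normal_cone) (use \<alpha> x that assms(3) in auto)
    finally show ?thesis unfolding T_def by (auto intro!: exI[of _ 1])
  qed
  ultimately have "convex_cone hull {y - x | x y. x \<in> A \<union> B \<and> y \<in> S} \<subseteq> T"
    by (intro hull_minimal) auto
  then have "d \<in> T" using dual_normal_cone_hull[of S "A \<union> B"] assms d by blast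
  then obtain r where r: "r \<ge> 0" "d + r *\<^sub>R m \<in> ?D" unfolding T_def by blast
  obtain n :: nat where n: "r \<le> real n" using real_arch_simple by blast
  \<comment> \<open>Rounding \<open>r\<close> up to an integer is harmless: the surplus is a
    nonnegative multiple of \<open>m\<close>, which lies in the dual cone.\<close>
  have "(d + r *\<^sub>R m) + (real n - r) *\<^sub>R m \<in> ?D"
    by (rule dual_cone_add[OF r(2) dual_cone_scale[OF _ m]]) (use n in auto)
  then show ?thesis unfolding m_def[symmetric] by (intro exI[of _ n]) (simp add: algebra_simps)
qed

context additive_subgroup
begin

lemma separated_normal_fan:
  assumes S: "finite S" "S \<subseteq> M"
  shows "separated_fan M (inner_normal_fan (convex hull S))"
proof
  fix \<sigma> \<tau> assume "\<sigma> \<in> inner_normal_fan (convex hull S)" "\<tau> \<in> inner_normal_fan (convex hull S)"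
  then obtain A B where A: "A \<noteq> {}" "A \<subseteq> S" "\<sigma> = inner_normal_cone S A"
    and B: "B \<noteq> {}" "B \<subseteq> S" "\<tau> = inner_normal_cone S B"
    unfolding inner_normal_fan_hull[OF S(1)] by blast
  show "\<sigma> \<inter> \<tau> \<in> inner_normal_fan (convex hull S)"
    unfolding inner_normal_fan_hull[OF S(1)] A(3) B(3) inner_normal_cone_Un[symmetric] using A B by blast
  obtain a where a: "a \<in> A" using A by blast
  \<comment> \<open>With one fixed base point \<open>a\<close>, each summand is nonnegative on
    \<sigma> since \<open>a\<close> is in \<open>A\<close>, and nonpositive on \<tau> since
    \<open>b\<close> is in \<open>B\<close>. The localisation lemma applies with constant
    \<alpha>.\<close>
  define m where "m = (\<Sum>b\<in>B. b - a)"
  have mM: "m \<in> M" unfolding m_def by (intro sum_closed diff_closed) (use A B a S in auto)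
  have "m \<in> dual_cone \<sigma>"
    unfolding m_def A(3) by (rule dual_cone_sum) (use a B in \<open>auto intro: diff_in_dual_normal_cone\<close>)
  moreover have "- m \<in> dual_cone \<tau>"
  proof -
    have "- m = (\<Sum>b\<in>B. a - b)" by (simp add: m_def sum_negf[symmetric])
    then show ?thesis
      unfolding B(3) by (auto intro!: dual_cone_sum diff_in_dual_normal_cone) (use a A in auto)
  qed
  moreover have "\<exists>n::nat. d + real n *\<^sub>R m \<in> cone_monoid M \<sigma>" if "d \<in> cone_monoid M (\<sigma> \<inter> \<tau>)" for d
  proof -
    have "d \<in> dual_cone (inner_normal_cone S (A \<union> B))" "d \<in> M"
      using that by (auto simp: cone_monoid_def A(3) B(3) inner_normal_cone_Un)
    then show ?thesis
      using dual_normal_cone_localize[OF S(1) A(2) B(2), of "\<lambda>_. a" d] a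
        add_closed nat_scale_closed[OF mM] unfolding m_def cone_monoid_def A(3) by auto
  qed
  ultimately show "\<exists>m\<in>cone_monoid M \<sigma>. - m \<in> cone_monoid M \<tau> \<and>
      (\<forall>d\<in>cone_monoid M (\<sigma> \<inter> \<tau>). \<exists>n::nat. d + real n *\<^sub>R m \<in> cone_monoid M \<sigma>)"
    using mM minus_closed by (intro bexI[of _ m]) (auto simp: cone_monoid_def)
qed

end

section \<open>Lattices, sections and full-dimensional polytopes in fibers\<close>

lemma additive_subgroup_lattice:
  assumes "is_lattice M"
  shows "additive_subgroup M"
proof -
  obtain B where B: "M = {\<Sum>b\<in>B. real_of_int (c b) *\<^sub>R b | c. True}"
    using assms unfolding is_lattice_def by blast
  have I: "(\<Sum>b\<in>B. real_of_int (c b) *\<^sub>R b) \<in> M" for c unfolding B by blast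
  have E: "\<exists>c. x = (\<Sum>b\<in>B. real_of_int (c b) *\<^sub>R b)" if "x \<in> M" for x using that unfolding B by blast
  show ?thesis
  proof
    show "0 \<in> M" using I[of "\<lambda>_. 0"] by simp
    fix x assume "x \<in> M"
    then obtain c where c: "x = (\<Sum>b\<in>B. real_of_int (c b) *\<^sub>R b)" using E by blast
    show "- x \<in> M" using I[of "\<lambda>b. - c b"] by (simp add: c sum_negf)
    fix y assume "y \<in> M"
    then obtain e where e: "y = (\<Sum>b\<in>B. real_of_int (e b) *\<^sub>R b)" using E by blast
    show "x + y \<in> M" using I[of "\<lambda>b. c b + e b"] by (simp add: c e scaleR_left_distrib sum.distrib)
  qed
qed

text \<open>A surjection onto a lattice splits, because lattices are free.\<close>

lemma lattice_section:
  fixes p :: "'a::euclidean_space \<Rightarrow> 'b::euclidean_space"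
  assumes \<Lambda>: "is_lattice \<Lambda>" and M: "additive_subgroup M" and p: "linear p" "p ` M = \<Lambda>"
  obtains s where "linear s" "s ` \<Lambda> \<subseteq> M" "\<And>l. l \<in> \<Lambda> \<Longrightarrow> p (s l) = l"
proof -
  interpret additive_subgroup M by fact
  obtain B where B: "independent B" "\<Lambda> = {\<Sum>b\<in>B. real_of_int (c b) *\<^sub>R b | c. True}"
    using \<Lambda> unfolding is_lattice_def by blast
  have finB: "finite B" using B(1) independent_imp_finite by blast
  have "b \<in> \<Lambda>" if "b \<in> B" for b
  proof -
    have "(\<Sum>x\<in>B. real_of_int (if x = b then 1 else 0) *\<^sub>R x) = (\<Sum>x\<in>B. if x = b then b else 0)"
      by (rule sum.cong) auto
    then have "b = (\<Sum>x\<in>B. real_of_int (if x = b then 1 else 0) *\<^sub>R x)" using finB that by simp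
    then show ?thesis unfolding B(2) by (intro CollectI exI[of _ "\<lambda>x. if x = b then 1 else 0"]) simp
  qed
  then have "\<forall>b\<in>B. \<exists>m\<in>M. p m = b" using p(2) by blast
  then obtain t where t: "\<forall>b\<in>B. t b \<in> M \<and> p (t b) = b" by metis
  obtain s where s: "linear s" "\<forall>b\<in>B. s b = t b" using linear_independent_extend[OF B(1)] by blast
  have int_scale: "real_of_int z *\<^sub>R x \<in> M" if "x \<in> M" for z x
    using nat_scale_closed[OF that, of "nat z"] minus_closed[OF nat_scale_closed[OF that, of "nat (- z)"]]
    by (cases "z \<ge> 0") auto
  have *: "s (\<Sum>b\<in>B. real_of_int (c b) *\<^sub>R b) = (\<Sum>b\<in>B. real_of_int (c b) *\<^sub>R t b)" for c
    using s by (simp add: linear_sum linear_scale)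
  show ?thesis
  proof (rule that[OF s(1)])
    show "s ` \<Lambda> \<subseteq> M" unfolding B(2) using * t by (auto intro!: sum_closed int_scale)
    show "p (s l) = l" if "l \<in> \<Lambda>" for l
      using that t unfolding B(2) by (auto simp: * linear_sum[OF p(1)] linear_scale[OF p(1)] intro!: sum.cong)
  qed
qed

text \<open>The least normal cone consists of the forms constant on \<open>S\<close>, and its dual
  is spanned by the differences of points of \<open>S\<close>. These differences are in the kernel
  because \<open>S\<close> sits in one fiber of \<open>p\<close>; by the dimension hypothesis they
  span the kernel of \<open>p\<close> on \<open>span M\<close>.\<close>

lemma cone_monoid_fiber_polytope:
  fixes p :: "'a::euclidean_space \<Rightarrow> 'b::euclidean_space"
  assumes "linear p" "finite S" "S \<subseteq> M" "a \<in> S" and v: "\<And>x. x \<in> S \<Longrightarrow> p x = v"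
    and dim: "aff_dim S = int (dim {x \<in> span M. p x = 0})"
  shows "cone_monoid M (inner_normal_cone S S) = {m\<in>M. p m = 0}"
proof (intro equalityI subsetI)
  fix m assume "m \<in> cone_monoid M (inner_normal_cone S S)"
  then have m: "m \<in> M" "m \<in> dual_cone (inner_normal_cone S S)" by (auto simp: cone_monoid_def)
  have "convex_cone {x. p x = 0}"
    using assms(1) by (auto simp: convex_cone_iff linear_add linear_scale linear_0)
  then have "convex_cone hull {y - x | x y. x \<in> S \<and> y \<in> S} \<subseteq> {x. p x = 0}"
    by (intro hull_minimal) (auto simp: linear_diff[OF assms(1)] v)
  then show "m \<in> {m\<in>M. p m = 0}" using m dual_normal_cone_hull[OF assms(2) order_refl] by blast
next
  fix m assume m: "m \<in> {m\<in>M. p m = 0}"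
  let ?K = "{x \<in> span M. p x = 0}"
  let ?T = "(\<lambda>x. x - a) ` S"
  have K: "subspace ?K"
    using assms(1) by (auto simp: subspace_def linear_add linear_scale linear_0 span_zero span_add span_scale)
  have TK: "?T \<subseteq> ?K"
    using assms(3,4) by (auto simp: linear_diff[OF assms(1)] v intro: span_diff span_base)
  \<comment> \<open>After the translation 0 is one of the points, so affine and linear dimension
    agree.\<close>
  have "aff_dim S = aff_dim ?T" by (simp only: aff_dim_translation_eq_subtract)
  also have "\<dots> = int (dim ?T)" by (rule aff_dim_zero) (use assms(4) in \<open>auto intro!: hull_inc\<close>)
  finally have "dim ?K \<le> dim (span ?T)" using dim by (simp add: dim_span)
  then have "span ?T = ?K"
    by (intro subspace_dim_equal subspace_span K) (use span_minimal[OF TK K] in auto)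
  then have mT: "m \<in> span ?T" using m by (auto intro: span_base)
  have "0 \<le> u \<bullet> m" if u: "u \<in> inner_normal_cone S S" for u
  proof -
    have "?T \<subseteq> {x. u \<bullet> x = 0}"
      using u assms(4) unfolding inner_normal_cone_def by (auto simp: inner_diff_right intro!: antisym)
    then have "span ?T \<subseteq> {x. u \<bullet> x = 0}"
      by (rule span_minimal) (rule subspace_hyperplane)
    then show ?thesis using mT by auto
  qed
  then show "m \<in> cone_monoid M (inner_normal_cone S S)" using m by (auto simp: cone_monoid_def dual_cone_def)
qed

section \<open>Toric maps and polytope fibrations\<close>

context separated_fan
begin

text \<open>A point of a source lies in many charts, and each may prescribe a representative of its
  image. Pairwise glued prescriptions are realised by one point, so that a map can be obtained by
  choice. An empty family imposes no condition.\<close>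

lemma toric_point_exists:
  fixes P :: "('a set \<times> ('a \<Rightarrow> 'k::field)) set"
  assumes "\<And>a b. a \<in> P \<Longrightarrow> b \<in> P \<Longrightarrow> (a, b) \<in> toric_glue M \<Sigma>"
  shows "\<exists>x. \<forall>(\<sigma>, \<gamma>)\<in>P. x \<in> toric_chart M \<Sigma> \<sigma> \<and> toric_coord \<sigma> x = \<gamma>"
proof (cases "P = {}")
  case False
  then obtain \<tau> \<eta> where \<tau>: "(\<tau>, \<eta>) \<in> P" by fast
  have "toric_pt M \<Sigma> \<tau> \<eta> \<in> toric_chart M \<Sigma> \<sigma> \<and> toric_coord \<sigma> (toric_pt M \<Sigma> \<tau> \<eta>) = \<gamma>"
    if "(\<sigma>, \<gamma>) \<in> P" for \<sigma> \<gamma>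
  proof -
    have "((\<tau>, \<eta>), (\<sigma>, \<gamma>)) \<in> toric_glue M \<Sigma>" using assms \<tau> that by blast
    moreover then have *: "\<tau> \<in> \<Sigma>" "\<eta> \<in> affine_toric M \<tau>" "\<sigma> \<in> \<Sigma>" "\<gamma> \<in> affine_toric M \<sigma>"
      by (auto simp: toric_glue_def)
    ultimately have "toric_pt M \<Sigma> \<tau> \<eta> = toric_pt M \<Sigma> \<sigma> \<gamma>" using toric_pt_eq_iff[OF *] by blast
    then show ?thesis using toric_chart_pt[OF *(3,4)] toric_coord_pt[OF *(3,4)] by simp
  qed
  then show ?thesis by blast
qed auto

lemma toric_glueI:
  assumes "\<sigma> \<in> \<Sigma>" "\<tau> \<in> \<Sigma>" "\<delta> 0 = 1"
    and "\<And>d e. d \<in> cone_monoid M (\<sigma> \<inter> \<tau>) \<Longrightarrow> e \<in> cone_monoid M (\<sigma> \<inter> \<tau>) \<Longrightarrow> \<delta> (d + e) = \<delta> d * \<delta> e"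
    and "\<And>d. d \<in> cone_monoid M \<sigma> \<Longrightarrow> \<gamma> d = \<delta> d"
    and "\<And>d. d \<in> cone_monoid M \<tau> \<Longrightarrow> \<eta> d = \<delta> d"
  shows "((\<sigma>, restrict \<gamma> (cone_monoid M \<sigma>)), (\<tau>, restrict \<eta> (cone_monoid M \<tau>))) \<in> toric_glue M \<Sigma>"
proof -
  let ?\<delta> = "restrict \<delta> (cone_monoid M (\<sigma> \<inter> \<tau>))"
  have \<delta>: "?\<delta> \<in> affine_toric M (\<sigma> \<inter> \<tau>)" by (rule affine_toricI) (use assms in auto)
  have "restrict ?\<delta> (cone_monoid M \<sigma>) = restrict \<gamma> (cone_monoid M \<sigma>)"
    using assms(5) cone_monoid_antimono[of "\<sigma> \<inter> \<tau>" \<sigma> M] by (intro restrict_ext) auto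
  moreover have "restrict ?\<delta> (cone_monoid M \<tau>) = restrict \<eta> (cone_monoid M \<tau>)"
    using assms(6) cone_monoid_antimono[of "\<sigma> \<inter> \<tau>" \<tau> M] by (intro restrict_ext) auto
  ultimately show ?thesis
    using affine_toric_restrict[OF \<delta>, of \<sigma>] affine_toric_restrict[OF \<delta>, of \<tau>] \<delta> assms(1,2)
    unfolding toric_glue_def by (auto intro!: bexI[of _ ?\<delta>])
qed

lemma
  assumes "\<sigma> \<in> \<Sigma>" "x \<in> toric_chart M \<Sigma> \<sigma>" "y \<in> toric_chart M \<Sigma> \<sigma>"
  defines "z \<equiv> toric_pt M \<Sigma> \<sigma> (\<lambda>m\<in>cone_monoid M \<sigma>. toric_coord \<sigma> x m * toric_coord \<sigma> y m)"
  shows toric_chart_prod: "z \<in> toric_chart M \<Sigma> \<sigma>"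
    and toric_coord_prod: "m \<in> cone_monoid M \<sigma> \<Longrightarrow> toric_coord \<sigma> z m = toric_coord \<sigma> x m * toric_coord \<sigma> y m"
proof -
  have aff: "(\<lambda>m\<in>cone_monoid M \<sigma>. toric_coord \<sigma> x m * toric_coord \<sigma> y m) \<in> affine_toric M \<sigma>"
    by (rule affine_toricI) (use assms(1-3) in \<open>auto simp: toric_coord_zero toric_coord_add\<close>)
  show "z \<in> toric_chart M \<Sigma> \<sigma>" unfolding z_def by (rule toric_chart_pt[OF assms(1) aff])
  show "toric_coord \<sigma> z m = toric_coord \<sigma> x m * toric_coord \<sigma> y m" if "m \<in> cone_monoid M \<sigma>"
    unfolding z_def toric_coord_pt[OF assms(1) aff] using that by simp
qed

end

text \<open>\<open>s\<close> goes backwards, from characters of the target to characters of the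
  source; \<open>cone_map\<close> says that the monomials regular on a chart of the target pull back
  to monomials regular on the given chart of the source. The subfamily \<open>\<Sigma>0\<close>
  allows maps defined only on an open part, such as the projection of the trivialisation to
  \<open>X_F\<close>.\<close>

locale toric_map = X: separated_fan M \<Sigma> + Y: separated_fan M' \<Sigma>'
  for M :: "'a::euclidean_space set" and \<Sigma> and M' :: "'b::euclidean_space set" and \<Sigma>' +
  fixes \<Sigma>0 and s :: "'b \<Rightarrow> 'a"
  assumes subfan: "\<Sigma>0 \<subseteq> \<Sigma>" and linear_s: "linear s"
    and cone_map: "\<sigma> \<in> \<Sigma>0 \<Longrightarrow> \<exists>\<tau>\<in>\<Sigma>'. s ` cone_monoid M' \<tau> \<subseteq> cone_monoid M \<sigma>"
begin

text \<open>Quantifying over all compatible pairs of charts includes the agreement of the local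
  formulas. Values outside the charts of \<open>\<Sigma>0\<close> stay free.\<close>

definition induced :: "(('a, 'k::field) toric_point \<Rightarrow> ('b, 'k) toric_point) \<Rightarrow> bool" where
  "induced g \<longleftrightarrow> (\<forall>\<sigma>\<in>\<Sigma>0. \<forall>\<tau>\<in>\<Sigma>'. s ` cone_monoid M' \<tau> \<subseteq> cone_monoid M \<sigma> \<longrightarrow>
     (\<forall>x\<in>toric_chart M \<Sigma> \<sigma>. g x \<in> toric_chart M' \<Sigma>' \<tau> \<and>
        (\<forall>d\<in>cone_monoid M' \<tau>. toric_coord \<tau> (g x) d = toric_coord \<sigma> x (s d))))"

lemma
  assumes "induced g" "\<sigma> \<in> \<Sigma>0" "\<tau> \<in> \<Sigma>'" "s ` cone_monoid M' \<tau> \<subseteq> cone_monoid M \<sigma>"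
    "x \<in> toric_chart M \<Sigma> \<sigma>"
  shows induced_chart: "g x \<in> toric_chart M' \<Sigma>' \<tau>"
    and induced_coord: "d \<in> cone_monoid M' \<tau> \<Longrightarrow> toric_coord \<tau> (g x) d = toric_coord \<sigma> x (s d)"
  using assms unfolding induced_def by auto

lemma induced_exists: "\<exists>g :: ('a, 'k::field) toric_point \<Rightarrow> ('b, 'k) toric_point. induced g"
proof -
  define P where "P x = {(\<tau>, restrict (\<lambda>d. toric_coord \<sigma> x (s d)) (cone_monoid M' \<tau>)) | \<sigma> \<tau>.
     \<sigma> \<in> \<Sigma>0 \<and> \<tau> \<in> \<Sigma>' \<and> s ` cone_monoid M' \<tau> \<subseteq> cone_monoid M \<sigma> \<and> x \<in> toric_chart M \<Sigma> \<sigma>}"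
    for x :: "('a, 'k) toric_point"
  have "\<exists>y. \<forall>(\<tau>, \<eta>)\<in>P x. y \<in> toric_chart M' \<Sigma>' \<tau> \<and> toric_coord \<tau> y = \<eta>" for x
  proof (rule Y.toric_point_exists)
    fix a b assume "a \<in> P x" "b \<in> P x"
    then obtain \<sigma>1 \<tau>1 \<sigma>2 \<tau>2 where
      1: "a = (\<tau>1, restrict (\<lambda>d. toric_coord \<sigma>1 x (s d)) (cone_monoid M' \<tau>1))" "\<sigma>1 \<in> \<Sigma>0" "\<tau>1 \<in> \<Sigma>'"
         "s ` cone_monoid M' \<tau>1 \<subseteq> cone_monoid M \<sigma>1" "x \<in> toric_chart M \<Sigma> \<sigma>1" and
      2: "b = (\<tau>2, restrict (\<lambda>d. toric_coord \<sigma>2 x (s d)) (cone_monoid M' \<tau>2))" "\<sigma>2 \<in> \<Sigma>0" "\<tau>2 \<in> \<Sigma>'"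
         "s ` cone_monoid M' \<tau>2 \<subseteq> cone_monoid M \<sigma>2" "x \<in> toric_chart M \<Sigma> \<sigma>2"
      unfolding P_def by auto
    have fan: "\<sigma>1 \<in> \<Sigma>" "\<sigma>2 \<in> \<Sigma>" using 1 2 subfan by auto
    note \<rho> = X.fan_Int[OF fan] and x = X.toric_chart_Int[OF fan 1(5) 2(5)]
    have sub: "cone_monoid M \<sigma>1 \<subseteq> cone_monoid M (\<sigma>1 \<inter> \<sigma>2)" "cone_monoid M \<sigma>2 \<subseteq> cone_monoid M (\<sigma>1 \<inter> \<sigma>2)"
      by (auto intro!: cone_monoid_antimono)
    \<comment> \<open>Again \<open>d\<close> is \<open>d + n m\<close> plus \<open>n (- m)\<close>.
      The summands lie in the monoids of \<tau>1 and \<tau>2, and \<open>s\<close> carries these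
      into the monoids of \<sigma>1 and \<sigma>2, both contained in that of
      \<open>\<sigma>1 \<inter> \<sigma>2\<close>.\<close>
    have im: "s d \<in> cone_monoid M (\<sigma>1 \<inter> \<sigma>2)" if d: "d \<in> cone_monoid M' (\<tau>1 \<inter> \<tau>2)" for d
    proof -
      obtain m where m: "- m \<in> cone_monoid M' \<tau>2"
        "\<forall>d\<in>cone_monoid M' (\<tau>1 \<inter> \<tau>2). \<exists>n::nat. d + real n *\<^sub>R m \<in> cone_monoid M' \<tau>1"
        using Y.separation[OF 1(3) 2(3)] by blast
      obtain n :: nat where n: "d + real n *\<^sub>R m \<in> cone_monoid M' \<tau>1" using m d by blast
      have "s (d + real n *\<^sub>R m) \<in> cone_monoid M (\<sigma>1 \<inter> \<sigma>2)" using n 1(4) sub by blast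
      moreover have "s (real n *\<^sub>R (- m)) \<in> cone_monoid M (\<sigma>1 \<inter> \<sigma>2)"
        using Y.cone_monoid_scale[OF m(1), of n] 2(4) sub by blast
      ultimately have "s (d + real n *\<^sub>R m) + s (real n *\<^sub>R (- m)) \<in> cone_monoid M (\<sigma>1 \<inter> \<sigma>2)"
        by (rule X.cone_monoid_add)
      then show ?thesis unfolding linear_add[OF linear_s, symmetric] by simp
    qed
    show "(a, b) \<in> toric_glue M' \<Sigma>'"
      unfolding 1(1) 2(1)
    proof (rule Y.toric_glueI[OF 1(3) 2(3), of "\<lambda>d. toric_coord (\<sigma>1 \<inter> \<sigma>2) x (s d)"])
      show "toric_coord (\<sigma>1 \<inter> \<sigma>2) x (s 0) = 1"
        using X.toric_coord_zero[OF \<rho> x] linear_0[OF linear_s] by simp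
      show "toric_coord (\<sigma>1 \<inter> \<sigma>2) x (s (d + e)) =
          toric_coord (\<sigma>1 \<inter> \<sigma>2) x (s d) * toric_coord (\<sigma>1 \<inter> \<sigma>2) x (s e)"
        if "d \<in> cone_monoid M' (\<tau>1 \<inter> \<tau>2)" "e \<in> cone_monoid M' (\<tau>1 \<inter> \<tau>2)" for d e
        using X.toric_coord_add[OF \<rho> x im[OF that(1)] im[OF that(2)]] linear_add[OF linear_s] by simp
      show "toric_coord \<sigma>1 x (s d) = toric_coord (\<sigma>1 \<inter> \<sigma>2) x (s d)" if "d \<in> cone_monoid M' \<tau>1" for d
        by (rule X.toric_coord_mono[OF \<rho> fan(1) Int_lower1 x]) (use that 1(4) in blast)
      show "toric_coord \<sigma>2 x (s d) = toric_coord (\<sigma>1 \<inter> \<sigma>2) x (s d)" if "d \<in> cone_monoid M' \<tau>2" for d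
        by (rule X.toric_coord_mono[OF \<rho> fan(2) Int_lower2 x]) (use that 2(4) in blast)
    qed
  qed
  then have "\<forall>x. \<exists>y. \<forall>(\<tau>, \<eta>)\<in>P x. y \<in> toric_chart M' \<Sigma>' \<tau> \<and> toric_coord \<tau> y = \<eta>" ..
  from choice[OF this] obtain g where
    g: "\<forall>x. \<forall>(\<tau>, \<eta>)\<in>P x. g x \<in> toric_chart M' \<Sigma>' \<tau> \<and> toric_coord \<tau> (g x) = \<eta>"
    by (rule exE)
  have "induced g"
    unfolding induced_def
  proof (intro ballI impI)
    fix \<sigma> \<tau> and x :: "('a, 'k) toric_point"
    assume "\<sigma> \<in> \<Sigma>0" "\<tau> \<in> \<Sigma>'" "s ` cone_monoid M' \<tau> \<subseteq> cone_monoid M \<sigma>" "x \<in> toric_chart M \<Sigma> \<sigma>"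
    then have "(\<tau>, restrict (\<lambda>d. toric_coord \<sigma> x (s d)) (cone_monoid M' \<tau>)) \<in> P x" unfolding P_def by blast
    with g have "g x \<in> toric_chart M' \<Sigma>' \<tau>"
      "toric_coord \<tau> (g x) = restrict (\<lambda>d. toric_coord \<sigma> x (s d)) (cone_monoid M' \<tau>)" by fast+
    then show "g x \<in> toric_chart M' \<Sigma>' \<tau> \<and> (\<forall>d\<in>cone_monoid M' \<tau>. toric_coord \<tau> (g x) d = toric_coord \<sigma> x (s d))"
      by simp
  qed
  then show ?thesis by blast
qed

text \<open>By \<open>induced_coord\<close>, coordinates pull back to coordinates. The open set
  \<open>U\<close> will be all of \<open>X_R\<close> for the toric morphism, and the preimage of the
  torus of \<open>Y\<close> when the trivialisation is inverted.\<close>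

lemma variety_morphism_induced:
  fixes g :: "('a, 'k::field) toric_point \<Rightarrow> ('b, 'k) toric_point"
  assumes g: "induced g"
    and U: "openin (zariski (fan_toric_variety M \<Sigma> :: (('a, 'k) toric_point, 'k) toric_variety)) U"
      "U \<subseteq> (\<Union>\<sigma>\<in>\<Sigma>0. toric_chart M \<Sigma> \<sigma>)"
  shows "variety_morphism (open_subvariety (fan_toric_variety M \<Sigma>) U) (fan_toric_variety M' \<Sigma>') g"
proof (rule Y.variety_morphism_into_fan)
  interpret FX: function_space "fan_toric_variety M \<Sigma> :: (('a, 'k) toric_point, 'k) toric_variety"
    by (rule X.function_space_fan)
  show "function_space (open_subvariety (fan_toric_variety M \<Sigma> :: (('a, 'k) toric_point, 'k) toric_variety) U)"
    by (rule FX.function_space_open_subvariety[OF U(1)])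
  fix x assume "x \<in> points (open_subvariety (fan_toric_variety M \<Sigma> :: (('a, 'k) toric_point, 'k) toric_variety) U)"
  then have xU: "x \<in> U" by (simp add: points_open_subvariety)
  then obtain \<sigma> where \<sigma>: "\<sigma> \<in> \<Sigma>0" "x \<in> toric_chart M \<Sigma> \<sigma>" using U by blast
  obtain \<tau> where \<tau>: "\<tau> \<in> \<Sigma>'" "s ` cone_monoid M' \<tau> \<subseteq> cone_monoid M \<sigma>" using cone_map[OF \<sigma>(1)] by blast
  define W :: "('a, 'k) toric_point set" where "W = U \<inter> toric_chart M \<Sigma> \<sigma>"
  have \<sigma>\<Sigma>: "\<sigma> \<in> \<Sigma>" using \<sigma> subfan by blast
  have o: "openin (zariski (fan_toric_variety M \<Sigma> :: (('a, 'k) toric_point, 'k) toric_variety)) W"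
    unfolding W_def using U(1) X.openin_toric_chart[OF \<sigma>\<Sigma>] by blast
  then have "openin (zariski (open_subvariety (fan_toric_variety M \<Sigma> :: (('a, 'k) toric_point, 'k) toric_variety) U)) W"
    unfolding open_subvariety_def using openin_open_subtopology[OF U(1)] by (simp add: W_def)
  moreover have "x \<in> W" using xU \<sigma> W_def by blast
  moreover have "g ` W \<subseteq> toric_chart M' \<Sigma>' \<tau>"
    using induced_chart[OF g \<sigma>(1) \<tau>] W_def by blast
  moreover have "(\<lambda>q. toric_coord \<tau> (g q) d) \<in> regular (open_subvariety (fan_toric_variety M \<Sigma>) U) W"
    if d: "d \<in> cone_monoid M' \<tau>" for d
  proof -
    have "(\<lambda>x. toric_coord \<sigma> x (s d) :: 'k) \<in> regular (fan_toric_variety M \<Sigma>) (toric_chart M \<Sigma> \<sigma>)"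
      by (rule X.regular_toric_coord[OF \<sigma>\<Sigma>]) (use \<tau> d in blast)
    then have "(\<lambda>x. toric_coord \<sigma> x (s d) :: 'k) \<in> regular (fan_toric_variety M \<Sigma>) W"
      by (rule FX.regular_restrict[OF _ X.openin_toric_chart[OF \<sigma>\<Sigma>] o]) (auto simp: W_def)
    then have "(\<lambda>q. toric_coord \<tau> (g q) d) \<in> regular (fan_toric_variety M \<Sigma>) W"
      by (rule FX.regular_cong[OF _ o]) (use induced_coord[OF g \<sigma>(1) \<tau> _ d] W_def in blast)
    then show ?thesis by (simp add: open_subvariety_def)
  qed
  ultimately show "\<exists>\<tau>\<in>\<Sigma>'. \<exists>W. openin (zariski (open_subvariety (fan_toric_variety M \<Sigma> :: (('a, 'k) toric_point, 'k) toric_variety) U)) W \<and> x \<in> W \<and>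
     g ` W \<subseteq> toric_chart M' \<Sigma>' \<tau> \<and>
     (\<forall>d\<in>cone_monoid M' \<tau>. (\<lambda>q. toric_coord \<tau> (g q) d) \<in> regular (open_subvariety (fan_toric_variety M \<Sigma>) U) W)"
    using \<tau>(1) by blast
qed

end

text \<open>\<open>T i\<close> is a finite generating set of \<open>R_i\<close>, \<open>v i\<close>
  the point below it, \<open>s\<close> a splitting of \<open>p\<close>. Full-dimensionality of
  \<open>R_i\<close> in its fiber enters in the form \<open>kernel\<close>. As the normal fans
  agree, every \<open>T i\<close> describes the fan of \<open>Y\<close> equally well, so each
  argument may use the \<open>R_i\<close> that meets the set at hand.\<close>

locale cayley_fibration = M: additive_subgroup M + L: additive_subgroup \<Lambda>
  for M :: "'a::euclidean_space set" and \<Lambda> :: "'b::euclidean_space set" +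
  fixes p :: "'a \<Rightarrow> 'b" and s :: "'b \<Rightarrow> 'a" and I :: "'i set" and T :: "'i \<Rightarrow> 'a set" and v :: "'i \<Rightarrow> 'b" and j :: 'i
  assumes p: "linear p" "p ` M \<subseteq> \<Lambda>"
    and s: "linear s" "s ` \<Lambda> \<subseteq> M" "\<And>l. l \<in> \<Lambda> \<Longrightarrow> p (s l) = l"
    and I: "finite I" "j \<in> I"
    and T: "\<And>i. i \<in> I \<Longrightarrow> finite (T i)" "\<And>i. i \<in> I \<Longrightarrow> T i \<subseteq> M" "\<And>i. i \<in> I \<Longrightarrow> T i \<noteq> {}"
    and pT: "\<And>i x. i \<in> I \<Longrightarrow> x \<in> T i \<Longrightarrow> p x = v i"
    and same_fan: "\<And>i. i \<in> I \<Longrightarrow> inner_normal_fan (convex hull T i) = inner_normal_fan (convex hull T j)"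
    and kernel: "\<And>i. i \<in> I \<Longrightarrow> cone_monoid M (inner_normal_cone (T i) (T i)) = {m\<in>M. p m = 0}"
begin

section \<open>The cones of the fibration and their monoids\<close>

definition verts :: "'a set" where "verts = (\<Union>i\<in>I. T i)"
definition fan_R :: "'a set set" where "fan_R = inner_normal_fan (convex hull verts)"
definition fan_Y :: "'a set set" where "fan_Y = inner_normal_fan (convex hull T j)"
definition fan_F :: "'b set set" where "fan_F = inner_normal_fan (convex hull (p ` verts))"
definition vertex_sets :: "'b set set" where "vertex_sets = {H. H \<noteq> {} \<and> H \<subseteq> p ` verts}"
definition over :: "'b set \<Rightarrow> 'a set" where "over H = {x \<in> verts. p x \<in> H}"
text \<open>\<open>over H\<close> contains every \<open>T i\<close> that it meets, so for
  \<open>H\<close> in \<open>vertex_sets\<close> a form in this cone is constant on some whole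
  \<open>R_i\<close>. This singles out the cones of \<open>fan_R\<close> that are pulled back from a
  cone of \<open>fan_F\<close>, as made precise in \<open>cone_monoid_R\<close>.\<close>

definition cone_R :: "'b set \<Rightarrow> 'a set" where "cone_R H = inner_normal_cone verts (over H)"
definition cone_F :: "'b set \<Rightarrow> 'b set" where "cone_F H = inner_normal_cone (p ` verts) H"
definition cone_Y :: "'a set" where "cone_Y = inner_normal_cone (T j) (T j)"

lemma verts: "finite verts" "verts \<subseteq> M" "verts \<noteq> {}"
  using I T unfolding verts_def by auto

lemma fan_R_eq: "fan_R = {inner_normal_cone verts A | A. A \<noteq> {} \<and> A \<subseteq> verts}"
  unfolding fan_R_def by (rule inner_normal_fan_hull[OF verts(1)])

lemma fan_F_eq: "fan_F = cone_F ` vertex_sets"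
  unfolding fan_F_def cone_F_def vertex_sets_def using inner_normal_fan_hull[of "p ` verts"] verts(1) by auto

lemma fan_Y_eq: "i \<in> I \<Longrightarrow> fan_Y = {inner_normal_cone (T i) A | A. A \<noteq> {} \<and> A \<subseteq> T i}"
  using same_fan[of i] inner_normal_fan_hull[OF T(1), of i] unfolding fan_Y_def by simp

sublocale R: separated_fan M fan_R
  unfolding fan_R_def by (rule M.separated_normal_fan) (use verts in auto)

sublocale Y: separated_fan M fan_Y
  unfolding fan_Y_def by (rule M.separated_normal_fan) (use I T in auto)

sublocale F: separated_fan \<Lambda> fan_F
  unfolding fan_F_def by (rule L.separated_normal_fan) (use verts p in auto)

text \<open>The cone is the intersection of the whole fan, and the fans of the \<open>R_i\<close>
  coincide.\<close>

lemma cone_Y_eq: "i \<in> I \<Longrightarrow> inner_normal_cone (T i) (T i) = cone_Y"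
proof -
  have "inner_normal_cone (T i) (T i) = \<Inter>fan_Y" if i: "i \<in> I" for i
    unfolding fan_Y_eq[OF i] using T(3)[OF i] inner_normal_cone_antimono[of _ "T i" "T i" "T i"] by blast
  then show "i \<in> I \<Longrightarrow> inner_normal_cone (T i) (T i) = cone_Y" using I(2) unfolding cone_Y_def by blast
qed

lemma cone_Y_mem: "cone_Y \<in> fan_Y"
  using I T unfolding cone_Y_def fan_Y_eq[OF I(2)] by blast

lemma cone_Y_least: "\<tau> \<in> fan_Y \<Longrightarrow> cone_Y \<subseteq> \<tau>"
  unfolding cone_Y_def fan_Y_eq[OF I(2)] using inner_normal_cone_antimono[of _ "T j" "T j" "T j"] by blast

lemma Inter_fan_Y: "\<Inter>fan_Y = cone_Y"
  using cone_Y_mem cone_Y_least by blast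

lemma cone_monoid_Y: "cone_monoid M cone_Y = {m\<in>M. p m = 0}"
  unfolding cone_Y_def by (rule kernel[OF I(2)])

lemma Inter_fan_R: "\<Inter>fan_R = inner_normal_cone verts verts"
  and Inter_fan_R_mem: "\<Inter>fan_R \<in> fan_R"
proof -
  show *: "\<Inter>fan_R = inner_normal_cone verts verts"
    unfolding fan_R_eq using verts(3) inner_normal_cone_antimono[of _ verts verts verts] by blast
  show "\<Inter>fan_R \<in> fan_R" unfolding * unfolding fan_R_eq using verts by blast
qed

lemma Inter_fan_R_subset: "\<Inter>fan_R \<subseteq> cone_Y"
  unfolding Inter_fan_R cone_Y_def by (rule inner_normal_cone_antimono) (use I in \<open>auto simp: verts_def\<close>)

lemma cone_R_mem: "H \<in> vertex_sets \<Longrightarrow> cone_R H \<in> fan_R"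
  unfolding cone_R_def fan_R_eq vertex_sets_def over_def by blast

lemma cone_F_mem: "H \<in> vertex_sets \<Longrightarrow> cone_F H \<in> fan_F"
  unfolding fan_F_eq by blast

lemma vertex_sets_Un: "H \<in> vertex_sets \<Longrightarrow> K \<in> vertex_sets \<Longrightarrow> H \<union> K \<in> vertex_sets"
  unfolding vertex_sets_def by blast

lemma cone_R_Un: "cone_R (H \<union> K) = cone_R H \<inter> cone_R K"
proof -
  have "over (H \<union> K) = over H \<union> over K" unfolding over_def by blast
  then show ?thesis unfolding cone_R_def by (simp add: inner_normal_cone_Un)
qed

lemma cone_F_Un: "cone_F (H \<union> K) = cone_F H \<inter> cone_F K"
  unfolding cone_F_def by (rule inner_normal_cone_Un)

lemma kernel_part:
  assumes "m \<in> M"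
  shows "m - s (p m) \<in> cone_monoid M cone_Y"
proof -
  have "p m \<in> \<Lambda>" using assms p by blast
  then show ?thesis
    unfolding cone_monoid_Y using assms s M.diff_closed linear_diff[OF p(1)] by auto
qed

text \<open>Being minimal on \<open>over H\<close>, the form \<open>u\<close> is constant on a whole
  \<open>T i\<close>, so it lies in the least cone of that polytope; \<open>kernel\<close> applied
  to \<open>m\<close> and \<open>- m\<close> gives both inequalities.\<close>

lemma cone_R_kernel:
  assumes H: "H \<in> vertex_sets" and u: "u \<in> cone_R H" and m: "m \<in> M" "p m = 0"
  shows "u \<bullet> m = 0"
proof -
  obtain x where x: "x \<in> verts" "p x \<in> H" using H unfolding vertex_sets_def by blast
  then obtain i where i: "i \<in> I" "x \<in> T i" unfolding verts_def by blast
  have "T i \<subseteq> over H" "T i \<subseteq> verts"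
    using i x pT[OF i(1)] unfolding over_def verts_def by auto
  then have "u \<in> inner_normal_cone (T i) (T i)"
    using u inner_normal_cone_antimono[of "T i" "over H" "T i" verts] unfolding cone_R_def by blast
  moreover have "m \<in> cone_monoid M (inner_normal_cone (T i) (T i))"
    "- m \<in> cone_monoid M (inner_normal_cone (T i) (T i))"
    unfolding kernel[OF i(1)] using m M.minus_closed linear_neg[OF p(1), of m] by auto
  ultimately have "0 \<le> u \<bullet> m" "0 \<le> u \<bullet> (- m)" unfolding cone_monoid_def dual_cone_def by blast+
  then show ?thesis by simp
qed

text \<open>Forms are transported by transposes, which are adjoints here since vectors represent
  forms. The transpose of \<open>p\<close> carries \<open>cone_F H\<close> into
  \<open>cone_R H\<close>. The transpose of \<open>s\<close> carries \<open>cone_R H\<close> back,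
  and pairing its value at \<open>u\<close> with \<open>p x\<close> returns
  \<open>u \<bullet> x\<close>, because \<open>u\<close> vanishes on the kernel element
  \<open>x - s (p x)\<close>.\<close>

lemma cone_monoid_R:
  assumes H: "H \<in> vertex_sets"
  shows "cone_monoid M (cone_R H) = {m\<in>M. p m \<in> cone_monoid \<Lambda> (cone_F H)}"
proof (intro equalityI subsetI)
  fix m assume "m \<in> cone_monoid M (cone_R H)"
  then have m: "m \<in> M" "m \<in> dual_cone (cone_R H)" unfolding cone_monoid_def by auto
  have "0 \<le> w \<bullet> p m" if w: "w \<in> cone_F H" for w
  proof -
    have adj: "adjoint p w \<bullet> x = w \<bullet> p x" for x
      using adjoint_works[OF p(1), of x w] by (simp add: inner_commute)
    have "adjoint p w \<in> cone_R H"
      using w unfolding cone_R_def cone_F_def inner_normal_cone_def over_def by (simp add: adj)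
    then show ?thesis using m unfolding dual_cone_def by (force simp: adj)
  qed
  then show "m \<in> {m\<in>M. p m \<in> cone_monoid \<Lambda> (cone_F H)}"
    using m p unfolding cone_monoid_def dual_cone_def by auto
next
  fix m assume "m \<in> {m\<in>M. p m \<in> cone_monoid \<Lambda> (cone_F H)}"
  then have m: "m \<in> M" "p m \<in> dual_cone (cone_F H)" unfolding cone_monoid_def by auto
  have "0 \<le> u \<bullet> m" if u: "u \<in> cone_R H" for u
  proof -
    have adj: "adjoint s u \<bullet> p x = u \<bullet> x" if x: "x \<in> M" for x
    proof -
      have "x - s (p x) \<in> M" "p (x - s (p x)) = 0" using kernel_part[OF x] unfolding cone_monoid_Y by auto
      then have "u \<bullet> (x - s (p x)) = 0" by (rule cone_R_kernel[OF H u])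
      then show ?thesis
        using adjoint_works[OF s(1), of "p x" u] by (simp add: inner_commute inner_diff_right)
    qed
    have "adjoint s u \<in> cone_F H"
      unfolding cone_F_def inner_normal_cone_def
    proof (intro CollectI ballI)
      fix h z assume h: "h \<in> H" and "z \<in> p ` verts"
      then obtain x y where x: "x \<in> over H" "p x = h" and y: "y \<in> verts" "p y = z"
        using H unfolding vertex_sets_def over_def by blast
      have "x \<in> M" "y \<in> M" using x(1) y(1) verts(2) unfolding over_def by blast+
      then have "adjoint s u \<bullet> h = u \<bullet> x" "adjoint s u \<bullet> z = u \<bullet> y" using adj x(2) y(2) by auto
      moreover have "u \<bullet> x \<le> u \<bullet> y" using u x(1) y(1) unfolding cone_R_def inner_normal_cone_def by blast
      ultimately show "adjoint s u \<bullet> h \<le> adjoint s u \<bullet> z" by simp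
    qed
    then have "0 \<le> adjoint s u \<bullet> p m" using m unfolding dual_cone_def by blast
    then show ?thesis using adj[OF m(1)] by simp
  qed
  then show "m \<in> cone_monoid M (cone_R H)" using m unfolding cone_monoid_def dual_cone_def by auto
qed

lemma cone_monoid_Y_subset: "H \<in> vertex_sets \<Longrightarrow> cone_monoid M cone_Y \<subseteq> cone_monoid M (cone_R H)"
  unfolding cone_monoid_Y using cone_monoid_R L.cone_monoid_zero by auto

lemma section_cone_monoid: "H \<in> vertex_sets \<Longrightarrow> s ` cone_monoid \<Lambda> (cone_F H) \<subseteq> cone_monoid M (cone_R H)"
  using s cone_monoid_R unfolding cone_monoid_def by auto

sublocale f: toric_map M fan_R M fan_Y fan_R "\<lambda>x. x"
proof
  fix \<sigma> assume "\<sigma> \<in> fan_R"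
  then obtain A where A: "A \<noteq> {}" "A \<subseteq> verts" "\<sigma> = inner_normal_cone verts A" unfolding fan_R_eq by blast
  then obtain i where i: "i \<in> I" "A \<inter> T i \<noteq> {}" unfolding verts_def by blast
  have "inner_normal_cone (T i) (A \<inter> T i) \<in> fan_Y" unfolding fan_Y_eq[OF i(1)] using i by blast
  moreover have "\<sigma> \<subseteq> inner_normal_cone (T i) (A \<inter> T i)"
    unfolding A by (rule inner_normal_cone_antimono) (use i in \<open>auto simp: verts_def\<close>)
  ultimately show "\<exists>\<tau>\<in>fan_Y. (\<lambda>x. x) ` cone_monoid M \<tau> \<subseteq> cone_monoid M \<sigma>"
    using cone_monoid_antimono[of \<sigma> _ M] by auto
qed (auto simp: linear_id[unfolded id_def])

text \<open>The second projection of the trivialisation: a character \<open>l\<close> of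
  \<open>X_F\<close> pulls back to \<open>s l\<close>. The charts of the cones
  \<open>cone_R H\<close> suffice as its domain, since they cover the preimage of the torus by
  \<open>preimage_torus\<close>.\<close>

sublocale \<rho>: toric_map M fan_R \<Lambda> fan_F "cone_R ` vertex_sets" s
proof (intro toric_map.intro toric_map_axioms.intro R.separated_fan_axioms F.separated_fan_axioms s(1))
  show "cone_R ` vertex_sets \<subseteq> fan_R" using cone_R_mem by blast
  fix \<sigma> assume "\<sigma> \<in> cone_R ` vertex_sets"
  then show "\<exists>\<tau>\<in>fan_F. s ` cone_monoid \<Lambda> \<tau> \<subseteq> cone_monoid M \<sigma>"
    using cone_F_mem section_cone_monoid by blast
qed

text \<open>Two localisations are combined. The first, inside one \<open>R_i\<close>, shows that the
  available monomials in \<open>ker p\<close> are units at \<open>x\<close> because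
  \<open>f x\<close> is in the torus. The second, inside \<open>R\<close>, inverts one of them to
  enlarge \<open>A\<close> to all points of \<open>verts\<close> having the same image under
  \<open>p\<close> as some point of \<open>A\<close>.\<close>

lemma preimage_torus:
  assumes f: "f.induced f" and x: "x \<in> points (fan_toric_variety M fan_R)" and fx: "f x \<in> toric_chart M fan_Y cone_Y"
  shows "\<exists>H\<in>vertex_sets. x \<in> toric_chart M fan_R (cone_R H)"
proof -
  obtain \<sigma> where \<sigma>: "\<sigma> \<in> fan_R" "x \<in> toric_chart M fan_R \<sigma>" using x unfolding R.points_fan by blast
  then obtain A where A: "A \<noteq> {}" "A \<subseteq> verts" "\<sigma> = inner_normal_cone verts A" unfolding fan_R_eq by blast
  then obtain i a where i: "i \<in> I" and a: "a \<in> A" "a \<in> T i" unfolding verts_def by blast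
  define \<tau> where "\<tau> = inner_normal_cone (T i) (A \<inter> T i)"
  have \<tau>: "\<tau> \<in> fan_Y" unfolding \<tau>_def fan_Y_eq[OF i] using a by blast
  have \<sigma>\<tau>: "\<sigma> \<subseteq> \<tau>"
    unfolding A \<tau>_def by (rule inner_normal_cone_antimono) (use i in \<open>auto simp: verts_def\<close>)
  have sub: "(\<lambda>x. x) ` cone_monoid M \<tau> \<subseteq> cone_monoid M \<sigma>" using cone_monoid_antimono[OF \<sigma>\<tau>] by auto
  \<comment> \<open>Inverting this \<open>m\<close> passes from \<tau> to the least cone
    \<open>cone_Y\<close>; as \<open>a\<close> and \<open>b\<close> lie over the same point,
    \<open>p m = 0\<close>.\<close>
  define m where "m = (\<Sum>b\<in>T i. b - a)"
  have "m \<in> M" unfolding m_def using T(2)[OF i] a by (intro M.sum_closed M.diff_closed) auto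
  moreover have "p m = 0"
    unfolding m_def linear_sum[OF p(1)] using pT[OF i] a by (simp add: linear_diff[OF p(1)])
  moreover have "m \<in> dual_cone \<tau>"
    unfolding m_def \<tau>_def by (rule dual_cone_sum, rule diff_in_dual_normal_cone) (use a in auto)
  ultimately have m: "m \<in> cone_monoid M \<tau>" "m \<in> cone_monoid M cone_Y" "m \<in> M"
    unfolding cone_monoid_Y by (auto simp: cone_monoid_def)
  have unit: "toric_coord \<sigma> x \<kappa> \<noteq> 0" if \<kappa>: "\<kappa> \<in> cone_monoid M \<sigma>" "p \<kappa> = 0" for \<kappa>
  proof -
    have \<kappa>M: "- \<kappa> \<in> cone_monoid M cone_Y"
      using \<kappa> M.minus_closed linear_neg[OF p(1), of \<kappa>] unfolding cone_monoid_Y by (auto simp: cone_monoid_def)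
    then have "- \<kappa> \<in> dual_cone (inner_normal_cone (T i) ((A \<inter> T i) \<union> T i))"
      using cone_Y_eq[OF i] by (simp add: Int_absorb2 cone_monoid_def Un_absorb1)
    then obtain n :: nat where "- \<kappa> + real n *\<^sub>R m \<in> dual_cone \<tau>"
      using dual_normal_cone_localize[of "T i" "A \<inter> T i" "T i" "\<lambda>_. a" "- \<kappa>"] T(1)[OF i] a
      unfolding m_def \<tau>_def by blast
    moreover have "- \<kappa> + real n *\<^sub>R m \<in> M"
      by (intro M.add_closed M.nat_scale_closed m(3)) (use \<kappa>M in \<open>simp add: cone_monoid_def\<close>)
    ultimately have n: "- \<kappa> + real n *\<^sub>R m \<in> cone_monoid M \<tau>" by (simp add: cone_monoid_def)
    note nm = M.cone_monoid_scale[OF m(1), of n] M.cone_monoid_scale[OF m(2), of n]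
    have nm': "- (real n *\<^sub>R m) \<in> cone_monoid M cone_Y"
      using nm(2) M.minus_closed linear_neg[OF p(1)] unfolding cone_monoid_Y by simp
    \<comment> \<open>The complementary factor to \<kappa> is \<open>- \<kappa> + n m\<close>, which
      lies in the monoid of \<tau> and hence in that of \<sigma>. The product is the value at
      \<open>n m\<close>, which can be computed at \<open>f x\<close>, where the torus makes it
      nonzero.\<close>
    have "toric_coord \<sigma> x \<kappa> * toric_coord \<sigma> x (- \<kappa> + real n *\<^sub>R m) = toric_coord \<sigma> x (real n *\<^sub>R m)"
      using R.toric_coord_add[OF \<sigma> \<kappa>(1), of "- \<kappa> + real n *\<^sub>R m"] n sub by auto
    also have "\<dots> = toric_coord \<tau> (f x) (real n *\<^sub>R m)"
      using f.induced_coord[OF f \<sigma>(1) \<tau> sub \<sigma>(2) nm(1)] by simp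
    also have "\<dots> = toric_coord cone_Y (f x) (real n *\<^sub>R m)"
      by (rule Y.toric_coord_mono[OF cone_Y_mem \<tau> cone_Y_least[OF \<tau>] fx nm(1)])
    also have "\<dots> \<noteq> 0" by (rule M.affine_toric_unit[OF Y.toric_coord_affine[OF cone_Y_mem fx] nm(2) nm'])
    finally show ?thesis by auto
  qed
  define H where "H = p ` A"
  have H: "H \<in> vertex_sets" unfolding H_def vertex_sets_def using A by blast
  have AH: "A \<subseteq> over H" "over H \<subseteq> verts" unfolding H_def over_def using A by auto
  \<comment> \<open>The base point \<open>\<alpha> b\<close> varies with \<open>b\<close> so as to
    lie over the same point of \<Lambda>. This puts the monomial \<open>m0\<close> into
    \<open>ker p\<close>, which makes it a unit at \<open>x\<close>.\<close>
  have "\<forall>b\<in>over H. \<exists>a\<in>A. p a = p b" unfolding H_def over_def by auto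
  then obtain \<alpha> where \<alpha>: "\<And>b. b \<in> over H \<Longrightarrow> \<alpha> b \<in> A \<and> p (\<alpha> b) = p b" by metis
  define m0 where "m0 = (\<Sum>b\<in>over H. b - \<alpha> b)"
  have m0M: "m0 \<in> M" unfolding m0_def using \<alpha> A(2) AH(2) verts(2) by (intro M.sum_closed M.diff_closed) auto
  have m0: "m0 \<in> cone_monoid M \<sigma>"
    unfolding cone_monoid_def
  proof (intro IntI m0M)
    show "m0 \<in> dual_cone \<sigma>" unfolding m0_def A(3)
      by (rule dual_cone_sum, rule diff_in_dual_normal_cone) (use \<alpha> AH in auto)
  qed
  have "p m0 = 0" unfolding m0_def linear_sum[OF p(1)] using \<alpha> by (simp add: linear_diff[OF p(1)])
  then have m0_unit: "toric_coord \<sigma> x m0 \<noteq> 0" by (rule unit[OF m0])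
  have "cone_R H \<subseteq> \<sigma>" unfolding cone_R_def A by (rule inner_normal_cone_antimono[OF AH(1) order_refl])
  then have "x \<in> toric_chart M fan_R (cone_R H)"
  proof (rule R.toric_chart_localize[OF cone_R_mem[OF H] \<sigma>(1) _ \<sigma>(2) m0 m0_unit])
    fix d assume "d \<in> cone_monoid M (cone_R H)"
    then have "d \<in> M" "d \<in> dual_cone (inner_normal_cone verts (A \<union> over H))"
      using AH(1) unfolding cone_monoid_def cone_R_def by (auto simp: Un_absorb1)
    then show "\<exists>n::nat. d + real n *\<^sub>R m0 \<in> cone_monoid M \<sigma>"
      using dual_normal_cone_localize[OF verts(1) A(2) AH(2), of \<alpha> d] \<alpha> M.add_closed M.nat_scale_closed[OF m0M]
      unfolding m0_def cone_monoid_def A(3) by auto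
  qed
  then show ?thesis using H by blast
qed

text \<open>The decomposition of \<open>m\<close> into \<open>m - s (p m)\<close> and
  \<open>s (p m)\<close> assigns the first summand to the torus of \<open>Y\<close> and the second
  to \<open>X_F\<close>; this dictates the formula for the coordinates of \<psi>.\<close>

lemma trivialization_exists:
  "\<exists>\<psi> :: ('a, 'k::field) toric_point \<times> ('b, 'k) toric_point \<Rightarrow> ('a, 'k) toric_point.
     \<forall>H\<in>vertex_sets. \<forall>y\<in>toric_chart M fan_Y cone_Y. \<forall>z\<in>toric_chart \<Lambda> fan_F (cone_F H).
       \<psi> (y, z) \<in> toric_chart M fan_R (cone_R H) \<and>
       (\<forall>m\<in>cone_monoid M (cone_R H). toric_coord (cone_R H) (\<psi> (y, z)) m =
          toric_coord cone_Y y (m - s (p m)) * toric_coord (cone_F H) z (p m))"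
proof -
  define \<gamma> :: "('a, 'k) toric_point \<Rightarrow> ('b, 'k) toric_point \<Rightarrow> 'b set \<Rightarrow> 'a \<Rightarrow> 'k"
    where "\<gamma> y z H m = toric_coord cone_Y y (m - s (p m)) * toric_coord (cone_F H) z (p m)" for y z H m
  define P where "P y z = {(cone_R H, restrict (\<gamma> y z H) (cone_monoid M (cone_R H))) | H.
     H \<in> vertex_sets \<and> z \<in> toric_chart \<Lambda> fan_F (cone_F H)}" for y z
  have ex: "\<exists>x. \<forall>(\<sigma>, \<eta>)\<in>P y z. x \<in> toric_chart M fan_R \<sigma> \<and> toric_coord \<sigma> x = \<eta>"
    if y: "y \<in> toric_chart M fan_Y cone_Y" for y z
  proof (rule R.toric_point_exists)
    fix a b assume "a \<in> P y z" "b \<in> P y z"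
    then obtain H K where
      H: "a = (cone_R H, restrict (\<gamma> y z H) (cone_monoid M (cone_R H)))" "H \<in> vertex_sets"
         "z \<in> toric_chart \<Lambda> fan_F (cone_F H)" and
      K: "b = (cone_R K, restrict (\<gamma> y z K) (cone_monoid M (cone_R K)))" "K \<in> vertex_sets"
         "z \<in> toric_chart \<Lambda> fan_F (cone_F K)"
      unfolding P_def by auto
    note HK = vertex_sets_Un[OF H(2) K(2)]
    \<comment> \<open>Two charts through \<open>z\<close> meet in the chart of
      \<open>H \<union> K\<close>, so \<gamma> for \<open>H \<union> K\<close> is the common
      extension that the gluing requires.\<close>
    have z: "z \<in> toric_chart \<Lambda> fan_F (cone_F (H \<union> K))"
      unfolding cone_F_Un by (rule F.toric_chart_Int[OF cone_F_mem[OF H(2)] cone_F_mem[OF K(2)] H(3) K(3)])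
    show "(a, b) \<in> toric_glue M fan_R"
      unfolding H(1) K(1)
    proof (rule R.toric_glueI[OF cone_R_mem[OF H(2)] cone_R_mem[OF K(2)], of "\<gamma> y z (H \<union> K)"])
      show "\<gamma> y z (H \<union> K) 0 = 1"
        unfolding \<gamma>_def using Y.toric_coord_zero[OF cone_Y_mem y] F.toric_coord_zero[OF cone_F_mem[OF HK] z]
        by (simp add: linear_0[OF p(1)] linear_0[OF s(1)])
      show "\<gamma> y z (H \<union> K) (d + e) = \<gamma> y z (H \<union> K) d * \<gamma> y z (H \<union> K) e"
        if "d \<in> cone_monoid M (cone_R H \<inter> cone_R K)" "e \<in> cone_monoid M (cone_R H \<inter> cone_R K)" for d e
      proof -
        have d: "d \<in> M" "p d \<in> cone_monoid \<Lambda> (cone_F (H \<union> K))" and e: "e \<in> M" "p e \<in> cone_monoid \<Lambda> (cone_F (H \<union> K))"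
          using that unfolding cone_R_Un[symmetric] cone_monoid_R[OF HK] by auto
        have split: "d + e - s (p (d + e)) = (d - s (p d)) + (e - s (p e))"
          by (simp add: linear_add[OF p(1)] linear_add[OF s(1)])
        then show ?thesis
          unfolding \<gamma>_def
          unfolding split Y.toric_coord_add[OF cone_Y_mem y kernel_part[OF d(1)] kernel_part[OF e(1)]]
          unfolding linear_add[OF p(1)] F.toric_coord_add[OF cone_F_mem[OF HK] z d(2) e(2)] by simp
      qed
      show "\<gamma> y z H d = \<gamma> y z (H \<union> K) d" if "d \<in> cone_monoid M (cone_R H)" for d
        unfolding \<gamma>_def using that F.toric_coord_mono[OF cone_F_mem[OF HK] cone_F_mem[OF H(2)] _ z, of "p d"]
        unfolding cone_monoid_R[OF H(2)] cone_F_Un by auto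
      show "\<gamma> y z K d = \<gamma> y z (H \<union> K) d" if "d \<in> cone_monoid M (cone_R K)" for d
        unfolding \<gamma>_def using that F.toric_coord_mono[OF cone_F_mem[OF HK] cone_F_mem[OF K(2)] _ z, of "p d"]
        unfolding cone_monoid_R[OF K(2)] cone_F_Un by auto
    qed
  qed
  have "\<forall>q. \<exists>x. fst q \<in> toric_chart M fan_Y cone_Y \<longrightarrow>
      (\<forall>(\<sigma>, \<eta>)\<in>P (fst q) (snd q). x \<in> toric_chart M fan_R \<sigma> \<and> toric_coord \<sigma> x = \<eta>)"
    using ex by blast
  from choice[OF this] obtain \<psi> where \<psi>: "\<forall>q. fst q \<in> toric_chart M fan_Y cone_Y \<longrightarrow>
      (\<forall>(\<sigma>, \<eta>)\<in>P (fst q) (snd q). \<psi> q \<in> toric_chart M fan_R \<sigma> \<and> toric_coord \<sigma> (\<psi> q) = \<eta>)"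
    by (rule exE)
  show ?thesis
  proof (intro exI[of _ \<psi>] ballI)
    fix H and y :: "('a, 'k) toric_point" and z :: "('b, 'k) toric_point"
    assume H: "H \<in> vertex_sets" and y: "y \<in> toric_chart M fan_Y cone_Y"
      and z: "z \<in> toric_chart \<Lambda> fan_F (cone_F H)"
    have "(cone_R H, restrict (\<gamma> y z H) (cone_monoid M (cone_R H))) \<in> P y z" unfolding P_def using H z by blast
    then have "\<psi> (y, z) \<in> toric_chart M fan_R (cone_R H)"
      "toric_coord (cone_R H) (\<psi> (y, z)) = restrict (\<gamma> y z H) (cone_monoid M (cone_R H))"
      using \<psi>[rule_format, of "(y, z)"] y by auto
    then show "\<psi> (y, z) \<in> toric_chart M fan_R (cone_R H) \<and>
       (\<forall>m\<in>cone_monoid M (cone_R H). toric_coord (cone_R H) (\<psi> (y, z)) m =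
          toric_coord cone_Y y (m - s (p m)) * toric_coord (cone_F H) z (p m))"
      by (simp add: \<gamma>_def)
  qed
qed

end

section \<open>The toric morphism and its generic fiber\<close>

context cayley_fibration
begin

text \<open>On the tori, \<open>f\<close> restricts a homomorphism from the characters of the torus
  of \<open>X_R\<close> to those in \<open>ker p\<close>, and restriction commutes with pointwise
  products.\<close>

lemma toric_morphism_induced:
  fixes f :: "('a, 'k::field) toric_point \<Rightarrow> ('a, 'k) toric_point"
  assumes f: "f.induced f"
  shows "toric_morphism (fan_toric_variety M fan_R) (fan_toric_variety M fan_Y) f"
  unfolding toric_morphism_def
proof
  let ?X = "fan_toric_variety M fan_R :: (('a, 'k) toric_point, 'k) toric_variety"
  have "variety_morphism (open_subvariety ?X (points ?X)) (fan_toric_variety M fan_Y) f"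
    by (rule f.variety_morphism_induced[OF f openin_topspace]) (simp add: R.points_fan)
  then show "variety_morphism ?X (fan_toric_variety M fan_Y) f"
    by (subst (asm) variety_morphism_cong[of _ ?X]) (auto simp: open_subvariety_def)
  let ?o = "\<Inter>fan_R"
  have sub: "(\<lambda>x. x) ` cone_monoid M cone_Y \<subseteq> cone_monoid M ?o"
    using cone_monoid_antimono[OF Inter_fan_R_subset, of M] by simp
  note fch = f.induced_chart[OF f Inter_fan_R_mem cone_Y_mem sub]
    and fco = f.induced_coord[OF f Inter_fan_R_mem cone_Y_mem sub]
  show "f \<in> hom (torus ?X) (torus (fan_toric_variety M fan_Y))"
  proof (rule homI)
    fix x assume "x \<in> carrier (torus ?X)"
    then show "f x \<in> carrier (torus (fan_toric_variety M fan_Y))"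
      using fch by (simp add: fan_toric_variety_def fan_torus_def Let_def Inter_fan_Y)
    fix y assume "y \<in> carrier (torus ?X)"
    with \<open>x \<in> carrier (torus ?X)\<close>
    have x: "x \<in> toric_chart M fan_R ?o" and y: "y \<in> toric_chart M fan_R ?o"
      by (simp_all add: fan_toric_variety_def fan_torus_def Let_def)
    let ?z = "toric_pt M fan_R ?o (\<lambda>m\<in>cone_monoid M ?o. toric_coord ?o x m * toric_coord ?o y m)"
    let ?w = "toric_pt M fan_Y cone_Y
      (\<lambda>m\<in>cone_monoid M cone_Y. toric_coord cone_Y (f x) m * toric_coord cone_Y (f y) m)"
    note z = R.toric_chart_prod[OF Inter_fan_R_mem x y]
    have "f ?z = ?w"
    proof (rule Y.toric_chart_eqI[OF cone_Y_mem fch[OF z] Y.toric_chart_prod[OF cone_Y_mem fch[OF x] fch[OF y]]])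
      fix d assume d: "d \<in> cone_monoid M cone_Y"
      then have "d \<in> cone_monoid M ?o" using sub by auto
      then show "toric_coord cone_Y (f ?z) d = toric_coord cone_Y ?w d"
        unfolding fco[OF z d] Y.toric_coord_prod[OF cone_Y_mem fch[OF x] fch[OF y] d] fco[OF x d] fco[OF y d]
        by (rule R.toric_coord_prod[OF Inter_fan_R_mem x y])
    qed
    then show "f (x \<otimes>\<^bsub>torus ?X\<^esub> y) = f x \<otimes>\<^bsub>torus (fan_toric_variety M fan_Y)\<^esub> f y"
      by (simp add: fan_toric_variety_def fan_torus_def Let_def Inter_fan_Y)
  qed
qed

text \<open>Over the torus of \<open>Y\<close> the inverse of \<psi> is the pair of \<open>f\<close>
  and \<rho>. Every composite is compared with the identity on the coordinates of one chart, since
  these determine a point of the chart.\<close>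

lemma generic_fiber_induced:
  fixes f :: "('a, 'k::field) toric_point \<Rightarrow> ('a, 'k) toric_point"
  assumes f: "f.induced f"
  shows "has_generic_fiber (fan_toric_variety M fan_R) (fan_toric_variety M fan_Y) f
    (fan_toric_variety \<Lambda> fan_F :: (('b, 'k) toric_point, 'k) toric_variety)"
proof -
  let ?X = "fan_toric_variety M fan_R :: (('a, 'k) toric_point, 'k) toric_variety"
  let ?Y = "fan_toric_variety M fan_Y :: (('a, 'k) toric_point, 'k) toric_variety"
  let ?F = "fan_toric_variety \<Lambda> fan_F :: (('b, 'k) toric_point, 'k) toric_variety"
  define U :: "('a, 'k) toric_point set" where "U = toric_chart M fan_Y cone_Y"
  define W where "W = points ?X \<inter> f -` U"
  obtain \<rho> :: "('a, 'k) toric_point \<Rightarrow> ('b, 'k) toric_point" where \<rho>: "\<rho>.induced \<rho>"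
    using \<rho>.induced_exists by blast
  obtain \<psi> :: "('a, 'k) toric_point \<times> ('b, 'k) toric_point \<Rightarrow> ('a, 'k) toric_point" where
    \<psi>: "\<forall>H\<in>vertex_sets. \<forall>y\<in>toric_chart M fan_Y cone_Y. \<forall>z\<in>toric_chart \<Lambda> fan_F (cone_F H).
       \<psi> (y, z) \<in> toric_chart M fan_R (cone_R H) \<and>
       (\<forall>m\<in>cone_monoid M (cone_R H). toric_coord (cone_R H) (\<psi> (y, z)) m =
          toric_coord cone_Y y (m - s (p m)) * toric_coord (cone_F H) z (p m))"
    using trivialization_exists by (rule exE)
  have \<psi>_chart: "\<psi> (y, z) \<in> toric_chart M fan_R (cone_R H)"
    and \<psi>_coord: "m \<in> cone_monoid M (cone_R H) \<Longrightarrow> toric_coord (cone_R H) (\<psi> (y, z)) m =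
          toric_coord cone_Y y (m - s (p m)) * toric_coord (cone_F H) z (p m)"
    if "H \<in> vertex_sets" "y \<in> U" "z \<in> toric_chart \<Lambda> fan_F (cone_F H)" for H y z m
    using \<psi> that unfolding U_def by blast+
  have Y_sub: "(\<lambda>x. x) ` cone_monoid M cone_Y \<subseteq> cone_monoid M (cone_R H)" if "H \<in> vertex_sets" for H
    using cone_monoid_Y_subset[OF that] by simp
  have f_chart: "f x \<in> U"
    and f_coord: "d \<in> cone_monoid M cone_Y \<Longrightarrow> toric_coord cone_Y (f x) d = toric_coord (cone_R H) x d"
    if "H \<in> vertex_sets" "x \<in> toric_chart M fan_R (cone_R H)" for H x d
    using f.induced_chart[OF f cone_R_mem cone_Y_mem Y_sub] f.induced_coord[OF f cone_R_mem cone_Y_mem Y_sub] that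
    unfolding U_def by blast+
  have \<rho>_chart: "\<rho> x \<in> toric_chart \<Lambda> fan_F (cone_F H)"
    and \<rho>_coord: "d \<in> cone_monoid \<Lambda> (cone_F H) \<Longrightarrow> toric_coord (cone_F H) (\<rho> x) d = toric_coord (cone_R H) x (s d)"
    if "H \<in> vertex_sets" "x \<in> toric_chart M fan_R (cone_R H)" for H x d
    using \<rho>.induced_chart[OF \<rho> _ cone_F_mem section_cone_monoid] \<rho>.induced_coord[OF \<rho> _ cone_F_mem section_cone_monoid]
      that by blast+
  have W_charts: "\<exists>H\<in>vertex_sets. x \<in> toric_chart M fan_R (cone_R H)" if "x \<in> W" for x
    using preimage_torus[OF f] that unfolding W_def U_def by blast
  have points_F: "\<exists>H\<in>vertex_sets. z \<in> toric_chart \<Lambda> fan_F (cone_F H)" if "z \<in> points ?F" for z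
    using that unfolding F.points_fan unfolding fan_F_eq by blast
  interpret FX: function_space ?X by (rule R.function_space_fan)
  interpret FY: function_space ?Y by (rule Y.function_space_fan)
  interpret FF: function_space ?F by (rule F.function_space_fan)
  have U: "openin (zariski ?Y) U" unfolding U_def by (rule Y.openin_toric_chart[OF cone_Y_mem])
  \<comment> \<open>The identity element shows that the torus of \<open>Y\<close> is not
    empty.\<close>
  have "restrict (\<lambda>_. 1 :: 'k) (cone_monoid M cone_Y) \<in> affine_toric M cone_Y"
    by (rule M.affine_toricI) auto
  then have U_nonempty: "U \<noteq> {}" unfolding U_def using Y.toric_chart_pt[OF cone_Y_mem] by blast
  have f_morphism: "variety_morphism ?X ?Y f"
    using toric_morphism_induced[OF f] unfolding toric_morphism_def by blast
  then have W: "openin (zariski ?X) W"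
    unfolding W_def variety_morphism_def using openin_vimage_continuous_map U by blast
  let ?YU = "open_subvariety ?Y U" and ?XW = "open_subvariety ?X W"
  interpret P: product_of_function_spaces ?YU ?F
    by (intro product_of_function_spaces.intro FY.function_space_open_subvariety U F.function_space_fan)
  have U_sub: "U \<subseteq> points ?Y" and W_sub: "W \<subseteq> points ?X" using U W openin_subset by blast+
  have points_P: "points (variety_product ?YU ?F) = U \<times> points ?F"
    using P.points_product U_sub by (simp add: points_open_subvariety Int_absorb1)
  have points_XW: "points ?XW = W"
    using W_sub by (simp add: points_open_subvariety Int_absorb1)
  have f_\<psi>: "f (\<psi> (y, z)) = y" if y: "y \<in> U" and z: "z \<in> points ?F" for y z
  proof -
    obtain H where H: "H \<in> vertex_sets" "z \<in> toric_chart \<Lambda> fan_F (cone_F H)" using points_F[OF z] by blast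
    note \<psi>H = \<psi>_chart[OF H(1) y H(2)]
    show ?thesis
    proof (rule Y.toric_chart_eqI[OF cone_Y_mem f_chart[OF H(1) \<psi>H, unfolded U_def] y[unfolded U_def]])
      fix d assume d: "d \<in> cone_monoid M cone_Y"
      \<comment> \<open>For such \<open>d\<close> the factor of \<open>z\<close> is its value at 0,
        which is 1, and the factor of \<open>y\<close> is its value at \<open>d\<close>
        itself.\<close>
      then have "p d = 0" "d \<in> cone_monoid M (cone_R H)"
        using cone_monoid_Y cone_monoid_Y_subset[OF H(1)] by auto
      then show "toric_coord cone_Y (f (\<psi> (y, z))) d = toric_coord cone_Y y d"
        unfolding f_coord[OF H(1) \<psi>H d] using \<psi>_coord[OF H(1) y H(2)]
        by (simp add: linear_0[OF s(1)] F.toric_coord_zero[OF cone_F_mem[OF H(1)] H(2)])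
    qed
  qed
  have \<rho>_\<psi>: "\<rho> (\<psi> (y, z)) = z" if y: "y \<in> U" and z: "z \<in> points ?F" for y z
  proof -
    obtain H where H: "H \<in> vertex_sets" "z \<in> toric_chart \<Lambda> fan_F (cone_F H)" using points_F[OF z] by blast
    note \<psi>H = \<psi>_chart[OF H(1) y H(2)]
    show ?thesis
    proof (rule F.toric_chart_eqI[OF cone_F_mem[OF H(1)] \<rho>_chart[OF H(1) \<psi>H] H(2)])
      fix d assume d: "d \<in> cone_monoid \<Lambda> (cone_F H)"
      \<comment> \<open>Here \<open>s d - s (p (s d)) = 0\<close>, so the factor of \<open>y\<close>
        is 1 and only the value of \<open>z\<close> at \<open>d\<close> remains.\<close>
      then have "p (s d) = d" "s d \<in> cone_monoid M (cone_R H)"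
        using s(3) section_cone_monoid[OF H(1)] by (auto simp: cone_monoid_def)
      then show "toric_coord (cone_F H) (\<rho> (\<psi> (y, z))) d = toric_coord (cone_F H) z d"
        unfolding \<rho>_coord[OF H(1) \<psi>H d] using \<psi>_coord[OF H(1) y H(2)] y
        by (simp add: U_def Y.toric_coord_zero[OF cone_Y_mem])
    qed
  qed
  have \<psi>_f\<rho>: "\<psi> (f x, \<rho> x) = x" if x: "x \<in> W" for x
  proof -
    obtain H where H: "H \<in> vertex_sets" "x \<in> toric_chart M fan_R (cone_R H)" using W_charts[OF x] by blast
    note fx = f_chart[OF H] and \<rho>x = \<rho>_chart[OF H]
    show ?thesis
    proof (rule R.toric_chart_eqI[OF cone_R_mem[OF H(1)] \<psi>_chart[OF H(1) fx \<rho>x] H(2)])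
      fix d assume d: "d \<in> cone_monoid M (cone_R H)"
      then have d': "d \<in> M" "p d \<in> cone_monoid \<Lambda> (cone_F H)" unfolding cone_monoid_R[OF H(1)] by auto
      \<comment> \<open>\<open>f\<close> records the value at the first element and \<rho> the value
        at the second; multiplicativity of the coordinates of \<open>x\<close> reassembles the value
        at \<open>d\<close>.\<close>
      have "d - s (p d) \<in> cone_monoid M (cone_R H)" "s (p d) \<in> cone_monoid M (cone_R H)"
        using kernel_part[OF d'(1)] cone_monoid_Y_subset[OF H(1)] section_cone_monoid[OF H(1)] d'(2) by auto
      then show "toric_coord (cone_R H) (\<psi> (f x, \<rho> x)) d = toric_coord (cone_R H) x d"
        unfolding \<psi>_coord[OF H(1) fx \<rho>x d] f_coord[OF H kernel_part[OF d'(1)]] \<rho>_coord[OF H d'(2)]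
        using R.toric_coord_add[OF cone_R_mem[OF H(1)] H(2), of "d - s (p d)" "s (p d)"] by simp
    qed
  qed
  have "variety_morphism (variety_product ?YU ?F) ?X \<psi>"
  proof (rule R.variety_morphism_into_fan[OF P.function_space_product])
    fix q assume "q \<in> points (variety_product ?YU ?F)"
    then obtain y z where q: "q = (y, z)" "y \<in> U" "z \<in> points ?F" unfolding points_P by auto
    obtain H where H: "H \<in> vertex_sets" "z \<in> toric_chart \<Lambda> fan_F (cone_F H)" using points_F[OF q(3)] by blast
    let ?V = "toric_chart \<Lambda> fan_F (cone_F H) :: ('b, 'k) toric_point set"
    have UU: "openin (zariski ?YU) U" unfolding open_subvariety_def by (simp add: openin_open_subtopology[OF U] U)
    have V: "openin (zariski ?F) ?V" by (rule F.openin_toric_chart[OF cone_F_mem[OF H(1)]])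
    note UV = P.openin_product[OF UU V]
    \<comment> \<open>On the rectangle \<open>U \<times> ?V\<close> each coordinate of \<psi> is an
      elementary tensor of a coordinate on the torus of \<open>Y\<close> and one on the chart of
      \<open>X_F\<close>.\<close>
    have "(\<lambda>q. toric_coord (cone_R H) (\<psi> q) m) \<in> regular (variety_product ?YU ?F) (U \<times> ?V)"
      if m: "m \<in> cone_monoid M (cone_R H)" for m
    proof -
      have m': "m \<in> M" "p m \<in> cone_monoid \<Lambda> (cone_F H)" using m unfolding cone_monoid_R[OF H(1)] by auto
      have a: "(\<lambda>y. toric_coord cone_Y y (m - s (p m))) \<in> regular ?YU U"
        using Y.regular_toric_coord[OF cone_Y_mem kernel_part[OF m'(1)]] by (simp add: open_subvariety_def U_def)
      have b: "(\<lambda>z. toric_coord (cone_F H) z (p m)) \<in> regular ?F ?V"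
        by (rule F.regular_toric_coord[OF cone_F_mem[OF H(1)] m'(2)])
      show ?thesis
        by (rule function_space.regular_cong[OF P.function_space_product P.regular_product[OF UU V a b] UV])
          (use \<psi>_coord[OF H(1) _ _ m] in auto)
    qed
    then show "\<exists>\<sigma>\<in>fan_R. \<exists>N. openin (zariski (variety_product ?YU ?F)) N \<and> q \<in> N \<and>
        \<psi> ` N \<subseteq> toric_chart M fan_R \<sigma> \<and>
        (\<forall>m\<in>cone_monoid M \<sigma>. (\<lambda>q. toric_coord \<sigma> (\<psi> q) m) \<in> regular (variety_product ?YU ?F) N)"
      using UV q H \<psi>_chart[OF H(1)] cone_R_mem[OF H(1)]
      by (intro bexI[of _ "cone_R H"] exI[of _ "U \<times> ?V"]) auto
  qed
  moreover have "\<psi> ` points (variety_product ?YU ?F) \<subseteq> W"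
  proof
    fix x assume "x \<in> \<psi> ` points (variety_product ?YU ?F)"
    then obtain y z where x: "x = \<psi> (y, z)" "y \<in> U" "z \<in> points ?F" unfolding points_P by auto
    obtain H where H: "H \<in> vertex_sets" "z \<in> toric_chart \<Lambda> fan_F (cone_F H)" using points_F[OF x(3)] by blast
    have "x \<in> points ?X" unfolding R.points_fan x(1) using \<psi>_chart[OF H(1) x(2) H(2)] cone_R_mem[OF H(1)] by blast
    then show "x \<in> W" unfolding W_def using f_\<psi>[OF x(2,3)] x by simp
  qed
  ultimately have \<psi>_morphism: "variety_morphism (variety_product ?YU ?F) ?XW \<psi>"
    by (intro variety_morphism_into_open W)
  have "variety_morphism ?XW ?Y f"
    by (rule f.variety_morphism_induced[OF f W]) (use W_sub in \<open>auto simp: R.points_fan\<close>)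
  then have 1: "variety_morphism ?XW ?YU f"
    by (rule variety_morphism_into_open[OF _ U]) (unfold points_XW, auto simp: W_def)
  have 2: "variety_morphism ?XW ?F \<rho>"
    by (rule \<rho>.variety_morphism_induced[OF \<rho> W]) (use W_charts in auto)
  have inverse_morphism: "variety_morphism ?XW (variety_product ?YU ?F) (\<lambda>x. (f x, \<rho> x))"
    by (rule P.variety_morphism_pair[OF FX.function_space_open_subvariety[OF W] 1 2])
  have "variety_isomorphism (variety_product ?YU ?F) ?XW \<psi>"
    unfolding variety_isomorphism_def
  proof (intro conjI exI[of _ "\<lambda>x. (f x, \<rho> x)"] \<psi>_morphism inverse_morphism ballI)
    show "(f (\<psi> q), \<rho> (\<psi> q)) = q" if "q \<in> points (variety_product ?YU ?F)" for q
      using that f_\<psi> \<rho>_\<psi> unfolding points_P by auto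
    show "\<psi> (f x, \<rho> x) = x" if "x \<in> points ?XW" for x
      using that \<psi>_f\<rho> unfolding points_XW by blast
  qed
  then show ?thesis
    unfolding has_generic_fiber_def W_def using U U_nonempty f_\<psi>
    by (intro exI[of _ U] exI[of _ \<psi>] conjI ballI) auto
qed

end

theorem theorem1p2:
  fixes M :: "'a::euclidean_space set" and \<Lambda> :: "'b::euclidean_space set"
    and \<pi> \<pi>\<^sub>R :: "'a \<Rightarrow> 'b"
    and k j :: nat and Rs :: "nat \<Rightarrow> 'a set" and R :: "'a set" and F :: "'b set"
    and X\<^sub>R Y :: "(('a, 'k::alg_closed_field) toric_point, 'k) toric_variety"
    and X\<^sub>F :: "(('b, 'k) toric_point, 'k) toric_variety"
  assumes "is_lattice M" and "is_lattice \<Lambda>"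
    and "lattice_surjection M \<Lambda> \<pi>" and "is_real_extension M \<pi> \<pi>\<^sub>R"
    and "generalized_twisted_Cayley_sum M \<Lambda> \<pi>\<^sub>R k Rs R"
    and full_dim: "\<forall>i\<in>{1..k}. aff_dim (Rs i) = int (dim {x \<in> span M. \<pi>\<^sub>R x = 0})"
    and "F = \<pi>\<^sub>R ` R"
    and "j \<in> {1..k}"
    and "X\<^sub>R = polytope_toric_variety M R"
    and "Y = polytope_toric_variety M (Rs j)"
    and "X\<^sub>F = polytope_toric_variety \<Lambda> F"
  shows "\<exists>f. toric_morphism X\<^sub>R Y f \<and> has_generic_fiber X\<^sub>R Y f X\<^sub>F"
proof -
  have lin: "linear \<pi>\<^sub>R" and im: "\<pi>\<^sub>R ` M = \<Lambda>"
    using assms(3,4) unfolding lattice_surjection_def is_real_extension_def by auto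
  note M = additive_subgroup_lattice[OF assms(1)] and \<Lambda> = additive_subgroup_lattice[OF assms(2)]
  obtain s where s: "linear s" "s ` \<Lambda> \<subseteq> M" "\<And>l. l \<in> \<Lambda> \<Longrightarrow> \<pi>\<^sub>R (s l) = l"
    using lattice_section[OF assms(2) M lin im] by blast
  note cayley = assms(5)[unfolded generalized_twisted_Cayley_sum_def]
  have "\<forall>i\<in>{1..k}. \<exists>S. finite S \<and> S \<subseteq> M \<and> Rs i = convex hull S"
    using cayley unfolding lattice_polytope_def by blast
  then obtain T where T: "\<And>i. i \<in> {1..k} \<Longrightarrow> finite (T i) \<and> T i \<subseteq> M \<and> Rs i = convex hull (T i)"
    by metis
  have "\<forall>i\<in>{1..k}. \<exists>v. \<pi>\<^sub>R ` Rs i = {v}" using cayley by blast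
  then obtain v where v: "\<And>i. i \<in> {1..k} \<Longrightarrow> \<pi>\<^sub>R ` Rs i = {v i}" by metis
  \<comment> \<open>The image of \<open>Rs i\<close> is a singleton, which excludes the empty
    polytope.\<close>
  have nonempty: "T i \<noteq> {}" if "i \<in> {1..k}" for i using v[OF that] T[OF that] by auto
  have const: "\<pi>\<^sub>R x = v i" if i: "i \<in> {1..k}" and x: "x \<in> T i" for i x
  proof -
    have "x \<in> Rs i" using T[OF i] x by (simp add: hull_inc)
    then show ?thesis using v[OF i] by blast
  qed
  interpret C: cayley_fibration M \<Lambda> \<pi>\<^sub>R s "{1..k}" T v j
  proof (intro cayley_fibration.intro cayley_fibration_axioms.intro M \<Lambda> lin s const assms(8))
    show "\<pi>\<^sub>R ` M \<subseteq> \<Lambda>" using im by simp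
    fix i assume i: "i \<in> {1..k}"
    show "finite (T i)" "T i \<subseteq> M" "T i \<noteq> {}" using T[OF i] nonempty[OF i] by auto
    have "normally_equivalent (Rs i) (Rs j)" using cayley i assms(8) by blast
    then show "inner_normal_fan (convex hull T i) = inner_normal_fan (convex hull T j)"
      using T[OF i] T[OF assms(8)] unfolding normally_equivalent_def by simp
    \<comment> \<open>Here \<open>full_dim\<close> is turned into the description of the least cone;
      \<open>a\<close> serves as the origin of the fiber polytope.\<close>
    obtain a where "a \<in> T i" using nonempty[OF i] by blast
    then show "cone_monoid M (inner_normal_cone (T i) (T i)) = {m \<in> M. \<pi>\<^sub>R m = 0}"
      using T[OF i] full_dim[rule_format, OF i] const[OF i]
      by (intro cone_monoid_fiber_polytope[OF lin, of "T i" M a "v i"]) (auto simp: aff_dim_convex_hull)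
  qed auto
  have "(\<Union>i\<in>{1..k}. Rs i) = (\<Union>i\<in>{1..k}. convex hull T i)" using T by auto
  then have "R = convex hull (\<Union>i\<in>{1..k}. convex hull T i)" using cayley by simp
  also have "\<dots> = convex hull C.verts"
  proof (intro antisym hull_minimal convex_convex_hull)
    show "(\<Union>i\<in>{1..k}. convex hull T i) \<subseteq> convex hull C.verts"
      unfolding C.verts_def by (intro UN_least hull_mono) blast
    show "C.verts \<subseteq> convex hull (\<Union>i\<in>{1..k}. convex hull T i)"
      unfolding C.verts_def by (intro UN_least) (meson UN_upper hull_subset subset_trans)
  qed
  finally have R: "R = convex hull C.verts" .
  have F: "F = convex hull (\<pi>\<^sub>R ` C.verts)"
    unfolding assms(7) R by (rule convex_hull_linear_image[OF lin])
  obtain f :: "('a, 'k) toric_point \<Rightarrow> ('a, 'k) toric_point" where f: "C.f.induced f"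
    using C.f.induced_exists by blast
  have "X\<^sub>R = fan_toric_variety M C.fan_R" "Y = fan_toric_variety M C.fan_Y" "X\<^sub>F = fan_toric_variety \<Lambda> C.fan_F"
    unfolding assms(9-11) polytope_toric_variety_def C.fan_R_def C.fan_Y_def C.fan_F_def R F
    using T[OF assms(8)] by auto
  with C.toric_morphism_induced[OF f] C.generic_fiber_induced[OF f]
  have "toric_morphism X\<^sub>R Y f \<and> has_generic_fiber X\<^sub>R Y f X\<^sub>F" by (simp only: simp_thms)
  then show ?thesis by (rule exI[of _ f])
qed

end
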